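(* Let $\mathcal B$ be a linearly ordered set, $N:\mathcal B\times\mathcal B\to\mathbb Z$ a symmetric function, and $\mathfrak F_N(\mathcal B)$ the free vertex algebra generated by $\mathcal B$ with respect to the locality bound $N$. Let $\lambda=\sum_{a\in\mathcal B}s_a a\in\mathbb Z_+[\mathcal B]$ and $d\in\frac12\mathbb Z$. Then the dimension of the homogeneous component $\mathfrak F_N(\mathcal B)_{\lambda,d}$ is equal to the number of $\mathcal B$-colored partitions of $d-d_{\min}(\lambda)$ that contain at most $s_a$ terms of each color $a\in\mathcal B$.
   Context: All spaces are over a field $\Bbbk$ of characteristic $0$; $\mathbb Z_+=\{n\in\mathbb Z: n\ge0\}$; $\mathbb Z_+[\mathcal B]$ is the free abelian monoid on $\mathcal B$. A vertex algebra is a superspace $A=A_{\bar0}\oplus A_{\bar1}$ with even bilinear products $(a,b)\mapsto a_{(n)}b$, $n\in\mathbb Z$, and a distinguished even element $\mathbf 1$. Put $Da=a_{(-2)}\mathbf 1$, $D^{(k)}=\frac1{k!}D^k$, $Y(a)(z)=\sum_{n\in\mathbb Z}a_{(n)}z^{-n-1}$, where $a_{(n)}$ is viewed as an operator on $A$. Axioms: (V1) $a_{(n)}b=0$ for $n\gg0$; (V2) $\mathbf 1_{(n)}a=\delta_{n,-1}a$, $a_{(n)}\mathbf 1=0$ for $n\ge0$ and $a_{(n)}\mathbf 1=D^{(-n-1)}a$ for $n<0$; (V3) $(Da)_{(n)}b=-n\,a_{(n-1)}b$ and $a_{(n)}(Db)=n\,a_{(n-1)}b+D(a_{(n)}b)$;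 (V4) locality: for parity-homogeneous $a,b$ there is $M\in\mathbb Z$ such that $Y(a)(w)Y(b)(z)\,\iota_{w,z}(w-z)^M=(-1)^{p(a)p(b)}Y(b)(z)Y(a)(w)\,\iota_{z,w}(w-z)^M$, where $p$ is the parity and $\iota_{w,z}$ (resp. $\iota_{z,w}$) means expansion in nonnegative powers of $z$ (resp. of $w$). Homomorphisms preserve $\mathbf 1$ and all products. Free vertex algebra: for a set $\mathcal B$ and a symmetric $N:\mathcal B\times\mathcal B\to\mathbb Z$, $\mathfrak F_N(\mathcal B)$ is the vertex algebra generated by $\mathcal B$, where $a\in\mathcal B$ has parity $N(a,a)\bmod 2$ and $a_{(n)}b=0$ for $a,b\in\mathcal B$, $n\ge N(a,b)$, which is universal with these properties: for any vertex algebra $A$ and any map $\iota:\mathcal B\to A$ with $\iota(a)$ of parity $N(a,a)\bmod 2$ and $\iota(a)_{(n)}\iota(b)=0$ whenever $n\ge N(a,b)$, there is a unique vertex algebra homomorphism $\mathfrak F_N(\mathcal B)\to A$ extending $\iota$. Gradings: $\mathfrak F=\mathfrak F_N(\mathcal B)$ is graded by weight in $\mathbb Z_+[\mathcal B]$ and degree in $\frac12\mathbb Z$, $\mathfrak F=\bigoplus_{\lambda,d}\mathfrak F_{\lambda,d}$, where $b\in\mathcal B$ has weight $b$ and degree $-\frac12N(b,b)$, $\mathbf 1\in\mathfrak F_{0,0}$, and $\mathfrak F_{\lambda,d\,(n)}\mathfrak F_{\lambda',d'}\subset\mathfrak F_{\lambda+\lambda',\,d+d'-n-1}$. The number $d_{\min}(\lambda)$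 is the minimal degree of nonzero elements of weight $\lambda$; writing $\lambda=a_1+\dots+a_k$ with $a_1\le\dots\le a_k$ in $\mathcal B$, it is the degree of the monomial $a_{1\,(m_1)}(\cdots(a_{k-1\,(m_{k-1})}a_k)\cdots)$ with $m_i=\sum_{j=i+1}^kN(a_i,a_j)-1$, i.e. $d_{\min}(\lambda)=-\frac12\sum_{a,b\in\mathcal B}s_as_bN(a,b)$. A $\mathcal B$-colored partition of a number $n$ is a finite multiset of pairs (positive integer, color in $\mathcal B$) whose integers sum to $n$ (for $n=0$ there is exactly one, the empty one; if $n$ is not a nonnegative integer there are none). *)

theory Defs
  imports
    Complex_Main
    "HOL-Library.Z2"
    "HOL-Library.Multiset"
    "HOL-Library.Poly_Mapping"
    "HOL-Library.Groups_Big_Fun"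
begin

section \<open>Vertex algebras\<close>

text \<open>
  A vertex algebra lives on a linear subspace \<open>car V\<close> of an ambient vector space, so that
  one can quantify over all vertex algebras carried by subspaces of a given space.
  \<open>part V 0\<close> and \<open>part V 1\<close> are the even and the odd subspace.
\<close>

record ('k, 'v) vertex_alg =
  smul :: "'k \<Rightarrow> 'v \<Rightarrow> 'v"
  car :: "'v set"
  part :: "bit \<Rightarrow> 'v set"
  nprod :: "int \<Rightarrow> 'v \<Rightarrow> 'v \<Rightarrow> 'v"
  vac :: 'v

definition transl :: "('k, 'v) vertex_alg \<Rightarrow> 'v \<Rightarrow> 'v" where
  "transl V a = nprod V (- 2) a (vac V)"

definition divided_transl :: "('k::field_char_0, 'v) vertex_alg \<Rightarrow> nat \<Rightarrow> 'v \<Rightarrow> 'v" where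
  "divided_transl V k a = smul V (1 / fact k) ((transl V ^^ k) a)"

text \<open>
  \<open>locality_order V s a b M\<close> is the identity of formal series
  \[ Y(a)(w)\,Y(b)(z)\,\iota_{w,z}(w-z)^M = s\,Y(b)(z)\,Y(a)(w)\,\iota_{z,w}(w-z)^M, \]
  applied to an arbitrary \<open>c\<close> and read off at \<open>w^(-m-1) z^(-n-1)\<close>, where
  \[ \iota_{w,z}(w-z)^M = \sum_{k\ge0} (-1)^k \binom{M}{k} w^{M-k} z^k, \qquad
     \iota_{z,w}(w-z)^M = \sum_{k\ge0} (-1)^{M-k} \binom{M}{k} w^k z^{M-k}. \]
  Both sums have finite support in a vertex algebra because \<open>b\<^sub>(\<^sub>n\<^sub>+\<^sub>k\<^sub>)c\<close> and
  \<open>a\<^sub>(\<^sub>m\<^sub>+\<^sub>k\<^sub>)c\<close> vanish for large \<open>k\<close>.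
\<close>

definition locality_order ::
  "('k::field_char_0, 'v::ab_group_add) vertex_alg \<Rightarrow> 'k \<Rightarrow> 'v \<Rightarrow> 'v \<Rightarrow> int \<Rightarrow> bool" where
  "locality_order V s a b M \<longleftrightarrow> (\<forall>c\<in>car V. \<forall>m n.
     Sum_any (\<lambda>k::nat. smul V ((- 1) ^ k * (of_int M gchoose k))
        (nprod V (m + M - int k) a (nprod V (n + int k) b c))) =
     smul V s (Sum_any (\<lambda>k::nat. smul V ((- 1) powi (M - int k) * (of_int M gchoose k))
        (nprod V (n + M - int k) b (nprod V (m + int k) a c)))))"

locale vertex_algebra = vector_space "smul V"
  for V :: "('k::field_char_0, 'v::ab_group_add) vertex_alg" +
  assumes subspace_car: "subspace (car V)"
    and subspace_part: "subspace (part V i)"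
    and car_eq: "car V = {x + y |x y. x \<in> part V 0 \<and> y \<in> part V 1}"
    and part_disjoint: "part V 0 \<inter> part V 1 = {0}"
    and vac_even: "vac V \<in> part V 0"
    and nprod_part: "a \<in> part V i \<Longrightarrow> b \<in> part V j \<Longrightarrow> nprod V n a b \<in> part V (i + j)"
    and nprod_add_left: "a \<in> car V \<Longrightarrow> a' \<in> car V \<Longrightarrow> b \<in> car V \<Longrightarrow>
      nprod V n (a + a') b = nprod V n a b + nprod V n a' b"
    and nprod_add_right: "a \<in> car V \<Longrightarrow> b \<in> car V \<Longrightarrow> b' \<in> car V \<Longrightarrow>
      nprod V n a (b + b') = nprod V n a b + nprod V n a b'"
    and nprod_smul_left: "a \<in> car V \<Longrightarrow> b \<in> car V \<Longrightarrow>
      nprod V n (smul V r a) b = smul V r (nprod V n a b)"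
    and nprod_smul_right: "a \<in> car V \<Longrightarrow> b \<in> car V \<Longrightarrow>
      nprod V n a (smul V r b) = smul V r (nprod V n a b)"
    and nprod_eventually_0: "a \<in> car V \<Longrightarrow> b \<in> car V \<Longrightarrow> \<exists>n0. \<forall>n\<ge>n0. nprod V n a b = 0"
    and vac_left: "a \<in> car V \<Longrightarrow> nprod V n (vac V) a = (if n = - 1 then a else 0)"
    and vac_right_nonneg: "a \<in> car V \<Longrightarrow> n \<ge> 0 \<Longrightarrow> nprod V n a (vac V) = 0"
    and vac_right_neg: "a \<in> car V \<Longrightarrow> n < 0 \<Longrightarrow>
      nprod V n a (vac V) = divided_transl V (nat (- n - 1)) a"
    and transl_left: "a \<in> car V \<Longrightarrow> b \<in> car V \<Longrightarrow>
      nprod V n (transl V a) b = smul V (of_int (- n)) (nprod V (n - 1) a b)"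
    and transl_right: "a \<in> car V \<Longrightarrow> b \<in> car V \<Longrightarrow>
      nprod V n a (transl V b) = smul V (of_int n) (nprod V (n - 1) a b) + transl V (nprod V n a b)"
    and locality: "a \<in> part V i \<Longrightarrow> b \<in> part V j \<Longrightarrow>
      \<exists>M. locality_order V (if i = 1 \<and> j = 1 then - 1 else 1) a b M"

definition va_hom ::
  "('k::field_char_0, 'v::ab_group_add) vertex_alg \<Rightarrow> ('k, 'w::ab_group_add) vertex_alg \<Rightarrow> ('v \<Rightarrow> 'w) \<Rightarrow> bool" where
  "va_hom V W f \<longleftrightarrow>
     (\<forall>x\<in>car V. f x \<in> car W) \<and>
     (\<forall>x\<in>car V. \<forall>y\<in>car V. f (x + y) = f x + f y) \<and>
     (\<forall>r. \<forall>x\<in>car V. f (smul V r x) = smul W r (f x)) \<and>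
     f (vac V) = vac W \<and>
     (\<forall>n. \<forall>x\<in>car V. \<forall>y\<in>car V. f (nprod V n x y) = nprod W n (f x) (f y))"

inductive_set generated :: "('k, 'v::ab_group_add) vertex_alg \<Rightarrow> 'v set \<Rightarrow> 'v set"
  for V :: "('k, 'v) vertex_alg" and S :: "'v set" where
    gen_vac: "vac V \<in> generated V S"
  | gen_base: "x \<in> S \<Longrightarrow> x \<in> generated V S"
  | gen_add: "x \<in> generated V S \<Longrightarrow> y \<in> generated V S \<Longrightarrow> x + y \<in> generated V S"
  | gen_smul: "x \<in> generated V S \<Longrightarrow> smul V r x \<in> generated V S"
  | gen_nprod: "x \<in> generated V S \<Longrightarrow> y \<in> generated V S \<Longrightarrow> nprod V n x y \<in> generated V S"


section \<open>Free vertex algebras\<close>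

text \<open>\<open>of_int (N a a) :: bit\<close> is the parity \<open>N a a mod 2\<close>.\<close>

definition bounded_gens ::
  "('k, 'v::ab_group_add) vertex_alg \<Rightarrow> 'b set \<Rightarrow> ('b \<Rightarrow> 'b \<Rightarrow> int) \<Rightarrow> ('b \<Rightarrow> 'v) \<Rightarrow> bool" where
  "bounded_gens V B N g \<longleftrightarrow>
     (\<forall>a\<in>B. g a \<in> part V (of_int (N a a))) \<and>
     (\<forall>a\<in>B. \<forall>b\<in>B. \<forall>n\<ge>N a b. nprod V n (g a) (g b) = 0)"

text \<open>The universal property, tested on the vertex algebras carried by subspaces of type \<open>'w\<close>:\<close>

definition va_universal :: "'w::ab_group_add itself \<Rightarrow>
  ('k::field_char_0, 'v::ab_group_add) vertex_alg \<Rightarrow> 'b set \<Rightarrow> ('b \<Rightarrow> 'b \<Rightarrow> int) \<Rightarrow> ('b \<Rightarrow> 'v) \<Rightarrow> bool" where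
  "va_universal (_ :: 'w itself) V B N g \<longleftrightarrow>
     (\<forall>(W :: ('k, 'w) vertex_alg) h. vertex_algebra W \<and> bounded_gens W B N h \<longrightarrow>
        (\<exists>f. va_hom V W f \<and> (\<forall>a\<in>B. f (g a) = h a)) \<and>
        (\<forall>f f'. va_hom V W f \<and> (\<forall>a\<in>B. f (g a) = h a) \<and>
                va_hom V W f' \<and> (\<forall>a\<in>B. f' (g a) = h a) \<longrightarrow> (\<forall>x\<in>car V. f x = f' x)))"

datatype 'b va_mono = MVac | MGen 'b | MProd int "'b va_mono" "'b va_mono"

text \<open>
  A formula cannot quantify over types, so the universal property is imposed for targets inside
  the space spanned by the formal nonassociative monomials in \<open>'b\<close>. This is no restriction:
  a vertex algebra generated by an image of \<open>B\<close> embeds into that space, and by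
  \<open>free_vertex_algebra_universal\<close> below the universal property follows for targets of
  every type.
\<close>

definition free_vertex_algebra ::
  "('k::field_char_0, 'v::ab_group_add) vertex_alg \<Rightarrow> 'b set \<Rightarrow> ('b \<Rightarrow> 'b \<Rightarrow> int) \<Rightarrow> ('b \<Rightarrow> 'v) \<Rightarrow> bool" where
  "free_vertex_algebra V B N g \<longleftrightarrow>
     vertex_algebra V \<and> bounded_gens V B N g \<and> car V = generated V (g ` B) \<and>
     va_universal TYPE('b va_mono \<Rightarrow>\<^sub>0 'k) V B N g"


lemma (in vertex_algebra) part_subset_car: "part V i \<subseteq> car V"
proof
  fix x assume x: "x \<in> part V i"
  have 0: "0 \<in> part V j" for j
    using subspace_part subspace_0 by blast
  show "x \<in> car V"
  proof (cases i)
    case zero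
    then show ?thesis
      unfolding car_eq using x 0[of 1] by force
  next
    case one
    then show ?thesis
      unfolding car_eq using x 0[of 0] by force
  qed
qed

lemma (in vertex_algebra) nprod_car:
  assumes "a \<in> car V" "b \<in> car V"
  shows "nprod V n a b \<in> car V"
proof -
  from assms obtain a0 a1 b0 b1 where
    ab: "a = a0 + a1" "b = b0 + b1" "a0 \<in> part V 0" "a1 \<in> part V 1" "b0 \<in> part V 0" "b1 \<in> part V 1"
    unfolding car_eq by blast
  have c: "a0 \<in> car V" "a1 \<in> car V" "b0 \<in> car V" "b1 \<in> car V"
    using ab part_subset_car by blast+
  have "nprod V n a b = nprod V n a0 b0 + nprod V n a0 b1 + (nprod V n a1 b0 + nprod V n a1 b1)"
    using c subspace_add[OF subspace_car] by (simp add: ab nprod_add_left nprod_add_right)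
  also have "\<dots> \<in> car V"
    using ab by (intro subspace_add[OF subspace_car])
      (blast intro: part_subset_car[THEN subsetD] nprod_part)+
  finally show ?thesis .
qed

lemma (in vertex_algebra) vac_car: "vac V \<in> car V"
  using vac_even part_subset_car by blast

lemma (in vertex_algebra) transl_pow_car: "a \<in> car V \<Longrightarrow> (transl V ^^ k) a \<in> car V"
  by (induction k) (auto simp: transl_def nprod_car vac_car)

lemma (in vertex_algebra) generated_subset_car:
  assumes "S \<subseteq> car V"
  shows "generated V S \<subseteq> car V"
proof
  fix x assume "x \<in> generated V S"
  then show "x \<in> car V"
    by induction
      (use assms vac_car nprod_car subspace_add[OF subspace_car] subspace_scale[OF subspace_car] in auto)
qed

lemma (in vertex_algebra) va_hom_eq_on_generated:
  assumes "va_hom V W f" "va_hom V W f'" "S \<subseteq> car V" "\<forall>x\<in>S. f x = f' x" "x \<in> generated V S"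
  shows "f x = f' x"
  using assms(5)
proof induction
  case gen_vac
  then show ?case using assms by (auto simp: va_hom_def)
next
  case (gen_base x)
  then show ?case using assms by auto
qed (use assms generated_subset_car[OF assms(3)] in \<open>auto simp: va_hom_def subset_iff\<close>)

definition restrict_va :: "('k, 'v) vertex_alg \<Rightarrow> 'v set \<Rightarrow> ('k, 'v) vertex_alg" where
  "restrict_va V U = V\<lparr>car := U, part := (\<lambda>i. part V i \<inter> U)\<rparr>"

lemma restrict_va_simps [simp]:
  "smul (restrict_va V U) = smul V" "car (restrict_va V U) = U"
  "part (restrict_va V U) i = part V i \<inter> U" "nprod (restrict_va V U) = nprod V"
  "vac (restrict_va V U) = vac V" "transl (restrict_va V U) = transl V"
  by (auto simp: restrict_va_def transl_def fun_eq_iff)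

lemma restrict_va_divided_transl [simp]:
  "divided_transl (restrict_va V U) k a = divided_transl V k a"
  by (simp add: divided_transl_def)

lemma (in vertex_algebra) vertex_algebra_generated:
  assumes hom: "\<And>x. x \<in> S \<Longrightarrow> \<exists>i. x \<in> part V i"
  shows "vertex_algebra (restrict_va V (generated V S))"
proof -
  let ?U = "generated V S"
  have SV: "S \<subseteq> car V"
    using hom part_subset_car by blast
  note UV = generated_subset_car[OF SV]
  note U = UV[THEN subsetD]
  have sub: "subspace ?U"
    using gen_smul[OF gen_vac, of V 0 S] by (auto intro!: subspaceI gen_add gen_smul)
  note PV = part_subset_car[THEN subsetD]
  have p0: "0 \<in> part V i" for i
    using subspace_part subspace_0 by blast
  have hom_dec: "\<exists>x0 x1. x = x0 + x1 \<and> x0 \<in> part V 0 \<inter> ?U \<and> x1 \<in> part V 1 \<inter> ?U"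
    if "x \<in> part V i" "x \<in> ?U" for x i
  proof (cases i)
    case zero
    then show ?thesis
      using that p0 subspace_0[OF sub] by (intro exI[of _ x] exI[of _ 0]) simp
  next
    case one
    then show ?thesis
      using that p0 subspace_0[OF sub] by (intro exI[of _ 0] exI[of _ x]) simp
  qed
  have dec: "\<exists>x0 x1. x = x0 + x1 \<and> x0 \<in> part V 0 \<inter> ?U \<and> x1 \<in> part V 1 \<inter> ?U" if "x \<in> ?U" for x
    using that
  proof induction
    case gen_vac
    show ?case
      by (rule hom_dec[OF vac_even generated.gen_vac])
  next
    case (gen_base x)
    then obtain i where "x \<in> part V i"
      using hom by blast
    then show ?case
      using hom_dec generated.gen_base[OF gen_base] by blast
  next
    case (gen_add x y)
    then obtain x0 x1 y0 y1 where xy: "x = x0 + x1" "y = y0 + y1"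
      "x0 \<in> part V 0 \<inter> ?U" "x1 \<in> part V 1 \<inter> ?U" "y0 \<in> part V 0 \<inter> ?U" "y1 \<in> part V 1 \<inter> ?U"
      by blast
    have "x + y = (x0 + y0) + (x1 + y1)"
      by (simp add: xy)
    moreover have "x0 + y0 \<in> part V 0 \<inter> ?U" "x1 + y1 \<in> part V 1 \<inter> ?U"
      using xy by (simp_all add: subspace_add[OF subspace_part] generated.gen_add)
    ultimately show ?case by blast
  next
    case (gen_smul x r)
    then obtain x0 x1 where x: "x = x0 + x1" "x0 \<in> part V 0 \<inter> ?U" "x1 \<in> part V 1 \<inter> ?U"
      by blast
    have "smul V r x = smul V r x0 + smul V r x1"
      by (simp add: x scale_right_distrib)
    moreover have "smul V r x0 \<in> part V 0 \<inter> ?U" "smul V r x1 \<in> part V 1 \<inter> ?U"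
      using x by (simp_all add: subspace_scale[OF subspace_part] generated.gen_smul)
    ultimately show ?case by blast
  next
    case (gen_nprod x y n)
    then obtain x0 x1 y0 y1 where xy: "x = x0 + x1" "y = y0 + y1"
      "x0 \<in> part V 0 \<inter> ?U" "x1 \<in> part V 1 \<inter> ?U" "y0 \<in> part V 0 \<inter> ?U" "y1 \<in> part V 1 \<inter> ?U"
      by blast
    let ?p = "nprod V n"
    have c: "x0 \<in> car V" "x1 \<in> car V" "y0 \<in> car V" "y1 \<in> car V"
      using xy U by blast+
    have "?p x y = (?p x0 y0 + ?p x1 y1) + (?p x0 y1 + ?p x1 y0)"
      using c subspace_add[OF subspace_car] by (simp add: xy nprod_add_left nprod_add_right algebra_simps)
    moreover have "?p x0 y0 \<in> part V 0" "?p x1 y1 \<in> part V 0" "?p x0 y1 \<in> part V 1" "?p x1 y0 \<in> part V 1"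
      using nprod_part[of x0 0 y0 0 n] nprod_part[of x1 1 y1 1 n]
        nprod_part[of x0 0 y1 1 n] nprod_part[of x1 1 y0 0 n] xy by auto
    moreover have "?p x0 y0 \<in> ?U" "?p x1 y1 \<in> ?U" "?p x0 y1 \<in> ?U" "?p x1 y0 \<in> ?U"
      using xy by (simp_all add: generated.gen_nprod)
    ultimately have "?p x y = (?p x0 y0 + ?p x1 y1) + (?p x0 y1 + ?p x1 y0)"
      "?p x0 y0 + ?p x1 y1 \<in> part V 0 \<inter> ?U" "?p x0 y1 + ?p x1 y0 \<in> part V 1 \<inter> ?U"
      by (simp_all add: subspace_add[OF subspace_part] subspace_add[OF sub])
    then show ?case by blast
  qed
  show ?thesis
  proof (intro vertex_algebra.intro vertex_algebra_axioms.intro; (simp only: restrict_va_simps restrict_va_divided_transl)?)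
    show "vector_space (smul V)" ..
    show "subspace (part V i \<inter> ?U)" for i
      using subspace_part sub by (rule subspace_inter)
    show "?U = {x + y |x y. x \<in> part V 0 \<inter> ?U \<and> y \<in> part V 1 \<inter> ?U}"
    proof (intro set_eqI iffI)
      fix x assume "x \<in> ?U"
      from dec[OF this] show "x \<in> {x + y |x y. x \<in> part V 0 \<inter> ?U \<and> y \<in> part V 1 \<inter> ?U}"
        by blast
    qed (auto intro: gen_add)
    show "part V 0 \<inter> ?U \<inter> (part V 1 \<inter> ?U) = {0}"
      using part_disjoint subspace_0[OF sub] by auto
    show "vac V \<in> part V 0 \<inter> ?U"
      using vac_even gen_vac by blast
    show "nprod V n a b \<in> part V (i + j) \<inter> ?U"
      if "a \<in> part V i \<inter> ?U" "b \<in> part V j \<inter> ?U" for a b i j n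
      using that by (auto simp del: add_bit_eq_xor intro: nprod_part gen_nprod)
    show "\<exists>M. locality_order (restrict_va V ?U) (if i = 1 \<and> j = 1 then - 1 else 1) a b M"
      if ab: "a \<in> part V i \<inter> ?U" "b \<in> part V j \<inter> ?U" for a b i j
    proof -
      obtain M where "locality_order V (if i = 1 \<and> j = 1 then - 1 else 1) a b M"
        using locality[of a i b j] ab by blast
      then have "locality_order (restrict_va V ?U) (if i = 1 \<and> j = 1 then - 1 else 1) a b M"
        unfolding locality_order_def restrict_va_simps by (simp add: U)
      then show ?thesis ..
    qed
  qed (simp_all add: U sub nprod_add_left nprod_add_right nprod_smul_left nprod_smul_right
        nprod_eventually_0 vac_left vac_right_nonneg vac_right_neg transl_left transl_right
        del: of_int_minus)
qed

definition transport_va ::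
  "('k, 'v) vertex_alg \<Rightarrow> ('k \<Rightarrow> 'w \<Rightarrow> 'w) \<Rightarrow> ('v \<Rightarrow> 'w) \<Rightarrow> ('w \<Rightarrow> 'v) \<Rightarrow> ('k, 'w) vertex_alg" where
  "transport_va V s p q = \<lparr>smul = s, car = p ` car V, part = (\<lambda>i. p ` part V i),
     nprod = (\<lambda>n x y. p (nprod V n (q x) (q y))), vac = p (vac V)\<rparr>"

lemma transport_va_simps [simp]:
  "smul (transport_va V s p q) = s" "car (transport_va V s p q) = p ` car V"
  "part (transport_va V s p q) i = p ` part V i"
  "nprod (transport_va V s p q) n x y = p (nprod V n (q x) (q y))"
  "vac (transport_va V s p q) = p (vac V)"
  by (auto simp: transport_va_def)

lemma (in vertex_algebra) vertex_algebra_transport: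
  fixes s :: "'k \<Rightarrow> 'w::ab_group_add \<Rightarrow> 'w"
  assumes s: "vector_space s"
    and q: "\<And>x. x \<in> car V \<Longrightarrow> q (p x) = x"
    and p_add: "\<And>x y. x \<in> car V \<Longrightarrow> y \<in> car V \<Longrightarrow> p (x + y) = p x + p y"
    and p_smul: "\<And>r x. x \<in> car V \<Longrightarrow> p (smul V r x) = s r (p x)"
  shows "vertex_algebra (transport_va V s p q)"
proof -
  interpret s: vector_space s by fact
  let ?W = "transport_va V s p q"
  note PV = part_subset_car[THEN subsetD]
  note car0 = subspace_0[OF subspace_car]
  note car_add = subspace_add[OF subspace_car]
  note car_smul = subspace_scale[OF subspace_car]
  have p0: "p 0 = 0"
    using p_smul[OF car0, of 0] by simp
  have pinj: "p x = p y \<longleftrightarrow> x = y" if "x \<in> car V" "y \<in> car V" for x y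
    using that q by metis
  have sub: "s.subspace (p ` X)" if "subspace X" "X \<subseteq> car V" for X
  proof (rule s.subspaceI)
    show "0 \<in> p ` X"
      using subspace_0[OF that(1)] p0 by force
    show "x + y \<in> p ` X" if xy: "x \<in> p ` X" "y \<in> p ` X" for x y
    proof -
      obtain a b where ab: "x = p a" "y = p b" "a \<in> X" "b \<in> X"
        using xy by blast
      have "x + y = p (a + b)"
        using ab p_add[of a b] \<open>X \<subseteq> car V\<close> by (simp add: subset_iff)
      then show ?thesis
        using ab subspace_add[OF \<open>subspace X\<close>] by blast
    qed
    show "s c x \<in> p ` X" if x: "x \<in> p ` X" for c x
    proof -
      obtain a where a: "x = p a" "a \<in> X"
        using x by blast
      have "s c x = p (smul V c a)"
        using a p_smul[of a c] \<open>X \<subseteq> car V\<close> by (simp add: subset_iff)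
      then show ?thesis
        using a subspace_scale[OF \<open>subspace X\<close>] by blast
    qed
  qed
  have p_sum: "p (sum g A) = (\<Sum>k\<in>A. p (g k)) \<and> sum g A \<in> car V"
    if "\<And>k. g k \<in> car V" for g and A :: "nat set"
    by (induction A rule: infinite_finite_induct) (auto simp: p0 car0 p_add that car_add)
  have p_Sum: "p (Sum_any g) = Sum_any (\<lambda>k. p (g k))" "Sum_any g \<in> car V"
    if "\<And>k. g k \<in> car V" for g :: "nat \<Rightarrow> 'v"
  proof -
    have "{k. p (g k) \<noteq> 0} = {k. g k \<noteq> 0}"
      using pinj[OF that car0] p0 by auto
    then show "p (Sum_any g) = Sum_any (\<lambda>k. p (g k))" "Sum_any g \<in> car V"
      using p_sum[of g, OF that] by (auto simp: Sum_any.expand_set)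
  qed
  have tr: "transl ?W (p a) = p (transl V a)" if "a \<in> car V" for a
    using that by (simp add: transl_def q vac_car)
  have tr_car: "transl V a \<in> car V" if "a \<in> car V" for a
    using that by (simp add: transl_def nprod_car vac_car)
  have tr_pow: "(transl ?W ^^ k) (p a) = p ((transl V ^^ k) a)" if "a \<in> car V" for k a
    by (induction k) (auto simp: that tr transl_pow_car)
  have dtr: "divided_transl ?W k (p a) = p (divided_transl V k a)" if "a \<in> car V" for k a
    by (simp add: divided_transl_def tr_pow p_smul transl_pow_car that)
  show ?thesis
  proof (intro vertex_algebra.intro vertex_algebra_axioms.intro)
    show "vector_space (smul ?W)" using s by simp
    show "module.subspace (smul ?W) (car ?W)"
      using sub[OF subspace_car] by simp
    show "module.subspace (smul ?W) (part ?W i)" for i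
      using sub[OF subspace_part part_subset_car] by simp
    show "car ?W = {x + y |x y. x \<in> part ?W 0 \<and> y \<in> part ?W 1}"
    proof -
      have "\<exists>x y. z = x + y \<and> x \<in> p ` part V 0 \<and> y \<in> p ` part V 1" if z: "z \<in> p ` car V" for z
      proof -
        obtain x y where "z = p (x + y)" "x \<in> part V 0" "y \<in> part V 1"
          using z unfolding car_eq by blast
        then show ?thesis using p_add PV by blast
      qed
      moreover have "p x + p y \<in> p ` car V" if "x \<in> part V 0" "y \<in> part V 1" for x y
        using that p_add[OF PV PV] car_add[OF PV PV] by (metis imageI)
      ultimately show ?thesis by auto
    qed
    show "part ?W 0 \<inter> part ?W 1 = {0}"
    proof -
      have "p ` part V 0 \<inter> p ` part V 1 = p ` (part V 0 \<inter> part V 1)"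
        using pinj PV by blast
      then show ?thesis by (simp add: part_disjoint p0)
    qed
    show "vac ?W \<in> part ?W 0"
      using vac_even by simp
    show "nprod ?W n a b \<in> part ?W (i + j)" if ab: "a \<in> part ?W i" "b \<in> part ?W j" for a b i j n
    proof -
      obtain x y where xy: "a = p x" "b = p y" "x \<in> part V i" "y \<in> part V j"
        using ab unfolding transport_va_simps by blast
      then show ?thesis
        using nprod_part[OF xy(3,4), of n] PV[OF xy(3)] PV[OF xy(4)]
        by (simp only: transport_va_simps q) (rule imageI)
    qed
    show "\<exists>n0. \<forall>n\<ge>n0. nprod ?W n a b = 0" if ab: "a \<in> car ?W" "b \<in> car ?W" for a b
    proof -
      obtain x y where xy: "a = p x" "b = p y" "x \<in> car V" "y \<in> car V"
        using ab by auto
      obtain n0 where "\<forall>n\<ge>n0. nprod V n x y = 0"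
        using nprod_eventually_0[OF xy(3,4)] by blast
      with xy show ?thesis
        by (intro exI[of _ n0]) (simp add: q p0)
    qed
    show "\<exists>M. locality_order ?W (if i = 1 \<and> j = 1 then - 1 else 1) a b M"
      if ab: "a \<in> part ?W i" "b \<in> part ?W j" for a b i j
    proof -
      obtain x y where xy: "a = p x" "b = p y" "x \<in> part V i" "y \<in> part V j"
        using ab unfolding transport_va_simps by blast
      then have c: "x \<in> car V" "y \<in> car V"
        using PV by blast+
      define e :: 'k where "e = (if i = 1 \<and> j = 1 then - 1 else 1)"
      obtain M where M: "locality_order V e x y M"
        using locality[OF xy(3,4)] unfolding e_def by blast
      have "locality_order ?W e a b M"
        unfolding locality_order_def
      proof (intro ballI allI)
        fix c' m n
        assume "c' \<in> car ?W"
        then obtain z where z: "c' = p z" "z \<in> car V"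
          by auto
        let ?L = "\<lambda>k::nat. smul V ((- 1) ^ k * (of_int M gchoose k))
            (nprod V (m + M - int k) x (nprod V (n + int k) y z))"
        let ?R = "\<lambda>k::nat. smul V ((- 1) powi (M - int k) * (of_int M gchoose k))
            (nprod V (n + M - int k) y (nprod V (m + int k) x z))"
        have cL: "?L k \<in> car V" and cR: "?R k \<in> car V" for k
          by (intro car_smul nprod_car c z(2))+
        have "Sum_any ?L = smul V e (Sum_any ?R)"
          using M z(2) unfolding locality_order_def by blast
        then have "p (Sum_any ?L) = p (smul V e (Sum_any ?R))"
          by (rule arg_cong)
        then have eq: "Sum_any (\<lambda>k. p (?L k)) = s e (Sum_any (\<lambda>k. p (?R k)))"
          by (simp only: p_Sum(1)[OF cL] p_Sum(1)[OF cR] p_smul[OF p_Sum(2)[OF cR]])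
        have pL: "p (?L k) = smul ?W ((- 1) ^ k * (of_int M gchoose k))
            (nprod ?W (m + M - int k) a (nprod ?W (n + int k) b c'))" for k
          using c z(2) unfolding z(1) xy(1,2) transport_va_simps
          by (simp only: q nprod_car p_smul)
        have pR: "p (?R k) = smul ?W ((- 1) powi (M - int k) * (of_int M gchoose k))
            (nprod ?W (n + M - int k) b (nprod ?W (m + int k) a c'))" for k
          using c z(2) unfolding z(1) xy(1,2) transport_va_simps
          by (simp only: q nprod_car p_smul)
        show "Sum_any (\<lambda>k::nat. smul ?W ((- 1) ^ k * (of_int M gchoose k))
            (nprod ?W (m + M - int k) a (nprod ?W (n + int k) b c'))) =
          smul ?W e (Sum_any (\<lambda>k::nat. smul ?W ((- 1) powi (M - int k) * (of_int M gchoose k))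
            (nprod ?W (n + M - int k) b (nprod ?W (m + int k) a c'))))"
          using eq unfolding pL pR by simp
      qed
      then show ?thesis
        unfolding e_def ..
    qed
  next
    fix a b n
    assume "a \<in> car ?W" "b \<in> car ?W"
    then show "nprod ?W n (transl ?W a) b = smul ?W (of_int (- n)) (nprod ?W (n - 1) a b)"
      "nprod ?W n a (transl ?W b) = smul ?W (of_int n) (nprod ?W (n - 1) a b) + transl ?W (nprod ?W n a b)"
      by (auto simp: tr tr_car q nprod_car transl_left transl_right p_add p_smul car_smul
          simp del: of_int_minus)
  qed (auto simp: q p_add[symmetric] p_smul[symmetric] p0 car_add car_smul nprod_car vac_car dtr
        nprod_add_left nprod_add_right nprod_smul_left nprod_smul_right vac_left
        vac_right_nonneg vac_right_neg)
qed

fun mono_eval :: "('k, 'v) vertex_alg \<Rightarrow> ('b \<Rightarrow> 'v) \<Rightarrow> 'b va_mono \<Rightarrow> 'v" where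
  "mono_eval V g MVac = vac V"
| "mono_eval V g (MGen b) = g b"
| "mono_eval V g (MProd n x y) = nprod V n (mono_eval V g x) (mono_eval V g y)"

lemma lookup_map_times:
  "Poly_Mapping.lookup (Poly_Mapping.map ((*) c) x) m = c * Poly_Mapping.lookup x m"
  for c :: "'k::field"
  by (simp add: Poly_Mapping.map.rep_eq when_def)

lemma vector_space_poly_mapping:
  "vector_space (\<lambda>c::'k::field. Poly_Mapping.map ((*) c) :: ('x \<Rightarrow>\<^sub>0 'k) \<Rightarrow> _)"
  by unfold_locales
    (auto intro!: poly_mapping_eqI simp: lookup_map_times lookup_add algebra_simps)

lemma (in vertex_algebra) generated_subset_span_mono:
  assumes "g ` B \<subseteq> car V"
  shows "generated V (g ` B) \<subseteq> span (mono_eval V g ` {m. set_va_mono m \<subseteq> B})"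
proof
  let ?M = "mono_eval V g ` {m. set_va_mono m \<subseteq> B}"
  have mono_car: "mono_eval V g m \<in> car V" if "set_va_mono m \<subseteq> B" for m
    using that
  proof (induction m)
    case (MGen b)
    then show ?case using assms by auto
  qed (simp_all add: vac_car nprod_car)
  have M_car: "x \<in> car V" if "x \<in> ?M" for x
    using that mono_car by blast
  have car0: "0 \<in> car V"
    by (rule subspace_0[OF subspace_car])
  have zero: "nprod V n x 0 = 0" "nprod V n 0 x = 0" if "x \<in> car V" for n x
    using nprod_smul_right[OF that car0, of n 0] nprod_smul_left[OF car0 that, of n 0] by simp_all
  have prod1: "span ?M \<subseteq> {y \<in> car V. nprod V n x y \<in> span ?M}" if x: "x \<in> ?M" for n x
  proof (rule span_minimal)
    show "subspace {y \<in> car V. nprod V n x y \<in> span ?M}"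
      using M_car[OF x] by (intro subspaceI)
        (simp_all add: car0 zero span_zero subspace_add[OF subspace_car] subspace_scale[OF subspace_car]
          nprod_add_right nprod_smul_right span_add span_scale)
    show "?M \<subseteq> {y \<in> car V. nprod V n x y \<in> span ?M}"
    proof
      fix y assume y: "y \<in> ?M"
      from x y obtain m1 m2 where m: "x = mono_eval V g m1" "y = mono_eval V g m2"
        "set_va_mono m1 \<subseteq> B" "set_va_mono m2 \<subseteq> B"
        by blast
      have "nprod V n x y \<in> ?M"
        using m by (intro image_eqI[of _ _ "MProd n m1 m2"]) simp_all
      then show "y \<in> {y \<in> car V. nprod V n x y \<in> span ?M}"
        using M_car[OF y] by (simp add: span_base)
    qed
  qed
  have prod2: "span ?M \<subseteq> {x \<in> car V. nprod V n x y \<in> span ?M}" if y: "y \<in> span ?M" for n y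
  proof (rule span_minimal)
    have "span ?M \<subseteq> car V"
      by (rule span_minimal[OF _ subspace_car]) (rule subsetI, rule M_car)
    then have "y \<in> car V"
      using y by (rule subsetD)
    then show "subspace {x \<in> car V. nprod V n x y \<in> span ?M}"
      by (intro subspaceI)
        (simp_all add: car0 zero span_zero subspace_add[OF subspace_car] subspace_scale[OF subspace_car]
          nprod_add_left nprod_smul_left span_add span_scale)
    show "?M \<subseteq> {x \<in> car V. nprod V n x y \<in> span ?M}"
    proof
      fix x assume x: "x \<in> ?M"
      show "x \<in> {x \<in> car V. nprod V n x y \<in> span ?M}"
        using subsetD[OF prod1[OF x] y, of n] M_car[OF x] by simp
    qed
  qed
  fix x assume "x \<in> generated V (g ` B)"
  then show "x \<in> span ?M"
  proof induction
    case gen_vac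
    show ?case by (intro span_base image_eqI[of _ _ MVac]) simp_all
  next
    case (gen_base x)
    then obtain b where "b \<in> B" "x = g b" by blast
    then show ?case by (intro span_base image_eqI[of _ _ "MGen b"]) simp_all
  next
    case (gen_nprod x y n)
    show ?case
      using subsetD[OF prod2[OF gen_nprod.IH(2)] gen_nprod.IH(1), of n] by simp
  qed (simp_all add: span_add span_scale)
qed

lemma (in vertex_algebra) generated_embedding:
  fixes g :: "'b \<Rightarrow> 'v"
  assumes "g ` B \<subseteq> car V"
  obtains p :: "'v \<Rightarrow> 'b va_mono \<Rightarrow>\<^sub>0 'k" where
    "inj_on p (generated V (g ` B))"
    "\<And>x y. x \<in> generated V (g ` B) \<Longrightarrow> y \<in> generated V (g ` B) \<Longrightarrow> p (x + y) = p x + p y"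
    "\<And>r x. x \<in> generated V (g ` B) \<Longrightarrow> p (smul V r x) = Poly_Mapping.map ((*) r) (p x)"
proof -
  let ?U = "generated V (g ` B)"
  let ?M = "mono_eval V g ` {m. set_va_mono m \<subseteq> B}"
  obtain E where E: "E \<subseteq> ?M" "independent E" "?M \<subseteq> span E"
    using maximal_independent_subset[of ?M] by metis
  have US: "x \<in> span E" if "x \<in> ?U" for x
    using subsetD[OF generated_subset_span_mono[OF assms] that]
      subsetD[OF span_minimal[OF E(3) subspace_span]] by simp
  define r where "r = inv_into {m. set_va_mono m \<subseteq> B} (mono_eval V g)"
  have r: "mono_eval V g (r e) = e" if "e \<in> E" for e
    unfolding r_def by (rule f_inv_into_f) (rule subsetD[OF E(1) that])
  define p where "p x = Abs_poly_mapping (\<lambda>m. if m \<in> r ` E then representation E x (mono_eval V g m) else 0)" for x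
  have fin: "finite {m. (if m \<in> r ` E then representation E x (mono_eval V g m) else 0) \<noteq> 0}" for x
  proof (rule finite_subset)
    show "{m. (if m \<in> r ` E then representation E x (mono_eval V g m) else 0) \<noteq> 0}
        \<subseteq> r ` {e. representation E x e \<noteq> 0}"
    proof
      fix m assume "m \<in> {m. (if m \<in> r ` E then representation E x (mono_eval V g m) else 0) \<noteq> 0}"
      then obtain e where e: "m = r e" "e \<in> E" "representation E x (mono_eval V g (r e)) \<noteq> 0"
        by (auto split: if_splits simp del: image_iff)
      then show "m \<in> r ` {e. representation E x e \<noteq> 0}"
        by (simp add: r)
    qed
    show "finite (r ` {e. representation E x e \<noteq> 0})"
      by (intro finite_imageI finite_representation)
  qed
  have lookup: "Poly_Mapping.lookup (p x) m = (if m \<in> r ` E then representation E x (mono_eval V g m) else 0)" for x m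
    unfolding p_def by (subst lookup_Abs_poly_mapping[OF fin]) (rule refl)
  show thesis
  proof
    show "inj_on p ?U"
    proof (rule inj_onI)
      fix x y assume xy: "x \<in> ?U" "y \<in> ?U" "p x = p y"
      have "representation E x e = representation E y e" for e
      proof (cases "e \<in> E")
        case True
        then have "r e \<in> r ` E"
          by (rule imageI)
        then show ?thesis
          using lookup[of x "r e"] lookup[of y "r e"] by (simp add: xy(3) r[OF True])
      next
        case False
        then show ?thesis
          using representation_ne_zero[of E x e] representation_ne_zero[of E y e] by argo
      qed
      then have "representation E x = representation E y"
        by (rule ext)
      then show "x = y"
        using sum_nonzero_representation_eq[OF E(2) US[OF xy(1)]]
          sum_nonzero_representation_eq[OF E(2) US[OF xy(2)]] by metis
    qed
    show "p (x + y) = p x + p y" if "x \<in> ?U" "y \<in> ?U" for x y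
      by (rule poly_mapping_eqI)
        (simp add: lookup lookup_add representation_add[OF E(2) US[OF that(2)] US[OF that(1)]]
          representation_add[OF E(2) US[OF that(1)] US[OF that(2)]])
    show "p (smul V c x) = Poly_Mapping.map ((*) c) (p x)" if "x \<in> ?U" for c x
      by (rule poly_mapping_eqI)
        (simp add: lookup lookup_map_times representation_scale[OF E(2) US[OF that]])
  qed
qed

theorem free_vertex_algebra_universal:
  fixes V :: "('k::field_char_0, 'v::ab_group_add) vertex_alg" and g :: "'b \<Rightarrow> 'v"
  assumes "free_vertex_algebra V B N g"
  shows "va_universal TYPE('w::ab_group_add) V B N g"
  unfolding va_universal_def
proof (intro allI impI conjI)
  fix W :: "('k, 'w) vertex_alg" and h
  assume Wh: "vertex_algebra W \<and> bounded_gens W B N h"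
  interpret V: vertex_algebra V
    using assms by (simp add: free_vertex_algebra_def)
  interpret W: vertex_algebra W
    using Wh by simp
  have gV: "g ` B \<subseteq> car V"
    using assms V.part_subset_car by (force simp: free_vertex_algebra_def bounded_gens_def)
  have carV: "car V = generated V (g ` B)"
    using assms by (simp add: free_vertex_algebra_def)
  have hW: "h ` B \<subseteq> car W"
    using Wh W.part_subset_car by (force simp: bounded_gens_def)
  let ?U = "generated W (h ` B)"
  let ?X = "restrict_va W ?U"
  interpret X: vertex_algebra ?X
    by (rule W.vertex_algebra_generated) (use Wh in \<open>auto simp: bounded_gens_def\<close>)
  obtain p :: "'w \<Rightarrow> 'b va_mono \<Rightarrow>\<^sub>0 'k" where p: "inj_on p ?U"
    "\<And>x y. x \<in> ?U \<Longrightarrow> y \<in> ?U \<Longrightarrow> p (x + y) = p x + p y"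
    "\<And>r x. x \<in> ?U \<Longrightarrow> p (smul W r x) = Poly_Mapping.map ((*) r) (p x)"
    by (rule W.generated_embedding[OF hW]) (rule that; simp)
  let ?q = "inv_into ?U p"
  let ?s = "\<lambda>c::'k. Poly_Mapping.map ((*) c) :: ('b va_mono \<Rightarrow>\<^sub>0 'k) \<Rightarrow> _"
  let ?Y = "transport_va ?X ?s p ?q"
  have q: "?q (p x) = x" if "x \<in> ?U" for x
    using p(1) that by simp
  have Y: "vertex_algebra ?Y"
    by (rule X.vertex_algebra_transport) (auto simp: vector_space_poly_mapping q p)
  have p0: "p 0 = 0"
    using p(2)[of 0 0] X.subspace_0[OF X.subspace_car] by simp
  have hU: "h a \<in> ?U" if "a \<in> B" for a
    using that by (auto intro: gen_base)
  have "bounded_gens ?Y B N (p \<circ> h)"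
    using Wh hU by (simp add: bounded_gens_def q p0)
  moreover have "va_universal TYPE('b va_mono \<Rightarrow>\<^sub>0 'k) V B N g"
    using assms by (simp add: free_vertex_algebra_def)
  ultimately have "\<exists>f. va_hom V ?Y f \<and> (\<forall>a\<in>B. f (g a) = (p \<circ> h) a)"
    unfolding va_universal_def using Y by blast
  then obtain f where f: "va_hom V ?Y f" "\<forall>a\<in>B. f (g a) = p (h a)"
    by auto
  have fU: "f x \<in> p ` ?U" if "x \<in> car V" for x
    using f(1) that by (auto simp: va_hom_def)
  have UW: "?U \<subseteq> car W"
    by (rule W.generated_subset_car[OF hW])
  have qU: "?q y \<in> ?U" "p (?q y) = y" if "y \<in> p ` ?U" for y
    using that by (auto simp: q)
  have q_add: "?q (x + y) = ?q x + ?q y" if "x \<in> p ` ?U" "y \<in> p ` ?U" for x y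
    using that by (auto simp: q p(2)[symmetric] gen_add)
  have q_smul: "?q (?s c x) = smul W c (?q x)" if "x \<in> p ` ?U" for x c
    using that by (auto simp: q p(3)[symmetric] gen_smul)
  have "va_hom V W (?q \<circ> f)"
    unfolding va_hom_def
  proof (intro conjI allI ballI)
    show "(?q \<circ> f) x \<in> car W" if "x \<in> car V" for x
      using qU(1)[OF fU[OF that]] UW by auto
    show "(?q \<circ> f) (vac V) = vac W"
      using f(1) by (simp add: va_hom_def q gen_vac)
    show "(?q \<circ> f) (x + y) = (?q \<circ> f) x + (?q \<circ> f) y" if "x \<in> car V" "y \<in> car V" for x y
      using f(1) that by (simp add: va_hom_def q_add fU)
    show "(?q \<circ> f) (smul V r x) = smul W r ((?q \<circ> f) x)" if "x \<in> car V" for r x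
      using f(1) that by (simp add: va_hom_def q_smul fU)
    show "(?q \<circ> f) (nprod V n x y) = nprod W n ((?q \<circ> f) x) ((?q \<circ> f) y)"
      if "x \<in> car V" "y \<in> car V" for n x y
      using f(1) that by (simp add: va_hom_def q gen_nprod qU(1)[OF fU])
  qed
  moreover have "\<forall>a\<in>B. (?q \<circ> f) (g a) = h a"
    using f(2) by (simp add: q hU)
  ultimately show "\<exists>f. va_hom V W f \<and> (\<forall>a\<in>B. f (g a) = h a)"
    by blast
  show "\<forall>x\<in>car V. f x = f' x"
    if "va_hom V W f \<and> (\<forall>a\<in>B. f (g a) = h a) \<and> va_hom V W f' \<and> (\<forall>a\<in>B. f' (g a) = h a)" for f f'
    using V.va_hom_eq_on_generated[of W f f' "g ` B"] that gV carV by auto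
qed

section \<open>Weight, degree and colored partitions\<close>

definition half_ints :: "rat set" where
  "half_ints = {d. 2 * d \<in> \<int>}"

text \<open>
  \<open>direct_sum_decomp s U I G\<close>: the space \<open>U\<close> with scalar multiplication \<open>s\<close> is the internal
  direct sum of the subspaces \<open>G i\<close> for \<open>i\<close> in \<open>I\<close>.
\<close>

definition direct_sum_decomp ::
  "('k::field \<Rightarrow> 'v::ab_group_add \<Rightarrow> 'v) \<Rightarrow> 'v set \<Rightarrow> 'i set \<Rightarrow> ('i \<Rightarrow> 'v set) \<Rightarrow> bool" where
  "direct_sum_decomp s U I G \<longleftrightarrow>
     (\<forall>i\<in>I. module.subspace s (G i) \<and> G i \<subseteq> U) \<and>
     (\<forall>x\<in>U. \<exists>!f. (\<forall>i\<in>I. f i \<in> G i) \<and> (\<forall>i. i \<notin> I \<longrightarrow> f i = 0) \<and>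
                  finite {i. f i \<noteq> 0} \<and> Sum_any f = x)"

text \<open>
  The free commutative monoid on \<open>B\<close> consists of the finite multisets with elements in \<open>B\<close>;
  the coefficient of \<open>a\<close> in \<open>lam\<close> is \<open>count lam a\<close>.
\<close>

definition weight_degree_grading ::
  "('k::field_char_0, 'v::ab_group_add) vertex_alg \<Rightarrow> 'b set \<Rightarrow> ('b \<Rightarrow> 'b \<Rightarrow> int) \<Rightarrow> ('b \<Rightarrow> 'v) \<Rightarrow>
   ('b multiset \<Rightarrow> rat \<Rightarrow> 'v set) \<Rightarrow> bool" where
  "weight_degree_grading V B N g G \<longleftrightarrow>
     direct_sum_decomp (smul V) (car V) ({lam. set_mset lam \<subseteq> B} \<times> half_ints) (\<lambda>(lam, d). G lam d) \<and>
     vac V \<in> G {#} 0 \<and>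
     (\<forall>b\<in>B. g b \<in> G {#b#} (- of_int (N b b) / 2)) \<and>
     (\<forall>lam lam' d d' n x y.
        set_mset lam \<subseteq> B \<and> set_mset lam' \<subseteq> B \<and> d \<in> half_ints \<and> d' \<in> half_ints \<and>
        x \<in> G lam d \<and> y \<in> G lam' d' \<longrightarrow>
        nprod V n x y \<in> G (lam + lam') (d + d' - of_int n - 1))"

definition min_degree :: "('b multiset \<Rightarrow> rat \<Rightarrow> 'v::zero set) \<Rightarrow> 'b multiset \<Rightarrow> rat" where
  "min_degree G lam = (LEAST d. d \<in> half_ints \<and> (\<exists>x\<in>G lam d. x \<noteq> 0))"

definition colored_partitions :: "'b set \<Rightarrow> rat \<Rightarrow> (nat \<times> 'b) multiset set" where
  "colored_partitions B q =
     {P. (\<forall>(n, a)\<in>#P. n > 0 \<and> a \<in> B) \<and> of_nat (\<Sum>(n, a)\<in>#P. n) = q}"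

definition bounded_colored_partitions :: "'b set \<Rightarrow> 'b multiset \<Rightarrow> rat \<Rightarrow> (nat \<times> 'b) multiset set" where
  "bounded_colored_partitions B lam q =
     {P \<in> colored_partitions B q. \<forall>a\<in>B. count (image_mset snd P) a \<le> count lam a}"

lemma finite_bounded_colored_partitions: "finite (bounded_colored_partitions B lam q)"
proof (rule finite_subset)
  let ?k = "nat \<lfloor>q\<rfloor>"
  let ?A = "{..?k} \<times> set_mset lam"
  show "bounded_colored_partitions B lam q \<subseteq> (\<Union>m\<le>?k. multisets_of_size ?A m)"
  proof
    fix P assume P: "P \<in> bounded_colored_partitions B lam q"
    have pos: "n > 0" "a \<in> B" if "(n, a) \<in># P" for n a
      using P that by (auto simp: bounded_colored_partitions_def colored_partitions_def)
    have "of_nat (\<Sum>(n, a)\<in>#P. n) = q"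
      using P by (simp add: bounded_colored_partitions_def colored_partitions_def)
    then have sum: "(\<Sum>(n, a)\<in>#P. n) = ?k"
      by (metis floor_of_nat nat_int)
    have "(\<Sum>x\<in>#P. 1) \<le> (\<Sum>(n, a)\<in>#P. n)"
      by (rule sum_mset_mono) (use pos in force)
    then have size: "size P \<le> ?k"
      using sum by simp
    have "n \<le> ?k \<and> a \<in># lam" if na: "(n, a) \<in># P" for n a
    proof
      have "(\<Sum>(n, a)\<in>#P. n) = n + (\<Sum>(n, a)\<in>#P - {#(n, a)#}. n)"
        using insert_DiffM[OF na] by (metis (mono_tags, lifting) case_prod_conv image_mset_add_mset sum_mset.insert)
      then show "n \<le> ?k"
        using sum by simp
      have "a \<in># image_mset snd P"
        using na by force
      then have "0 < count (image_mset snd P) a"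
        by (simp only: count_greater_zero_iff)
      also have "\<dots> \<le> count lam a"
        using P pos(2)[OF na] by (simp add: bounded_colored_partitions_def)
      finally show "a \<in># lam"
        by (simp only: count_greater_zero_iff)
    qed
    then have "set_mset P \<subseteq> ?A"
      by auto
    then show "P \<in> (\<Union>m\<le>?k. multisets_of_size ?A m)"
      using size by (auto simp: multisets_of_size_def)
  qed
  show "finite (\<Union>m\<le>?k. multisets_of_size ?A m)"
    by (intro finite_UN_I finite_atMost finite_multisets_of_size) simp_all
qed

end

theory Submission
  imports Defs "HOL-Computational_Algebra.Formal_Power_Series"
begin

text \<open>
  The free vertex algebra is, as a graded space, a polynomial ring. Take one variable
  \<open>x_b^(n)\<close> for every color \<open>b\<close> and every \<open>n \<ge> 0\<close>, and put
  \<open>x_b(w) = \<Sum> x_b^(n) w^n\<close>. On this ring each color \<open>a\<close> acts by the field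
  \<open>a(u) = x_a(u) \<Gamma>_a(u)\<close>, where \<open>\<Gamma>_a(u)\<close> is the ring homomorphism with
  \<open>\<Gamma>_a(u) x_b(w) = \<plusminus> (u - w)^(-N(a,b)) x_b(w)\<close>. Then
  \<open>a_1(z_1) ... a_k(z_k) 1 = \<plusminus> \<Prod> (z_i - z_j)^(-N(a_i,a_j)) x_(a_1)(z_1) ... x_(a_k)(z_k)\<close>,
  so the fields are mutually local, their orders of locality are given by \<open>N\<close>, and the
  monomials in the \<open>x_b^(n)\<close> are obtained from \<open>1\<close> by clearing the factors
  \<open>z_i - z_j\<close>. A monomial of weight \<open>\<lambda>\<close> has degree \<open>d_min(\<lambda>)\<close> plus the sum of its upper
  indices; forgetting the indices that are \<open>0\<close> turns the monomials of weight \<open>\<lambda>\<close> and degree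
  \<open>d\<close> into the partitions that are to be counted (\<open>partitions_bij\<close>).

  The monomials are linearly independent in the free algebra because the polynomial ring is a
  vertex algebra with bounded generators, so that the free one maps to it. This is an instance
  of a reconstruction theorem (\<open>vertex_algebra_state_va\<close>): a space with translation covariant,
  mutually local fields that generate it from the vacuum is a vertex algebra. It rests on Dong's
  lemma (\<open>Dong\<close>), which keeps products of fields local, and on Goddard's uniqueness argument
  (\<open>good_zero\<close>), which says that a local field is determined by its value at the vacuum.

  The monomials span the free algebra for two reasons. First, the right-normed words
  \<open>a_1_(m_1)( ... (a_k_(m_k) 1))\<close> span every vertex algebra generated by the \<open>a\<close>'s
  (\<open>gact_span\<close>). Second, in any vertex algebra with bounded generators, locality holds with
  the exact order \<open>N(a,b)\<close>, negative orders included (\<open>exact_loc\<close>), so the series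
  \<open>\<Prod> (z_i - z_j)^(N(a_i,a_j)) a_1(z_1) ... a_k(z_k) 1\<close> is symmetric up to the sign, has no
  negative powers, and its coefficients depend only on the multiset of pairs
  \<open>(n_i, a_i)\<close>. This gives a linear map \<open>g\<close> from the polynomial ring that intertwines the
  fields (\<open>g_vop\<close>). It is onto by the first remark and is split by the map from the free
  algebra to the polynomial ring, hence an isomorphism onto the free algebra once the
  polynomial ring is restricted to the given colors.
\<close>

section \<open>Formal series in two variables\<close>

text \<open>
  The coefficient of \<open>w^(\<nu>-k) z^k\<close> in the expansion of \<open>(w - z)^\<nu>\<close> in nonnegative powers of
  \<open>z\<close>.
\<close>

definition sbinom :: "int \<Rightarrow> nat \<Rightarrow> 'k::field_char_0" where
  "sbinom \<nu> k = (- 1) ^ k * (of_int \<nu> gchoose k)"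

lemma sbinom_0 [simp]: "sbinom \<nu> 0 = 1"
  by (simp add: sbinom_def)

lemma sbinom_eq_0: "n < k \<Longrightarrow> sbinom (int n) k = 0"
  by (simp add: sbinom_def binomial_gbinomial[symmetric])

lemma sbinom_Vandermonde: "(\<Sum>i\<le>j. sbinom \<nu> i * sbinom \<mu> (j - i)) = (sbinom (\<nu> + \<mu>) j :: 'k::field_char_0)"
proof -
  have "(\<Sum>i\<le>j. sbinom \<nu> i * sbinom \<mu> (j - i)) =
      (\<Sum>i\<le>j. (- 1) ^ j * ((of_int \<nu> gchoose i) * (of_int \<mu> gchoose (j - i))) :: 'k)"
    by (intro sum.cong refl) (simp add: sbinom_def power_add[symmetric])
  also have "\<dots> = sbinom (\<nu> + \<mu>) j"
    by (simp add: sbinom_def sum_distrib_left[symmetric] gbinomial_Vandermonde[symmetric] atMost_atLeast0)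
  finally show ?thesis .
qed

lemma sbinom_Suc: "of_nat (Suc k) * sbinom \<nu> (Suc k) = - (of_int \<nu> - of_nat k) * (sbinom \<nu> k :: 'k::field_char_0)"
proof -
  have *: "of_nat (Suc k) * (of_int \<nu> gchoose Suc k) = (of_int \<nu> - of_nat k) * (of_int \<nu> gchoose k :: 'k)"
    by (simp only: gbinomial_absorption gbinomial_absorb_comp)
  have "of_nat (Suc k) * sbinom \<nu> (Suc k) = - ((- 1) ^ k * (of_nat (Suc k) * (of_int \<nu> gchoose Suc k) :: 'k))"
    by (simp add: sbinom_def)
  also have "\<dots> = - (of_int \<nu> - of_nat k) * sbinom \<nu> k"
    by (subst *) (simp add: sbinom_def algebra_simps)
  finally show ?thesis .
qed

text \<open>
  A series in \<open>w\<close> and \<open>z\<close> is given by its modes: \<open>F m n\<close> is the coefficient of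
  \<open>w^(-m-1) z^(-n-1)\<close>, as in \<open>Y(a)(w) Y(b)(z) c\<close>. Thus multiplication by \<open>w\<close> is a shift of
  \<open>m\<close> by one. Boundedness means that the powers of \<open>z\<close> are bounded below uniformly in the
  power of \<open>w\<close>; then \<open>F\<close> can be multiplied by any series in \<open>z/w\<close>.
\<close>

definition bdd :: "(int \<Rightarrow> int \<Rightarrow> 'v::zero) \<Rightarrow> bool" where
  "bdd F \<longleftrightarrow> (\<exists>n0. \<forall>m n. n0 \<le> n \<longrightarrow> F m n = 0)"

text \<open>
  Multiplication by \<open>w - z\<close>.
\<close>

definition Delta :: "(int \<Rightarrow> int \<Rightarrow> 'v::ab_group_add) \<Rightarrow> int \<Rightarrow> int \<Rightarrow> 'v" where
  "Delta F m n = F (m + 1) n - F m (n + 1)"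

lemma funpow_le: "j \<le> k \<Longrightarrow> (f ^^ k) x = (f ^^ (k - j)) ((f ^^ j) x)"
  by (metis comp_apply funpow_add le_add_diff_inverse2)

lemma bdd_pw:
  assumes "bdd F" obtains n0 where "\<And>m n. n0 \<le> n \<Longrightarrow> F m n = 0"
  using assms unfolding bdd_def by blast

lemma bddI: "(\<And>m n. n0 \<le> n \<Longrightarrow> F m n = 0) \<Longrightarrow> bdd F"
  unfolding bdd_def by blast

lemma bdd_add:
  fixes F G :: "int \<Rightarrow> int \<Rightarrow> 'v::monoid_add"
  assumes "bdd F" "bdd G" shows "bdd (\<lambda>m n. F m n + G m n)"
proof -
  obtain a b where "\<And>m n. a \<le> n \<Longrightarrow> F m n = 0" "\<And>m n. b \<le> n \<Longrightarrow> G m n = 0"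
    using assms by (metis bdd_pw)
  then show ?thesis by (intro bddI[of "max a b"]) auto
qed

lemma bdd_diff:
  fixes F G :: "int \<Rightarrow> int \<Rightarrow> 'v::group_add"
  assumes "bdd F" "bdd G" shows "bdd (\<lambda>m n. F m n - G m n)"
proof -
  obtain a b where "\<And>m n. a \<le> n \<Longrightarrow> F m n = 0" "\<And>m n. b \<le> n \<Longrightarrow> G m n = 0"
    using assms by (metis bdd_pw)
  then show ?thesis by (intro bddI[of "max a b"]) auto
qed

lemma bdd_sum:
  fixes F :: "'i \<Rightarrow> int \<Rightarrow> int \<Rightarrow> 'v::comm_monoid_add"
  assumes "finite S" "\<And>i. i \<in> S \<Longrightarrow> bdd (F i)"
  shows "bdd (\<lambda>m n. \<Sum>i\<in>S. F i m n)"
  using assms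
proof (induction S)
  case empty
  then show ?case by (auto intro: bddI)
next
  case (insert x S)
  then show ?case using bdd_add[of "F x"] by simp
qed

lemma bdd_map: "bdd F \<Longrightarrow> L 0 = 0 \<Longrightarrow> bdd (\<lambda>m n. L (F m n))"
  unfolding bdd_def by metis

lemma bdd_shift: assumes "bdd F" shows "bdd (\<lambda>m n. F (m + i) (n + j))"
proof -
  obtain a where "\<And>m n. a \<le> n \<Longrightarrow> F m n = 0" using assms by (metis bdd_pw)
  then show ?thesis by (intro bddI[of "a - j"]) auto
qed

lemma bdd_Delta: "bdd F \<Longrightarrow> bdd (Delta F)"
  unfolding Delta_def[abs_def]
  using bdd_diff[OF bdd_shift[of F 1 0] bdd_shift[of F 0 1]] by simp

text \<open>
  The coefficient of the lowest power of \<open>z\<close> is multiplied by \<open>w\<close>, so \<open>w - z\<close> is not a zero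
  divisor on bounded series. On series that are unbounded in both directions it is: the formal
  delta function is annihilated.
\<close>

lemma Delta_inj:
  assumes "bdd F" "\<And>m n. Delta F m n = 0"
  shows "F m n = 0"
proof -
  obtain n0 where n0: "\<And>m n. n0 \<le> n \<Longrightarrow> F m n = 0" using assms(1) by (metis bdd_pw)
  have "\<forall>m. F m (n0 - int j) = 0" for j
  proof (induction j)
    case (Suc j)
    show ?case
    proof
      fix m
      show "F m (n0 - int (Suc j)) = 0"
        using assms(2)[of "m - 1" "n0 - int (Suc j)"] Suc by (simp add: Delta_def algebra_simps)
    qed
  qed (simp add: n0)
  from this[of "nat (n0 - n)"] show ?thesis
    by (cases "n0 \<le> n") (auto simp: n0)
qed

lemma Delta_funpow_inj:
  assumes "bdd F" "\<And>m n. (Delta ^^ j) F m n = 0"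
  shows "F m n = 0"
  using assms
proof (induction j arbitrary: F m n)
  case (Suc j)
  have "Delta F m n = 0" for m n
    by (rule Suc.IH) (use Suc.prems in \<open>auto simp: bdd_Delta funpow_swap1\<close>)
  then show ?case using Delta_inj[OF Suc.prems(1)] by blast
qed simp

lemma Delta_funpow_0 [simp]: "(Delta ^^ j) (\<lambda>m n. 0) = (\<lambda>m n. 0)"
  by (induction j) (auto simp: Delta_def fun_eq_iff)

lemma Delta_funpow_add: "(Delta ^^ j) (\<lambda>m n. F m n + G m n) = (\<lambda>m n. (Delta ^^ j) F m n + (Delta ^^ j) G m n)"
  by (induction j) (auto simp: Delta_def fun_eq_iff)

lemma Delta_funpow_diff: "(Delta ^^ j) (\<lambda>m n. F m n - G m n) = (\<lambda>m n. (Delta ^^ j) F m n - (Delta ^^ j) G m n)"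
  by (induction j) (auto simp: Delta_def fun_eq_iff)

lemma Delta_funpow_map:
  assumes "\<And>x y. L (x - y) = L x - L y"
  shows "(Delta ^^ j) (\<lambda>m n. L (F m n)) = (\<lambda>m n. L ((Delta ^^ j) F m n))"
  by (induction j) (auto simp: Delta_def fun_eq_iff assms)

lemma Delta_funpow_mono:
  assumes "\<And>m n. (Delta ^^ j) F m n = 0" "j \<le> k"
  shows "(Delta ^^ k) F m n = 0"
proof -
  have "(Delta ^^ j) F = (\<lambda>m n. 0)" using assms by (auto simp: fun_eq_iff)
  moreover have "(Delta ^^ k) F = (Delta ^^ (k - j)) ((Delta ^^ j) F)"
    by (rule funpow_le[OF assms(2)])
  ultimately show ?thesis by simp
qed

locale char0_space = vector_space scale
  for scale :: "'k::field_char_0 \<Rightarrow> 'v::ab_group_add \<Rightarrow> 'v" (infixr "*s" 75)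
begin

text \<open>
  Multiplication by \<open>\<iota>_(w,z) (w - z)^\<nu>\<close>.
\<close>

definition imul :: "int \<Rightarrow> (int \<Rightarrow> int \<Rightarrow> 'v) \<Rightarrow> int \<Rightarrow> int \<Rightarrow> 'v" where
  "imul \<nu> F m n = Sum_any (\<lambda>k::nat. sbinom \<nu> k *s F (m + \<nu> - int k) (n + int k))"

lemma imul_sum:
  assumes "\<And>m n'. n + int K \<le> n' \<Longrightarrow> F m n' = 0"
  shows "imul \<nu> F m n = (\<Sum>k<K. sbinom \<nu> k *s F (m + \<nu> - int k) (n + int k))"
  unfolding imul_def
proof (rule Sum_any.expand_superset)
  show "{a. sbinom \<nu> a *s F (m + \<nu> - int a) (n + int a) \<noteq> 0} \<subseteq> {..<K}"
  proof -
    have "F (m + \<nu> - int a) (n + int a) = 0" if "\<not> a < K" for a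
      using that by (intro assms) simp
    then show ?thesis by auto
  qed
qed simp

lemma imul_nat:
  "imul (int j) F m n = (\<Sum>k\<le>j. sbinom (int j) k *s F (m + int j - int k) (n + int k))"
  unfolding imul_def
proof (rule Sum_any.expand_superset)
  show "{a. sbinom (int j) a *s F (m + int j - int a) (n + int a) \<noteq> 0} \<subseteq> {..j}"
  proof -
    have "sbinom (int j) a = (0::'k)" if "\<not> a \<le> j" for a
      using that by (intro sbinom_eq_0) simp
    then show ?thesis by auto
  qed
qed simp

lemma imul_0: "imul 0 F = F"
  using imul_nat[of 0 F] by (simp add: fun_eq_iff)

lemma imul_1: "imul 1 F = Delta F"
proof -
  have "sbinom 1 (Suc 0) = (-1::'k)" by (simp add: sbinom_def)
  then show ?thesis using imul_nat[of 1 F] by (simp add: fun_eq_iff Delta_def add.commute)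
qed

text \<open>
  By the Vandermonde identity, \<open>imul\<close> is an action of the additive group of integers on bounded
  series. This is what permits division by \<open>w - z\<close> below.
\<close>

lemma imul_imul:
  assumes "bdd F"
  shows "imul \<nu> (imul \<mu> F) = imul (\<nu> + \<mu>) F"
proof (intro ext)
  fix m n
  obtain n0 where n0: "\<And>m n. n0 \<le> n \<Longrightarrow> F m n = 0" using assms by (metis bdd_pw)
  define K where "K = nat (n0 - n)"
  have K: "n0 \<le> n + int K" by (simp add: K_def)
  have *: "imul \<mu> F m' n' = (\<Sum>k<K - l. sbinom \<mu> k *s F (m' + \<mu> - int k) (n' + int k))" if "n' = n + int l" for m' n' l
    by (rule imul_sum) (use that K in \<open>auto simp: n0\<close>)
  have "imul \<nu> (imul \<mu> F) m n = (\<Sum>k<K. sbinom \<nu> k *s imul \<mu> F (m + \<nu> - int k) (n + int k))"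
    by (rule imul_sum) (use K in \<open>auto simp: n0 imul_sum[where K = 0]\<close>)
  also have "\<dots> = (\<Sum>k<K. \<Sum>l<K - k. (sbinom \<nu> k * sbinom \<mu> l) *s F (m + (\<nu> + \<mu>) - int (k + l)) (n + int (k + l)))"
    by (intro sum.cong refl, subst *[OF refl]) (simp add: scale_sum_right algebra_simps)
  also have "\<dots> = (\<Sum>(k, l)\<in>{(k, l). k + l < K}. (sbinom \<nu> k * sbinom \<mu> l) *s F (m + (\<nu> + \<mu>) - int (k + l)) (n + int (k + l)))"
    by (subst sum.Sigma) (auto intro!: sum.cong)
  also have "\<dots> = (\<Sum>j<K. \<Sum>k\<le>j. (sbinom \<nu> k * sbinom \<mu> (j - k)) *s F (m + (\<nu> + \<mu>) - int j) (n + int j))"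
    by (subst sum.triangle_reindex) (auto intro!: sum.cong)
  also have "\<dots> = (\<Sum>j<K. sbinom (\<nu> + \<mu>) j *s F (m + (\<nu> + \<mu>) - int j) (n + int j))"
    by (intro sum.cong refl) (simp only: scale_sum_left[symmetric] sbinom_Vandermonde)
  also have "\<dots> = imul (\<nu> + \<mu>) F m n"
    by (rule imul_sum[symmetric]) (use K in \<open>auto simp: n0\<close>)
  finally show "imul \<nu> (imul \<mu> F) m n = imul (\<nu> + \<mu>) F m n" .
qed

lemma Delta_funpow_imul: assumes "bdd F" shows "(Delta ^^ j) (imul \<nu> F) = imul (int j + \<nu>) F"
proof (induction j)
  case (Suc j)
  have "(Delta ^^ Suc j) (imul \<nu> F) = imul 1 (imul (int j + \<nu>) F)" by (simp add: Suc imul_1)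
  then show ?case by (simp add: imul_imul[OF assms] algebra_simps)
qed simp

lemma imul_nat_Delta: "imul (int j) F = (Delta ^^ j) F"
proof (induction j)
  case (Suc j)
  have Pascal: "sbinom (1 + int j) (Suc k) = (sbinom (int j) (Suc k) - sbinom (int j) k :: 'k)" for k
    using gbinomial_Suc_Suc[of "of_nat j :: 'k" k] by (simp add: sbinom_def algebra_simps)
  have "(\<Sum>k\<le>Suc j. sbinom (int (Suc j)) k *s F (m + int (Suc j) - int k) (n + int k))
      = (\<Sum>k\<le>j. sbinom (int j) k *s F (m + 1 + int j - int k) (n + int k))
        - (\<Sum>k\<le>j. sbinom (int j) k *s F (m + int j - int k) (n + 1 + int k))" for m n
  proof -
    have "(\<Sum>k\<le>Suc j. sbinom (int (Suc j)) k *s F (m + int (Suc j) - int k) (n + int k))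
      = F (m + 1 + int j) n + (\<Sum>k\<le>j. sbinom (int j) (Suc k) *s F (m + int j - int k) (n + 1 + int k))
        - (\<Sum>k\<le>j. sbinom (int j) k *s F (m + int j - int k) (n + 1 + int k))"
      by (subst sum.atMost_Suc_shift) (simp add: Pascal scale_left_diff_distrib sum_subtractf algebra_simps)
    also have "F (m + 1 + int j) n + (\<Sum>k\<le>j. sbinom (int j) (Suc k) *s F (m + int j - int k) (n + 1 + int k))
      = (\<Sum>k\<le>Suc j. sbinom (int j) k *s F (m + 1 + int j - int k) (n + int k))"
      by (subst sum.atMost_Suc_shift) (simp add: algebra_simps)
    also have "\<dots> = (\<Sum>k\<le>j. sbinom (int j) k *s F (m + 1 + int j - int k) (n + int k))"
      using sbinom_eq_0[of j "Suc j", where 'a='k] by simp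
    finally show ?thesis .
  qed
  then show ?case
    unfolding fun_eq_iff imul_nat by (simp add: Suc[symmetric] Delta_def imul_nat)
qed (simp add: imul_0)

lemma imul_add:
  assumes "bdd F" "bdd G"
  shows "imul \<nu> (\<lambda>m n. F m n + G m n) m n = imul \<nu> F m n + imul \<nu> G m n"
proof -
  obtain a b where ab: "\<And>m n. a \<le> n \<Longrightarrow> F m n = 0" "\<And>m n. b \<le> n \<Longrightarrow> G m n = 0"
    using assms by (metis bdd_pw)
  define K where "K = nat (max a b - n)"
  have K: "a \<le> n + int K" "b \<le> n + int K" unfolding K_def by linarith+
  show ?thesis
    by (subst (1 2 3) imul_sum[where K = K]) (use K in \<open>auto simp: ab scale_right_distrib sum.distrib\<close>)
qed

lemma imul_map:
  assumes "module_hom scale scale L" "bdd F"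
  shows "imul \<nu> (\<lambda>m n. L (F m n)) m n = L (imul \<nu> F m n)"
proof -
  interpret L: module_hom scale scale L by fact
  obtain a where a: "\<And>m n. a \<le> n \<Longrightarrow> F m n = 0" using assms by (metis bdd_pw)
  define K where "K = nat (a - n)"
  have K: "a \<le> n + int K" by (simp add: K_def)
  show ?thesis
    by (subst (1 2) imul_sum[where K = K]) (use K in \<open>auto simp: a L.sum L.scale\<close>)
qed

lemma imul_zero [simp]: "imul \<nu> (\<lambda>m n. 0) m n = 0"
  by (simp add: imul_def)

lemma imul_scale: "imul \<nu> (\<lambda>m n. c *s F m n) m n = c *s imul \<nu> F m n"
proof (cases "c = 0")
  case True then show ?thesis by (simp)
next
  case False
  have "{k. sbinom \<nu> k *s c *s F (m + \<nu> - int k) (n + int k) \<noteq> 0} = {k. sbinom \<nu> k *s F (m + \<nu> - int k) (n + int k) \<noteq> 0}"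
    using False by auto
  then show ?thesis
    unfolding imul_def Sum_any.expand_set by (simp add: scale_sum_right mult.commute)
qed

lemma imul_diff:
  assumes "bdd F" "bdd G"
  shows "imul \<nu> (\<lambda>m n. F m n - G m n) m n = imul \<nu> F m n - imul \<nu> G m n"
proof -
  have "bdd (\<lambda>m n. (-1) *s G m n)" using assms(2) by (rule bdd_map) simp
  from imul_add[OF assms(1) this, of \<nu>] show ?thesis by (simp only: imul_scale) simp
qed

lemma imul_sumf:
  assumes "finite S" "\<And>i. i \<in> S \<Longrightarrow> bdd (F i)"
  shows "imul \<nu> (\<lambda>m n. \<Sum>i\<in>S. F i m n) m n = (\<Sum>i\<in>S. imul \<nu> (F i) m n)"
  using assms
proof (induction S)
  case (insert x S)
  have "bdd (\<lambda>m n. \<Sum>i\<in>S. F i m n)"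
    by (rule bdd_sum) (use insert in auto)
  then show ?case using insert by (simp add: imul_add)
qed simp

lemma imul_shift: "imul \<nu> (\<lambda>m n. F (m + i) (n + j)) m n = imul \<nu> F (m + i) (n + j)"
  by (simp add: imul_def algebra_simps)

text \<open>
  The derivation \<open>\<partial>/\<partial>w + \<partial>/\<partial>z\<close>. It annihilates \<open>w - z\<close> and therefore commutes with all
  \<open>imul \<nu>\<close>.
\<close>

definition mderiv :: "(int \<Rightarrow> int \<Rightarrow> 'v) \<Rightarrow> int \<Rightarrow> int \<Rightarrow> 'v" where
  "mderiv F m n = - (of_int m *s F (m - 1) n) - of_int n *s F m (n - 1)"

lemma imul_mderiv:
  assumes "bdd F"
  shows "imul \<nu> (mderiv F) m n = mderiv (imul \<nu> F) m n"
proof -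
  obtain a where a: "\<And>m n. a \<le> n \<Longrightarrow> F m n = 0" using assms by (metis bdd_pw)
  define K where "K = nat (a + 1 - n)"
  have K: "a + 1 \<le> n + int K" by (simp add: K_def)
  define S where "S k = F (m + \<nu> - 1 - int k) (n + int k)" for k
  define R where "R k = F (m + \<nu> - int k) (n - 1 + int k)" for k
  have RS: "R (Suc k) = S k" for k by (simp add: R_def S_def algebra_simps)
  have S0: "S k = 0" if "K \<le> k" for k using that K by (auto simp: S_def intro!: a)
  have R0: "R k = 0" if "K \<le> k" for k using that K by (auto simp: R_def intro!: a)
  have "imul \<nu> (mderiv F) m n = (\<Sum>k<K. sbinom \<nu> k *s mderiv F (m + \<nu> - int k) (n + int k))"
    by (rule imul_sum) (use K in \<open>auto simp: a mderiv_def\<close>)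
  also have "\<dots> = (\<Sum>k<K. - (of_int m *s sbinom \<nu> k *s S k) - of_int n *s sbinom \<nu> k *s R k
      + (- ((of_int \<nu> - of_nat k) * sbinom \<nu> k) *s S k - (of_nat k * sbinom \<nu> k) *s R k))"
    by (intro sum.cong refl) (simp add: mderiv_def S_def R_def algebra_simps)
  also have "\<dots> = - (of_int m *s (\<Sum>k<K. sbinom \<nu> k *s S k)) - of_int n *s (\<Sum>k<K. sbinom \<nu> k *s R k)
      + ((\<Sum>k<K. - ((of_int \<nu> - of_nat k) * sbinom \<nu> k) *s S k) - (\<Sum>k<K. (of_nat k * sbinom \<nu> k) *s R k))"
    by (simp add: sum.distrib sum_subtractf sum_negf scale_sum_right)
  also have "(\<Sum>k<K. (of_nat k * sbinom \<nu> k) *s R k) = (\<Sum>k<Suc K. (of_nat k * sbinom \<nu> k) *s R k)"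
    by (simp add: R0)
  also have "\<dots> = (\<Sum>k<K. (of_nat (Suc k) * sbinom \<nu> (Suc k)) *s S k)"
    by (subst sum.lessThan_Suc_shift) (simp add: RS)
  also have "\<dots> = (\<Sum>k<K. - ((of_int \<nu> - of_nat k) * sbinom \<nu> k) *s S k)"
    by (simp only: sbinom_Suc mult_minus_left)
  also have "(\<Sum>k<K. sbinom \<nu> k *s S k) = imul \<nu> F (m - 1) n"
    by (subst imul_sum[where K = K]) (use K in \<open>auto simp: S_def a algebra_simps\<close>)
  also have "(\<Sum>k<K. sbinom \<nu> k *s R k) = imul \<nu> F m (n - 1)"
    by (subst imul_sum[where K = K]) (use K in \<open>auto simp: R_def a algebra_simps\<close>)
  finally show ?thesis unfolding mderiv_def[of "imul \<nu> F"] by (simp only: diff_self add_0_right)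
qed

lemma mi13_mi23:
  assumes "\<And>r m n. n0 \<le> n \<Longrightarrow> T r m n = 0"
  shows "imul \<nu> (\<lambda>r n. imul \<mu> (\<lambda>m n. T r m n) m n) r n = imul \<mu> (\<lambda>m n. imul \<nu> (\<lambda>r n. T r m n) r n) m n"
proof -
  define K where "K = nat (n0 - n)"
  have K: "n0 \<le> n + int K" by (simp add: K_def)
  have *: "imul \<mu> (T r) m' (n + int k) = (\<Sum>l<K. sbinom \<mu> l *s T r (m' + \<mu> - int l) (n + int k + int l))" for r m' k
    by (rule imul_sum) (use K in \<open>auto simp: assms\<close>)
  have **: "imul \<nu> (\<lambda>r n. T r m' n) r' (n + int k) = (\<Sum>l<K. sbinom \<nu> l *s T (r' + \<nu> - int l) m' (n + int k + int l))" for r' m' k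
    by (rule imul_sum) (use K in \<open>auto simp: assms\<close>)
  have "imul \<nu> (\<lambda>r n. imul \<mu> (\<lambda>m n. T r m n) m n) r n
    = (\<Sum>k<K. sbinom \<nu> k *s imul \<mu> (T (r + \<nu> - int k)) m (n + int k))"
    by (rule imul_sum) (use K in \<open>auto simp: assms imul_sum[where K = 0]\<close>)
  also have "\<dots> = (\<Sum>k<K. \<Sum>l<K. (sbinom \<nu> k * sbinom \<mu> l) *s T (r + \<nu> - int k) (m + \<mu> - int l) (n + int k + int l))"
    by (simp add: * scale_sum_right)
  also have "\<dots> = (\<Sum>l<K. \<Sum>k<K. (sbinom \<nu> k * sbinom \<mu> l) *s T (r + \<nu> - int k) (m + \<mu> - int l) (n + int k + int l))"
    by (rule sum.swap)
  also have "\<dots> = (\<Sum>l<K. sbinom \<mu> l *s imul \<nu> (\<lambda>r n. T r (m + \<mu> - int l) n) r (n + int l))"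
    by (simp add: ** scale_sum_right mult.commute algebra_simps)
  also have "\<dots> = imul \<mu> (\<lambda>m n. imul \<nu> (\<lambda>r n. T r m n) r n) m n"
    by (rule imul_sum[symmetric]) (use K in \<open>auto simp: assms imul_sum[where K = 0]\<close>)
  finally show ?thesis .
qed

lemma mi12_mi13:
  assumes "\<And>r m n. m0 \<le> m \<Longrightarrow> T r m n = 0" "\<And>r m n. n0 \<le> n \<Longrightarrow> T r m n = 0"
  shows "imul \<nu> (\<lambda>r m. imul \<mu> (\<lambda>r n. T r m n) r n) r m = imul \<mu> (\<lambda>r n. imul \<nu> (\<lambda>r m. T r m n) r m) r n"
proof -
  define K where "K = nat (m0 - m)"
  have K: "m0 \<le> m + int K" by (simp add: K_def)
  define L where "L = nat (n0 - n)"
  have L: "n0 \<le> n + int L" by (simp add: L_def)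
  have *: "imul \<mu> (\<lambda>r n. T r m' n) r' n = (\<Sum>l<L. sbinom \<mu> l *s T (r' + \<mu> - int l) m' (n + int l))" for r' m'
    by (rule imul_sum) (use L in \<open>auto simp: assms\<close>)
  have **: "imul \<nu> (\<lambda>r m. T r m n') r' m = (\<Sum>l<K. sbinom \<nu> l *s T (r' + \<nu> - int l) (m + int l) n')" for r' n'
    by (rule imul_sum) (use K in \<open>auto simp: assms\<close>)
  have "imul \<nu> (\<lambda>r m. imul \<mu> (\<lambda>r n. T r m n) r n) r m
    = (\<Sum>k<K. sbinom \<nu> k *s imul \<mu> (\<lambda>r n. T r (m + int k) n) (r + \<nu> - int k) n)"
    by (rule imul_sum) (use K in \<open>auto simp: assms\<close>)
  also have "\<dots> = (\<Sum>k<K. \<Sum>l<L. (sbinom \<nu> k * sbinom \<mu> l) *s T (r + \<nu> + \<mu> - int k - int l) (m + int k) (n + int l))"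
    by (simp add: * scale_sum_right algebra_simps)
  also have "\<dots> = (\<Sum>l<L. \<Sum>k<K. (sbinom \<nu> k * sbinom \<mu> l) *s T (r + \<nu> + \<mu> - int k - int l) (m + int k) (n + int l))"
    by (rule sum.swap)
  also have "\<dots> = (\<Sum>l<L. sbinom \<mu> l *s imul \<nu> (\<lambda>r m. T r m (n + int l)) (r + \<mu> - int l) m)"
    by (simp add: ** scale_sum_right algebra_simps)
  also have "\<dots> = imul \<mu> (\<lambda>r n. imul \<nu> (\<lambda>r m. T r m n) r m) r n"
    by (rule imul_sum[symmetric]) (use L in \<open>auto simp: assms\<close>)
  finally show ?thesis .
qed

end

section \<open>Differences in three variables\<close>

type_synonym 'v series3 = "int \<Rightarrow> int \<Rightarrow> int \<Rightarrow> 'v"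

text \<open>
  For a series in \<open>x, w, z\<close>, multiplication by \<open>x - w\<close> and by \<open>x - z\<close>.
\<close>

definition D12 :: "'v::ab_group_add series3 \<Rightarrow> 'v series3" where
  "D12 T r m n = T (r + 1) m n - T r (m + 1) n"

definition D13 :: "'v::ab_group_add series3 \<Rightarrow> 'v series3" where
  "D13 T r m n = T (r + 1) m n - T r m (n + 1)"

definition flip23 :: "'v series3 \<Rightarrow> 'v series3" where
  "flip23 T r m n = T r n m"

lemma flip23_zero [simp]: "flip23 (\<lambda>r m n. 0) = (\<lambda>r m n. 0)"
  by (auto simp: fun_eq_iff flip23_def)

lemma D12_flip23: "D12 (flip23 T) = flip23 (D13 T)" and D13_flip23: "D13 (flip23 T) = flip23 (D12 T)"
  by (auto simp: fun_eq_iff D12_def D13_def flip23_def)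

lemma D12_pow_flip23: "(D12 ^^ j) (flip23 T) = flip23 ((D13 ^^ j) T)"
  by (induction j) (auto simp: D12_flip23)

lemma D13_pow_flip23: "(D13 ^^ j) (flip23 T) = flip23 ((D12 ^^ j) T)"
  by (induction j) (auto simp: D13_flip23)

lemma D12_D13: "D12 (D13 T) = D13 (D12 T)"
  by (auto simp: fun_eq_iff D12_def D13_def algebra_simps)

lemma D12_pow_D13: "(D12 ^^ j) (D13 T) = D13 ((D12 ^^ j) T)"
  by (induction j) (auto simp: D12_D13)

lemma D12_pow_D13_pow: "(D12 ^^ j) ((D13 ^^ k) T) = (D13 ^^ k) ((D12 ^^ j) T)"
  by (induction k arbitrary: T) (auto simp: D12_pow_D13)

lemma D12_pow_eq: "(D12 ^^ j) T r m n = (Delta ^^ j) (\<lambda>r m. T r m n) r m"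
proof (induction j arbitrary: r m)
  case (Suc j) then show ?case by (simp add: D12_def Delta_def)
qed simp

lemma D13_pow_eq: "(D13 ^^ j) T r m n = (Delta ^^ j) (\<lambda>r n. T r m n) r n"
proof (induction j arbitrary: r n)
  case (Suc j) then show ?case by (simp add: D13_def Delta_def)
qed simp

lemma D12_pow_zero [simp]: "(D12 ^^ j) (\<lambda>r m n. 0) = (\<lambda>r m n. 0)"
  by (induction j) (auto simp: fun_eq_iff D12_def)

lemma D13_pow_zero [simp]: "(D13 ^^ j) (\<lambda>r m n. 0) = (\<lambda>r m n. 0)"
  by (induction j) (auto simp: fun_eq_iff D13_def)

lemma D12_pow_add: "(D12 ^^ j) (\<lambda>r m n. T r m n + U r m n) = (\<lambda>r m n. (D12 ^^ j) T r m n + (D12 ^^ j) U r m n)"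
  by (induction j) (auto simp: fun_eq_iff D12_def)

lemma D13_pow_add: "(D13 ^^ j) (\<lambda>r m n. T r m n + U r m n) = (\<lambda>r m n. (D13 ^^ j) T r m n + (D13 ^^ j) U r m n)"
  by (induction j) (auto simp: fun_eq_iff D13_def)

lemma D12_pow_diff: "(D12 ^^ j) (\<lambda>r m n. T r m n - U r m n) = (\<lambda>r m n. (D12 ^^ j) T r m n - (D12 ^^ j) U r m n)"
  by (induction j) (auto simp: fun_eq_iff D12_def)

lemma D13_pow_diff: "(D13 ^^ j) (\<lambda>r m n. T r m n - U r m n) = (\<lambda>r m n. (D13 ^^ j) T r m n - (D13 ^^ j) U r m n)"
  by (induction j) (auto simp: fun_eq_iff D13_def)

lemma D12_pow_map: "(\<And>x y. L (x - y) = L x - L y) \<Longrightarrow> (D12 ^^ j) (\<lambda>r m n. L (T r m n)) = (\<lambda>r m n. L ((D12 ^^ j) T r m n))"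
  by (induction j) (auto simp: fun_eq_iff D12_def)

lemma D13_pow_map: "(\<And>x y. L (x - y) = L x - L y) \<Longrightarrow> (D13 ^^ j) (\<lambda>r m n. L (T r m n)) = (\<lambda>r m n. L ((D13 ^^ j) T r m n))"
  by (induction j) (auto simp: fun_eq_iff D13_def)

lemma D12_pow_inj:
  assumes "\<And>r m n. R \<le> r \<Longrightarrow> T r m n = 0" "(D12 ^^ j) T = (\<lambda>r m n. 0)"
  shows "T = (\<lambda>r m n. 0)"
proof (intro ext)
  fix r m n
  let ?F = "\<lambda>m r. T r m n"
  have "(Delta ^^ j) (\<lambda>r m. T r m n) r m = 0" for r m
    using fun_cong[OF fun_cong[OF fun_cong[OF assms(2)]], of r m n] by (simp add: D12_pow_eq)
  then have z: "(Delta ^^ j) (\<lambda>r m. T r m n) = (\<lambda>r m. 0)" by (auto simp: fun_eq_iff)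
  have neg: "(Delta ^^ j) ?F m r = 0 \<longleftrightarrow> (Delta ^^ j) (\<lambda>r m. T r m n) r m = 0" for m r
  proof -
    have "(Delta ^^ j) ?F m r = (if even j then (Delta ^^ j) (\<lambda>r m. T r m n) r m else - (Delta ^^ j) (\<lambda>r m. T r m n) r m)" for m r
      by (induction j arbitrary: m r) (auto simp: Delta_def)
    then show ?thesis by simp
  qed
  show "T r m n = 0"
    by (rule Delta_funpow_inj[of ?F j]) (use assms(1) z in \<open>auto simp: neg intro: bddI\<close>)
qed

lemma D13_pow_inj:
  assumes "\<And>r m n. R \<le> r \<Longrightarrow> T r m n = 0" "(D13 ^^ j) T = (\<lambda>r m n. 0)"
  shows "T = (\<lambda>r m n. 0)"
proof -
  have *: "(D12 ^^ j) (flip23 T) = (\<lambda>r m n. 0)"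
    by (simp add: D12_pow_flip23 assms(2))
  have "flip23 T = (\<lambda>r m n. 0)"
    by (rule D12_pow_inj[OF _ *, of R]) (simp add: flip23_def assms(1))
  then show ?thesis by (auto simp: fun_eq_iff flip23_def)
qed

lemma D12_pow_bounded:
  "(\<And>r m n. R \<le> r \<Longrightarrow> T r m n = 0) \<Longrightarrow> R \<le> r \<Longrightarrow> (D12 ^^ j) T r m n = 0"
  by (induction j arbitrary: r m n) (auto simp: D12_def)

lemma D13_D12_pow_inj:
  assumes "\<And>r m n. R \<le> r \<Longrightarrow> T r m n = 0" "(D13 ^^ j) ((D12 ^^ k) T) = (\<lambda>r m n. 0)"
  shows "T = (\<lambda>r m n. 0)"
proof (rule D12_pow_inj[where j = k and R = R])
  show "(D12 ^^ k) T = (\<lambda>r m n. 0)"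
    by (rule D13_pow_inj[where R = R and j = j, OF _ assms(2)]) (rule D12_pow_bounded[OF assms(1)])
qed (rule assms(1))

section \<open>Local fields and Dong's lemma\<close>

context char0_space begin

abbreviation lin :: "('v \<Rightarrow> 'v) \<Rightarrow> bool" where "lin \<equiv> module_hom scale scale"

definition fld :: "(int \<Rightarrow> 'v \<Rightarrow> 'v) \<Rightarrow> bool" where
  "fld f \<longleftrightarrow> (\<forall>n. lin (f n)) \<and> (\<forall>c. \<exists>n0. \<forall>n\<ge>n0. f n c = 0)"

definition supercomm :: "'k \<Rightarrow> (int \<Rightarrow> 'v \<Rightarrow> 'v) \<Rightarrow> (int \<Rightarrow> 'v \<Rightarrow> 'v) \<Rightarrow> 'v \<Rightarrow> int \<Rightarrow> int \<Rightarrow> 'v" where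
  "supercomm s f g c m n = f m (g n c) - s *s g n (f m c)"

definition loc :: "nat \<Rightarrow> 'k \<Rightarrow> (int \<Rightarrow> 'v \<Rightarrow> 'v) \<Rightarrow> (int \<Rightarrow> 'v \<Rightarrow> 'v) \<Rightarrow> bool" where
  "loc K s f g \<longleftrightarrow> (\<forall>c. (Delta ^^ K) (supercomm s f g c) = (\<lambda>m n. 0))"

text \<open>
  The commutator with the factor \<open>(w - z)^\<nu>\<close> expanded differently in the two terms:
  \<open>\<iota>_(w,z) (w - z)^\<nu> f(w) g(z) c - s \<iota>_(z,w) (w - z)^\<nu> g(z) f(w) c\<close>. Its vanishing is locality of
  order \<open>\<nu>\<close>, also for negative \<open>\<nu>\<close>; its residue at \<open>w\<close> is the \<open>\<nu>\<close>-th product of \<open>f\<close> and \<open>g\<close>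
  as a field in \<open>z\<close>.
\<close>

definition tcomm :: "int \<Rightarrow> 'k \<Rightarrow> (int \<Rightarrow> 'v \<Rightarrow> 'v) \<Rightarrow> (int \<Rightarrow> 'v \<Rightarrow> 'v) \<Rightarrow> 'v \<Rightarrow> int \<Rightarrow> int \<Rightarrow> 'v" where
  "tcomm \<nu> s f g c m n = imul \<nu> (\<lambda>m n. f m (g n c)) m n
     - (s * (- 1) powi \<nu>) *s imul \<nu> (\<lambda>n m. g n (f m c)) n m"

lemma fld_lin: "fld f \<Longrightarrow> lin (f n)" by (simp add: fld_def)

lemma fld_diff: "fld f \<Longrightarrow> f n (x - y) = f n x - f n y" using module_hom.diff[of scale scale "f n"] by (simp add: fld_def)
lemma fld_add: "fld f \<Longrightarrow> f n (x + y) = f n x + f n y" using module_hom.add[of scale scale "f n"] by (simp add: fld_def)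
lemma fld_scale: "fld f \<Longrightarrow> f n (c *s x) = c *s f n x" using module_hom.scale[of scale scale "f n"] by (simp add: fld_def)
lemma fld_zero: "fld f \<Longrightarrow> f n 0 = 0" using module_hom.zero[of scale scale "f n"] by (simp add: fld_def)
lemma fld_bound: assumes "fld f" obtains n0 where "\<And>n. n0 \<le> n \<Longrightarrow> f n c = 0" using assms unfolding fld_def by blast

lemma bdd_fld: assumes "fld f" "fld g" shows "bdd (\<lambda>m n. f m (g n c))"
proof -
  obtain n0 where "\<And>n. n0 \<le> n \<Longrightarrow> g n c = 0" using assms(2) by (metis fld_bound)
  then show ?thesis by (intro bddI[of n0]) (simp add: fld_zero assms)
qed

lemma loc_mono: "loc K s f g \<Longrightarrow> K \<le> L \<Longrightarrow> loc L s f g"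
  unfolding loc_def by (intro allI ext, rule Delta_funpow_mono) auto

lemma Delta_pow_transpose: "(Delta ^^ K) (\<lambda>m n. F n m) m n = (- 1) ^ K *s (Delta ^^ K) F n m"
  by (induction K arbitrary: m n) (auto simp: Delta_def scale_right_diff_distrib)

lemma Delta_pow_scale: "(Delta ^^ K) (\<lambda>m n. s *s F m n) = (\<lambda>m n. s *s (Delta ^^ K) F m n)"
  by (rule Delta_funpow_map) (simp add: scale_right_diff_distrib)

lemma loc_sym:
  assumes "loc K s f g" "s * s = 1" shows "loc K s g f"
  unfolding loc_def
proof (intro allI ext)
  fix c m n
  have "supercomm s g f c = (\<lambda>m n. (- s) *s supercomm s f g c n m)"
    using assms(2) by (auto simp: fun_eq_iff supercomm_def scale_right_diff_distrib)
  then have "(Delta ^^ K) (supercomm s g f c) m n = (- s) *s (Delta ^^ K) (\<lambda>m n. supercomm s f g c n m) m n"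
    by (simp only: Delta_pow_scale)
  also have "\<dots> = 0"
    unfolding Delta_pow_transpose[of K "supercomm s f g c"] using assms(1) by (simp add: loc_def)
  finally show "(Delta ^^ K) (supercomm s g f c) m n = 0" .
qed

lemma powi_m1_add_1: "(- 1 :: 'k) powi (\<nu> + 1) = - ((- 1) powi \<nu>)"
  by (simp add: power_int_add)

lemma Delta_tcomm:
  assumes "fld f" "fld g" shows "Delta (tcomm \<nu> s f g c) = tcomm (\<nu> + 1) s f g c"
proof (intro ext)
  fix m n
  have 1: "Delta (imul \<nu> F) = imul (\<nu> + 1) F" if "bdd F" for F
    using imul_imul[OF that, of 1 \<nu>] by (simp add: imul_1 add.commute)
  have A: "imul (\<nu> + 1) (\<lambda>m n. f m (g n c)) m n = Delta (imul \<nu> (\<lambda>m n. f m (g n c))) m n"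
    by (simp add: 1 bdd_fld assms)
  have B: "imul (\<nu> + 1) (\<lambda>n m. g n (f m c)) n m = Delta (imul \<nu> (\<lambda>n m. g n (f m c))) n m"
    by (simp add: 1 bdd_fld assms)
  show "Delta (tcomm \<nu> s f g c) m n = tcomm (\<nu> + 1) s f g c m n"
    unfolding tcomm_def A B powi_m1_add_1 by (simp add: Delta_def tcomm_def algebra_simps)
qed

lemma Delta_pow_tcomm:
  assumes "fld f" "fld g" shows "(Delta ^^ j) (tcomm \<nu> s f g c) = tcomm (\<nu> + int j) s f g c"
  by (induction j) (auto simp: Delta_tcomm assms algebra_simps)

lemma tcomm_nat: "tcomm (int K) s f g c = (Delta ^^ K) (supercomm s f g c)"
proof (intro ext)
  fix m n
  have "(Delta ^^ K) (supercomm s f g c) m n = (Delta ^^ K) (\<lambda>m n. f m (g n c)) m n - s *s (Delta ^^ K) (\<lambda>m n. g n (f m c)) m n"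
    unfolding supercomm_def[abs_def] Delta_funpow_diff Delta_pow_scale ..
  then show "tcomm (int K) s f g c m n = (Delta ^^ K) (supercomm s f g c) m n"
    using Delta_pow_transpose[of K "\<lambda>n m. g n (f m c)" m n] by (simp add: tcomm_def imul_nat_Delta)
qed

lemma loc_tcomm_zero:
  assumes "loc K s f g" "int K \<le> \<nu>" shows "tcomm \<nu> s f g c m n = 0"
proof -
  have "\<nu> = int (nat \<nu>)" "K \<le> nat \<nu>" using assms(2) by auto
  then show ?thesis
    using loc_mono[OF assms(1), of "nat \<nu>"] tcomm_nat[of "nat \<nu>" s f g c] by (simp add: loc_def)
qed

lemma D12_imul:
  assumes "\<And>r. bdd (T r)"
  shows "(D12 ^^ j) (\<lambda>r m n. imul \<nu> (T r) m n) = (\<lambda>r m n. imul \<nu> ((D12 ^^ j) T r) m n) \<and> (\<forall>r. bdd ((D12 ^^ j) T r))"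
proof (induction j)
  case (Suc j)
  let ?T = "(D12 ^^ j) T"
  have bdd: "bdd (?T r)" for r using Suc by blast
  have zb': "bdd (\<lambda>m n. ?T r (m + 1) n)" for r using bdd_shift[OF bdd[of r], of 1 0] by simp
  have D: "D12 ?T r = (\<lambda>m n. ?T (r + 1) m n - ?T r (m + 1) n)" for r by (auto simp: D12_def fun_eq_iff)
  have "bdd (D12 ?T r)" for r unfolding D by (rule bdd_diff[OF bdd zb'])
  moreover have "D12 (\<lambda>r m n. imul \<nu> (?T r) m n) = (\<lambda>r m n. imul \<nu> (D12 ?T r) m n)"
    unfolding D imul_diff[OF bdd zb'] using imul_shift[of \<nu> _ 1 0] by (auto simp: fun_eq_iff D12_def)
  ultimately show ?case using Suc by simp
qed (simp add: assms)

lemma D13_imul: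
  assumes "\<And>r. bdd (T r)"
  shows "(D13 ^^ j) (\<lambda>r m n. imul \<nu> (T r) m n) = (\<lambda>r m n. imul \<nu> ((D13 ^^ j) T r) m n) \<and> (\<forall>r. bdd ((D13 ^^ j) T r))"
proof (induction j)
  case (Suc j)
  let ?T = "(D13 ^^ j) T"
  have bdd: "bdd (?T r)" for r using Suc by blast
  have zb': "bdd (\<lambda>m n. ?T r m (n + 1))" for r using bdd_shift[OF bdd[of r], of 0 1] by simp
  have D: "D13 ?T r = (\<lambda>m n. ?T (r + 1) m n - ?T r m (n + 1))" for r by (auto simp: D13_def fun_eq_iff)
  have "bdd (D13 ?T r)" for r unfolding D by (rule bdd_diff[OF bdd zb'])
  moreover have "D13 (\<lambda>r m n. imul \<nu> (?T r) m n) = (\<lambda>r m n. imul \<nu> (D13 ?T r) m n)"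
    unfolding D imul_diff[OF bdd zb'] using imul_shift[of \<nu> _ 0 1] by (auto simp: fun_eq_iff D13_def)
  ultimately show ?case using Suc by simp
qed (simp add: assms)

text \<open>
  Moving \<open>e(x)\<close> past \<open>f(w)\<close> costs a power of \<open>x - w\<close>, and moving it past \<open>g(z)\<close> a power of
  \<open>x - z\<close>.
\<close>

lemma triple_plain:
  assumes e: "fld e" and f: "fld f" and g: "fld g"
    and ef: "loc K s1 e f" and eg: "loc K s2 e g"
  shows "(D13 ^^ K) ((D12 ^^ K) (\<lambda>r m n. e r (f m (g n c)) - (s1 * s2) *s f m (g n (e r c)))) = (\<lambda>r m n. 0)"
proof -
  let ?X = "\<lambda>r m n. supercomm s1 e f (g n c) r m"
  let ?Y = "\<lambda>r m n. s1 *s f m (supercomm s2 e g c r n)"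
  have split: "(\<lambda>r m n. e r (f m (g n c)) - (s1 * s2) *s f m (g n (e r c))) = (\<lambda>r m n. ?X r m n + ?Y r m n)"
    by (simp add: supercomm_def fld_diff[OF f] fld_scale[OF f] algebra_simps fun_eq_iff)
  have X: "(D12 ^^ K) ?X = (\<lambda>r m n. 0)"
    using ef by (auto simp: fun_eq_iff D12_pow_eq loc_def)
  have "(D13 ^^ K) (\<lambda>r m n. supercomm s2 e g c r n) = (\<lambda>r m n. 0)"
    using eg by (auto simp: fun_eq_iff D13_pow_eq loc_def)
  then have Y: "(D13 ^^ K) ?Y r m n = 0" for r m n
    unfolding D13_pow_eq
    by (subst Delta_funpow_map[where L = "\<lambda>x. s1 *s f m x"])
      (use eg in \<open>auto simp: fld_diff[OF f] scale_right_diff_distrib loc_def fld_zero[OF f] fun_eq_iff\<close>)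
  then have Y: "(D13 ^^ K) ?Y = (\<lambda>r m n. 0)" by (auto simp: fun_eq_iff)
  show ?thesis
    unfolding split D12_pow_add D13_pow_add X D12_pow_D13_pow[symmetric] Y by simp
qed

text \<open>
  Multiplication by \<open>(w - z)^\<nu>\<close>, in either expansion, commutes with the powers of \<open>x - w\<close> and
  \<open>x - z\<close>, so the previous lemma may be applied under it to both terms of the commutator.
\<close>

lemma triple:
  assumes e: "fld e" and f: "fld f" and g: "fld g"
    and ef: "loc K s1 e f" and eg: "loc K s2 e g"
  shows "(D13 ^^ K) ((D12 ^^ K) (\<lambda>r m n. e r (tcomm \<nu> s f g c m n) - (s1 * s2) *s tcomm \<nu> s f g (e r c) m n)) = (\<lambda>r m n. 0)"
proof -
  define T where "T r m n = e r (f m (g n c)) - (s1 * s2) *s f m (g n (e r c))" for r m n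
  define T' where "T' r n m = e r (g n (f m c)) - (s1 * s2) *s g n (f m (e r c))" for r m n
  define t where "t = s * (- 1) powi \<nu>"
  have scz: "c *s (0::'v) = 0" for c by simp
  have T_parts: "bdd (\<lambda>m n. e r (f m (g n c)))" "bdd (\<lambda>m n. (s1 * s2) *s f m (g n (e r c)))"
      "bdd (\<lambda>n m. e r (g n (f m c)))" "bdd (\<lambda>n m. (s1 * s2) *s g n (f m (e r c)))" for r
    by (rule bdd_map[where L = "e r", OF bdd_fld[OF f g] fld_zero[OF e]]
        bdd_map[where L = "e r", OF bdd_fld[OF g f] fld_zero[OF e]]
        bdd_map[where L = "scale (s1 * s2)", OF bdd_fld[OF f g]]
        bdd_map[where L = "scale (s1 * s2)", OF bdd_fld[OF g f]]; simp)+
  have T_bdd: "bdd (T r)" "bdd (T' r)" for r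
    unfolding T_def[abs_def] T'_def[abs_def] by (rule bdd_diff[OF T_parts(1,2)] bdd_diff[OF T_parts(3,4)])+
  have miT: "imul \<nu> (T r) m n = e r (imul \<nu> (\<lambda>m n. f m (g n c)) m n) - (s1 * s2) *s imul \<nu> (\<lambda>m n. f m (g n (e r c))) m n" for r m n
    unfolding T_def[abs_def] imul_diff[OF T_parts(1,2)] imul_scale imul_map[OF fld_lin[OF e] bdd_fld[OF f g]] ..
  have miT': "imul \<nu> (T' r) n m = e r (imul \<nu> (\<lambda>n m. g n (f m c)) n m) - (s1 * s2) *s imul \<nu> (\<lambda>n m. g n (f m (e r c))) n m" for r m n
    unfolding T'_def[abs_def] imul_diff[OF T_parts(3,4)] imul_scale imul_map[OF fld_lin[OF e] bdd_fld[OF g f]] ..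
  have U: "(\<lambda>r m n. e r (tcomm \<nu> s f g c m n) - (s1 * s2) *s tcomm \<nu> s f g (e r c) m n)
      = (\<lambda>r m n. imul \<nu> (T r) m n - t *s flip23 (\<lambda>r n m. imul \<nu> (T' r) n m) r m n)"
    by (simp add: fun_eq_iff tcomm_def miT miT' flip23_def t_def fld_diff[OF e] fld_scale[OF e] algebra_simps)
  have zT: "(D13 ^^ K) ((D12 ^^ K) T) = (\<lambda>r m n. 0)"
    unfolding T_def[abs_def] by (rule triple_plain[OF e f g ef eg])
  have zT': "(D13 ^^ K) ((D12 ^^ K) T') = (\<lambda>r m n. 0)"
    using triple_plain[OF e g f eg ef, of c] unfolding T'_def[abs_def] by (simp only: mult.commute[of s2 s1])
  have 1: "(D13 ^^ K) ((D12 ^^ K) (\<lambda>r m n. imul \<nu> (T r) m n)) = (\<lambda>r m n. 0)"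
    using D12_imul[of T K \<nu>, OF T_bdd(1)] D13_imul[of "(D12 ^^ K) T" K \<nu>] by (simp add: zT)
  have 2: "(D13 ^^ K) ((D12 ^^ K) (\<lambda>r m n. imul \<nu> (T' r) m n)) = (\<lambda>r m n. 0)"
    using D12_imul[of T' K \<nu>, OF T_bdd(2)] D13_imul[of "(D12 ^^ K) T'" K \<nu>] by (simp add: zT')
  have 3: "(D13 ^^ K) ((D12 ^^ K) (flip23 (\<lambda>r n m. imul \<nu> (T' r) n m))) = (\<lambda>r m n. 0)"
    unfolding D12_pow_flip23 D13_pow_flip23 D12_pow_D13_pow 2 by (simp add: flip23_def fun_eq_iff)
  show ?thesis
    unfolding U D12_pow_diff D13_pow_diff 1
    by (simp add: D12_pow_map[where L = "scale t"] D13_pow_map[where L = "scale t"] scale_right_diff_distrib 3)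
qed

text \<open>
  Locality of order \<open>\<nu>\<close> only has to be checked on the vacuum: it is transported to \<open>e(x) v\<close> by
  any field \<open>e\<close> that is local to \<open>f\<close> and \<open>g\<close>. Indeed \<open>e(x) v\<close> has no negative powers of \<open>x\<close>,
  so \<open>x - w\<close> and \<open>x - z\<close> can be cancelled.
\<close>

lemma tcomm_zero_from_vac:
  assumes e: "fld e" and f: "fld f" and g: "fld g"
    and ef: "loc K s1 e f" and eg: "loc L s2 e g" and "s1 * s2 \<noteq> 0"
    and vac: "\<And>m n. tcomm \<nu> s f g v m n = 0" and reg: "\<And>n. 0 \<le> n \<Longrightarrow> e n v = 0"
  shows "tcomm \<nu> s f g (e r v) m n = 0"
proof -
  let ?M = "max K L"
  have "loc ?M s1 e f" "loc ?M s2 e g" using ef eg by (auto intro: loc_mono)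
  note t = triple[OF e f g this, of \<nu> s v]
  have Gp0: "tcomm \<nu> s f g 0 m n = 0" for m n
    by (simp add: tcomm_def fld_zero f g)
  have "(\<lambda>r m n. e r (tcomm \<nu> s f g v m n) - (s1 * s2) *s tcomm \<nu> s f g (e r v) m n) = (\<lambda>r m n. 0)"
    by (rule D13_D12_pow_inj[OF _ t, of 0]) (simp add: vac fld_zero[OF e] reg Gp0)
  from fun_cong[OF fun_cong[OF fun_cong[OF this, of r], of m], of n]
  show ?thesis using \<open>s1 * s2 \<noteq> 0\<close> by (simp add: vac fld_zero[OF e])
qed

text \<open>
  Dong's lemma. The commutator \<open>U \<nu>\<close> of \<open>e(x)\<close> with \<open>tcomm \<nu>\<close> is annihilated by powers of
  \<open>(x - w) (x - z)\<close>, and \<open>x - w = (x - z) - (w - z)\<close> where \<open>w - z\<close> turns \<open>U \<nu>\<close> into \<open>U (\<nu> + 1)\<close>.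
  Since \<open>U \<nu> = 0\<close> for large \<open>\<nu>\<close>, downward induction on \<open>\<nu>\<close> trades the factors \<open>x - w\<close> for
  factors \<open>x - z\<close>; the residue in \<open>w\<close> may then be taken.
\<close>

lemma Dong:
  assumes e: "fld e" and f: "fld f" and g: "fld g"
    and ef: "loc K s1 e f" and eg: "loc L s2 e g" and fg: "loc M s f g"
  shows "\<exists>J. loc J (s1 * s2) e (\<lambda>q c. tcomm \<nu> s f g c 0 q)"
proof -
  let ?K = "max K L"
  have l: "loc ?K s1 e f" "loc ?K s2 e g" using ef eg by (auto intro: loc_mono)
  define U where "U \<nu> c = (\<lambda>r m n. e r (tcomm \<nu> s f g c m n) - (s1 * s2) *s tcomm \<nu> s f g (e r c) m n)" for \<nu> c
  have t: "(D13 ^^ ?K) ((D12 ^^ ?K) (U \<nu> c)) = (\<lambda>r m n. 0)" for \<nu> c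
    unfolding U_def by (rule triple[OF e f g l])
  have U_Suc: "D12 (U \<nu> c) = (\<lambda>r m n. D13 (U \<nu> c) r m n - U (\<nu> + 1) c r m n)" for \<nu> c
    unfolding U_def Delta_tcomm[OF f g, symmetric]
    by (simp add: D12_def D13_def Delta_def fld_diff[OF e] algebra_simps fun_eq_iff)
  have U_zero: "U \<nu> c = (\<lambda>r m n. 0)" if "int M \<le> \<nu>" for \<nu> c
    unfolding U_def by (simp add: loc_tcomm_zero[OF fg that] fld_zero[OF e])
  have "\<exists>J. \<forall>c. (D13 ^^ J) (U (int M - int i) c) = (\<lambda>r m n. 0)" for i
  proof (induction i)
    case 0
    show ?case by (intro exI[of _ 0]) (simp add: U_zero)
  next
    case (Suc i)
    let ?\<nu> = "int M - int (Suc i)"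
    obtain J where J: "\<And>c. (D13 ^^ J) (U (?\<nu> + 1) c) = (\<lambda>r m n. 0)"
      using Suc by auto
    define J' where "J' = max J ?K"
    have J': "(D13 ^^ (J' + j)) (U (?\<nu> + 1) c) = (\<lambda>r m n. 0)" for c j
    proof -
      have "(D13 ^^ (J' + j)) (U (?\<nu> + 1) c) = (D13 ^^ (J' + j - J)) ((D13 ^^ J) (U (?\<nu> + 1) c))"
        by (rule funpow_le) (simp add: J'_def)
      then show ?thesis by (simp only: J D13_pow_zero)
    qed
    have "(D13 ^^ (J' + j)) ((D12 ^^ (?K - j)) (U ?\<nu> c)) = (\<lambda>r m n. 0)" if "j \<le> ?K" for j c
      using that
    proof (induction j)
      case 0
      have "(D13 ^^ J') ((D12 ^^ ?K) (U ?\<nu> c)) = (D13 ^^ (J' - ?K)) ((D13 ^^ ?K) ((D12 ^^ ?K) (U ?\<nu> c)))"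
        by (rule funpow_le) (simp add: J'_def)
      then show ?case by (simp add: t)
    next
      case (Suc j)
      let ?i = "?K - Suc j"
      have "(D12 ^^ (?K - j)) (U ?\<nu> c) = (D12 ^^ ?i) (D12 (U ?\<nu> c))"
        using Suc.prems by (simp add: Suc_diff_Suc[symmetric] funpow_Suc_right del: funpow.simps)
      also have "\<dots> = (\<lambda>r m n. (D12 ^^ ?i) (D13 (U ?\<nu> c)) r m n - (D12 ^^ ?i) (U (?\<nu> + 1) c) r m n)"
        unfolding U_Suc D12_pow_diff ..
      finally have "(\<lambda>r m n. 0) = (\<lambda>r m n. (D13 ^^ (J' + j)) ((D12 ^^ ?i) (D13 (U ?\<nu> c))) r m n
          - (D13 ^^ (J' + j)) ((D12 ^^ ?i) (U (?\<nu> + 1) c)) r m n)"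
        using Suc by (simp add: D13_pow_diff)
      also have "(D13 ^^ (J' + j)) ((D12 ^^ ?i) (U (?\<nu> + 1) c)) = (\<lambda>r m n. 0)"
        by (simp only: D12_pow_D13_pow[symmetric] J' D12_pow_zero)
      also have "(D13 ^^ (J' + j)) ((D12 ^^ ?i) (D13 (U ?\<nu> c))) = (D13 ^^ (J' + Suc j)) ((D12 ^^ ?i) (U ?\<nu> c))"
        by (simp add: D12_pow_D13 funpow_swap1)
      finally show ?case by simp
    qed
    from this[of ?K] show ?case by (intro exI[of _ "J' + ?K"]) simp
  qed
  moreover have "min (int M) \<nu> = int M - int (nat (int M - \<nu>))" by simp
  ultimately have "\<exists>J. \<forall>c. (D13 ^^ J) (U (min (int M) \<nu>) c) = (\<lambda>r m n. 0)"
    by (simp only:)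
  then obtain J where J: "\<And>c. (D13 ^^ J) (U (min (int M) \<nu>) c) = (\<lambda>r m n. 0)"
    by blast
  have "(D13 ^^ J) (U \<nu> c) = (\<lambda>r m n. 0)" for c
    using J[of c] U_zero[of \<nu> c] by (cases "int M \<le> \<nu>") (auto simp: min_def)
  then have "loc J (s1 * s2) e (\<lambda>q c. tcomm \<nu> s f g c 0 q)"
    unfolding loc_def supercomm_def[abs_def]
    by (auto simp: fun_eq_iff U_def D13_pow_eq)
  then show ?thesis ..
qed

end

section \<open>Reconstruction of a vertex algebra from generating fields\<close>

definition koszul :: "bit \<Rightarrow> bit \<Rightarrow> 'k::comm_ring_1" where
  "koszul i j = (if i = 1 \<and> j = 1 then - 1 else 1)"

lemma koszul_0 [simp]: "koszul i 0 = 1" "koszul 0 i = 1" by (auto simp: koszul_def)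
lemma koszul_sym: "koszul i j = koszul j i" by (auto simp: koszul_def)
lemma koszul_sq [simp]: "koszul i j * koszul i j = 1" by (auto simp: koszul_def)
lemma koszul_add: "koszul i (j + k) = koszul i j * koszul i k"
  by (cases i; cases j; cases k) (auto simp: koszul_def)

inductive words :: "'v \<Rightarrow> ('b \<Rightarrow> int \<Rightarrow> 'v \<Rightarrow> 'v) \<Rightarrow> ('b \<Rightarrow> bit) \<Rightarrow> bit \<Rightarrow> 'v \<Rightarrow> bool"
  for v a par where
  words_vac: "words v a par 0 v"
| words_app: "words v a par i w \<Longrightarrow> words v a par (par b + i) (a b n w)"

context char0_space begin

lemma imul_mem:
  assumes "subspace S" "bdd F" "\<And>m n. F m n \<in> S" shows "imul \<nu> F m n \<in> S"
proof -
  obtain n0 where n0: "\<And>m n. n0 \<le> n \<Longrightarrow> F m n = 0" using assms(2) by (metis bdd_pw)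
  have K: "n0 \<le> n + int (nat (n0 - n))" by simp
  have "imul \<nu> F m n = (\<Sum>k<nat (n0 - n). sbinom \<nu> k *s F (m + \<nu> - int k) (n + int k))"
    by (rule imul_sum) (use K in \<open>auto simp: n0\<close>)
  also have "\<dots> \<in> S" by (intro subspace_sum subspace_scale assms)
  finally show ?thesis .
qed

lemma tcomm_mem:
  assumes "subspace S" "fld f" "fld g" "\<And>m n. f m (g n c) \<in> S" "\<And>m n. g n (f m c) \<in> S"
  shows "tcomm \<nu> s f g c m n \<in> S"
  unfolding tcomm_def using assms by (intro subspace_diff subspace_scale imul_mem bdd_fld) auto

lemma linI: "(\<And>x y. L (x + y) = L x + L y) \<Longrightarrow> (\<And>c x. L (c *s x) = c *s L x) \<Longrightarrow> lin L"
  by (intro module_hom.intro module_hom_axioms.intro) unfold_locales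

lemma lin_tcomm: assumes f: "fld f" and g: "fld g" shows "lin (\<lambda>c. tcomm \<nu> s f g c m n)"
proof (rule linI)
  fix x y
  show "tcomm \<nu> s f g (x + y) m n = tcomm \<nu> s f g x m n + tcomm \<nu> s f g y m n"
    by (simp add: tcomm_def fld_add f g imul_add bdd_fld algebra_simps)
next
  fix c x
  show "tcomm \<nu> s f g (c *s x) m n = c *s tcomm \<nu> s f g x m n"
    by (simp add: tcomm_def fld_scale f g imul_scale algebra_simps)
qed

lemma fld_tcomm: assumes f: "fld f" and g: "fld g" shows "fld (\<lambda>q c. tcomm \<nu> s f g c p q)"
  unfolding fld_def
proof (intro conjI allI lin_tcomm f g)
  fix c
  obtain a where a: "\<And>n. a \<le> n \<Longrightarrow> f n c = 0" using fld_bound[OF f] by blast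
  obtain b where b: "\<And>n. b \<le> n \<Longrightarrow> g n c = 0" using fld_bound[OF g] by blast
  define K where "K = nat (a - p)"
  have K: "a \<le> p + int K" by (simp add: K_def)
  have A: "imul \<nu> (\<lambda>m n. f m (g n c)) p q = 0" if "b \<le> q" for q
    using imul_sum[of q 0 "\<lambda>m n. f m (g n c)"] that by (simp add: b fld_zero f)
  have "\<forall>k. \<exists>e. \<forall>q\<ge>e. g q (f (p + int k) c) = 0"
    using fld_bound[OF g] by metis
  then obtain e where e: "\<And>k q. e k \<le> q \<Longrightarrow> g q (f (p + int k) c) = 0" by metis
  define E where "E = Max (insert 0 (e ` {..<K}))"
  have E: "e k \<le> E" if "k < K" for k using that by (auto simp: E_def)
  have B: "imul \<nu> (\<lambda>n m. g n (f m c)) q p = 0" if "E - \<nu> + int K \<le> q" for q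
  proof -
    have "imul \<nu> (\<lambda>n m. g n (f m c)) q p = (\<Sum>k<K. sbinom \<nu> k *s g (q + \<nu> - int k) (f (p + int k) c))"
      by (rule imul_sum) (use K in \<open>simp add: a fld_zero g\<close>)
    also have "\<dots> = 0"
    proof (rule sum.neutral, rule ballI)
      fix k assume k: "k \<in> {..<K}"
      then have "e k \<le> q + \<nu> - int k" using E[of k] that by simp
      then show "sbinom \<nu> k *s g (q + \<nu> - int k) (f (p + int k) c) = 0" by (simp add: e)
    qed
    finally show ?thesis .
  qed
  show "\<exists>n0. \<forall>n\<ge>n0. tcomm \<nu> s f g c p n = 0"
    by (intro exI[of _ "max b (E - \<nu> + int K)"]) (simp add: tcomm_def A B)
qed

text \<open>
  Translation covariance, \<open>[T, f(z)] = f'(z)\<close>, read off at the modes.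
\<close>

definition covariant :: "('v \<Rightarrow> 'v) \<Rightarrow> (int \<Rightarrow> 'v \<Rightarrow> 'v) \<Rightarrow> bool" where
  "covariant T f \<longleftrightarrow> (\<forall>n c. T (f n c) = f n (T c) - of_int n *s f (n - 1) c)"

lemma bdd_mderiv: "bdd F \<Longrightarrow> bdd (mderiv F)"
proof -
  assume "bdd F"
  then obtain n0 where n0: "\<And>m n. n0 \<le> n \<Longrightarrow> F m n = 0" by (metis bdd_pw)
  then show ?thesis by (intro bddI[of "n0 + 1"]) (simp add: mderiv_def)
qed

lemma covariant_imul:
  assumes T: "lin T" and f: "fld f" "covariant T f" and g: "fld g" "covariant T g"
  shows "T (imul \<nu> (\<lambda>m n. f m (g n c)) m n)
    = imul \<nu> (\<lambda>m n. f m (g n (T c))) m n + mderiv (imul \<nu> (\<lambda>m n. f m (g n c))) m n"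
proof -
  interpret T: module_hom scale scale T by fact
  let ?F = "\<lambda>m n. f m (g n c)"
  have "T (imul \<nu> ?F m n) = imul \<nu> (\<lambda>m n. T (?F m n)) m n"
    by (rule imul_map[symmetric]) (simp_all add: T bdd_fld f g)
  also have "(\<lambda>m n. T (?F m n)) = (\<lambda>m n. f m (g n (T c)) + mderiv ?F m n)"
    using f(2) g(2) by (auto simp: covariant_def fun_eq_iff mderiv_def fld_diff f(1) g(1) fld_scale)
  also have "imul \<nu> \<dots> m n = imul \<nu> (\<lambda>m n. f m (g n (T c))) m n + mderiv (imul \<nu> ?F) m n"
    by (subst imul_add) (simp_all add: bdd_fld f g bdd_mderiv imul_mderiv)
  finally show ?thesis .
qed

lemma covariant_tcomm:
  assumes T: "lin T" and f: "fld f" "covariant T f" and g: "fld g" "covariant T g"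
  shows "T (tcomm \<nu> s f g c m n) = tcomm \<nu> s f g (T c) m n + mderiv (tcomm \<nu> s f g c) m n"
proof -
  interpret T: module_hom scale scale T by fact
  show ?thesis
    unfolding tcomm_def T.diff T.scale covariant_imul[OF T f g] covariant_imul[OF T g f]
    by (simp add: mderiv_def algebra_simps)
qed

lemma Delta_pow_deriv:
  assumes "(Delta ^^ K) F = (\<lambda>m n. 0)"
  shows "(Delta ^^ Suc K) (\<lambda>m n. of_int m *s F (m - 1) n) = (\<lambda>m n. 0)"
  using assms
proof (induction K arbitrary: F)
  case 0
  then show ?case by (auto simp: fun_eq_iff Delta_def)
next
  case (Suc K)
  have 1: "Delta (\<lambda>m n. of_int m *s F (m - 1) n) = (\<lambda>m n. of_int m *s Delta F (m - 1) n + F m n)"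
    by (auto simp: fun_eq_iff Delta_def algebra_simps)
  have "(Delta ^^ Suc K) (\<lambda>m n. of_int m *s Delta F (m - 1) n) = (\<lambda>m n. 0)"
    by (rule Suc.IH) (use Suc.prems in \<open>simp add: funpow_swap1\<close>)
  then show ?case
    unfolding funpow_Suc_right[of "Suc K"] o_apply 1 Delta_funpow_add Suc.prems by simp
qed

lemma loc_deriv:
  assumes "loc K s f g" "fld g"
  shows "loc (Suc K) s (\<lambda>n c. - (of_int n *s f (n - 1) c)) g"
  unfolding loc_def
proof
  fix c
  have "supercomm s (\<lambda>n c. - (of_int n *s f (n - 1) c)) g c = (\<lambda>m n. (- 1) *s of_int m *s supercomm s f g c (m - 1) n)"
    by (auto simp: fun_eq_iff supercomm_def fld_scale[OF assms(2), of _ "-1", simplified] fld_scale[OF assms(2)] algebra_simps)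
  then show "(Delta ^^ Suc K) (supercomm s (\<lambda>n c. - (of_int n *s f (n - 1) c)) g c) = (\<lambda>m n. 0)"
    using Delta_pow_deriv[of K "supercomm s f g c"] assms(1) by (simp only: Delta_pow_scale loc_def) simp
qed

lemma loc_add:
  assumes "loc K s f g" "loc L s f' g" "fld g"
  shows "loc (max K L) s (\<lambda>n c. f n c + f' n c) g"
proof -
  have "loc (max K L) s f g" "loc (max K L) s f' g" using assms(1,2) by (auto intro: loc_mono)
  moreover have "supercomm s (\<lambda>n c. f n c + f' n c) g c = (\<lambda>m n. supercomm s f g c m n + supercomm s f' g c m n)" for c
    by (auto simp: fun_eq_iff supercomm_def fld_add[OF assms(3)] algebra_simps)
  ultimately show ?thesis by (simp add: loc_def Delta_funpow_add)
qed

lemma loc_scale: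
  assumes "loc K s f g" "fld g"
  shows "loc K s (\<lambda>n c. r *s f n c) g"
proof -
  have "supercomm s (\<lambda>n c. r *s f n c) g c = (\<lambda>m n. r *s supercomm s f g c m n)" for c
    by (auto simp: fun_eq_iff supercomm_def fld_scale[OF assms(2)] algebra_simps)
  then show ?thesis using assms(1) by (simp add: loc_def Delta_pow_scale)
qed

lemma fld_plus: assumes "fld f" "fld g" shows "fld (\<lambda>n c. f n c + g n c)"
  unfolding fld_def
proof (intro conjI allI)
  show "lin (\<lambda>c. f n c + g n c)" for n
    by (rule linI) (simp_all add: fld_add fld_scale assms algebra_simps)
  fix c
  obtain a where a: "\<And>n. a \<le> n \<Longrightarrow> f n c = 0" using fld_bound[OF assms(1)] by blast
  obtain b where b: "\<And>n. b \<le> n \<Longrightarrow> g n c = 0" using fld_bound[OF assms(2)] by blast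
  show "\<exists>n0. \<forall>n\<ge>n0. f n c + g n c = 0"
    by (intro exI[of _ "max a b"]) (simp add: a b)
qed

lemma fld_scaled: assumes "fld f" shows "fld (\<lambda>n c. r *s f n c)"
  unfolding fld_def
proof (intro conjI allI)
  show "lin (\<lambda>c. r *s f n c)" for n
    by (rule linI) (simp_all add: fld_add fld_scale assms algebra_simps)
  fix c
  obtain a where a: "\<And>n. a \<le> n \<Longrightarrow> f n c = 0" using fld_bound[OF assms(1)] by blast
  show "\<exists>n0. \<forall>n\<ge>n0. r *s f n c = 0"
    by (intro exI[of _ a]) (simp add: a)
qed

lemma fld_deriv: assumes "fld f" shows "fld (\<lambda>n c. - (of_int n *s f (n - 1) c))"
  unfolding fld_def
proof (intro conjI allI)
  show "lin (\<lambda>c. - (of_int n *s f (n - 1) c))" for n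
    by (rule linI) (simp_all add: fld_add fld_scale assms algebra_simps)
  fix c
  obtain a where a: "\<And>n. a \<le> n \<Longrightarrow> f n c = 0" using fld_bound[OF assms(1)] by blast
  show "\<exists>n0. \<forall>n\<ge>n0. - (of_int n *s f (n - 1) c) = 0"
    by (intro exI[of _ "a + 1"]) (simp add: a)
qed

lemma fld_0: "fld (\<lambda>n c. 0)"
  unfolding fld_def by (auto intro: linI)

lemma Sum_any_imul: "Sum_any (\<lambda>k. ((- 1) ^ k * (of_int \<nu> gchoose k)) *s F (m + \<nu> - int k) (n + int k)) = imul \<nu> F m n"
  by (simp add: imul_def sbinom_def)

lemma Sum_any_mi': "Sum_any (\<lambda>k. ((- 1) powi (\<nu> - int k) * (of_int \<nu> gchoose k)) *s F (m + \<nu> - int k) (n + int k))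
   = (- 1) powi \<nu> *s imul \<nu> F m n"
proof -
  have "(- 1) powi (\<nu> - int k) = (- 1) powi \<nu> * ((- 1) ^ k :: 'k)" for k
  proof -
    have "(- 1) powi \<nu> = (- 1) powi (\<nu> - int k) * ((- 1) ^ k :: 'k)"
      using power_int_add[of "- 1 :: 'k" "\<nu> - int k" "int k"] by simp
    then have "(- 1) powi \<nu> * (- 1) ^ k = (- 1) powi (\<nu> - int k) * ((- 1) ^ k * (- 1) ^ k :: 'k)"
      by (simp only: mult.assoc)
    then show ?thesis by (simp flip: power_mult_distrib)
  qed
  then show ?thesis
    unfolding imul_scale[symmetric] by (simp add: imul_def sbinom_def mult.assoc mult.left_commute mult.commute)
qed

end

text \<open>
  The data of the reconstruction theorem: a superspace with a vacuum, a translation operator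
  and a family of mutually local fields that generate it.
\<close>

locale vacuum_fields = char0_space scale
  for scale :: "'k::field_char_0 \<Rightarrow> 'v::ab_group_add \<Rightarrow> 'v" (infixr "*s" 75) +
  fixes P :: "bit \<Rightarrow> 'v set" and v :: 'v and T :: "'v \<Rightarrow> 'v"
    and a :: "'b \<Rightarrow> int \<Rightarrow> 'v \<Rightarrow> 'v" and par :: "'b \<Rightarrow> bit"
  assumes sub_P: "subspace (P i)"
    and P_sum: "\<exists>y z. x = y + z \<and> y \<in> P 0 \<and> z \<in> P 1"
    and P_disj: "P 0 \<inter> P 1 = {0}"
    and v_P: "v \<in> P 0"
    and lin_T: "lin T" and T_v: "T v = 0"
    and a_fld: "fld (a b)"
    and a_vac: "0 \<le> n \<Longrightarrow> a b n v = 0"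
    and a_covariant: "covariant T (a b)"
    and a_P: "c \<in> P i \<Longrightarrow> a b n c \<in> P (par b + i)"
    and a_loc: "\<exists>K. loc K (koszul (par b) (par b')) (a b) (a b')"
    and words_P: "x \<in> P i \<Longrightarrow> x \<in> span {w. words v a par i w}"
begin

text \<open>
  The fields that can occur as \<open>Y(x)\<close> for an \<open>x\<close> of parity \<open>i\<close>. Locality is required only with
  respect to the generating fields, which is enough for uniqueness.
\<close>

definition good :: "bit \<Rightarrow> (int \<Rightarrow> 'v \<Rightarrow> 'v) \<Rightarrow> bool" where
  "good i f \<longleftrightarrow> fld f \<and> covariant T f \<and> (\<forall>n\<ge>0. f n v = 0) \<and> (\<forall>n j c. c \<in> P j \<longrightarrow> f n c \<in> P (i + j)) \<and>
     (\<forall>b. \<exists>K. loc K (koszul i (par b)) f (a b))"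

lemma good_fld: "good i f \<Longrightarrow> fld f" by (simp add: good_def)

lemma good_a: "good (par b) (a b)"
  by (simp add: good_def a_fld a_covariant a_vac a_P a_loc del: add_bit_eq_xor)

lemma good_plus: assumes "good i f" "good i g" shows "good i (\<lambda>n c. f n c + g n c)"
  unfolding good_def
proof (intro conjI allI impI)
  show "fld (\<lambda>n c. f n c + g n c)" using assms by (simp add: good_fld fld_plus)
  show "covariant T (\<lambda>n c. f n c + g n c)"
    using assms module_hom.add[OF lin_T] by (auto simp: good_def covariant_def algebra_simps)
  show "\<exists>K. loc K (koszul i (par b)) (\<lambda>n c. f n c + g n c) (a b)" for b
    using assms loc_add a_fld unfolding good_def by metis
qed (use assms in \<open>auto simp: good_def intro: subspace_add[OF sub_P] simp del: add_bit_eq_xor\<close>)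

lemma good_scale: assumes "good i f" shows "good i (\<lambda>n c. r *s f n c)"
  unfolding good_def
proof (intro conjI allI impI)
  show "fld (\<lambda>n c. r *s f n c)" using assms by (simp add: good_fld fld_scaled)
  show "covariant T (\<lambda>n c. r *s f n c)"
    using assms by (auto simp: good_def covariant_def module_hom.scale[OF lin_T] scale_right_diff_distrib mult.commute)
  show "\<exists>K. loc K (koszul i (par b)) (\<lambda>n c. r *s f n c) (a b)" for b
    using assms loc_scale[OF _ a_fld] unfolding good_def by blast
qed (use assms in \<open>auto simp: good_def intro: subspace_scale[OF sub_P] simp del: add_bit_eq_xor\<close>)

lemma good_deriv: assumes "good i f" shows "good i (\<lambda>n c. - (of_int n *s f (n - 1) c))"
  unfolding good_def
proof (intro conjI allI impI)
  show "fld (\<lambda>n c. - (of_int n *s f (n - 1) c))" using assms by (simp add: good_fld fld_deriv)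
  show "covariant T (\<lambda>n c. - (of_int n *s f (n - 1) c))"
    unfolding covariant_def
  proof (intro allI)
    fix n c
    have "T (f (n - 1) c) = f (n - 1) (T c) - of_int (n - 1) *s f (n - 1 - 1) c"
      using assms unfolding good_def covariant_def by blast
    then have "of_int n *s T (f (n - 1) c) = of_int n *s f (n - 1) (T c) - of_int n *s of_int (n - 1) *s f (n - 1 - 1) c"
      by (simp only: scale_right_diff_distrib)
    then show "T (- (of_int n *s f (n - 1) c)) = - (of_int n *s f (n - 1) (T c)) -
        of_int n *s - (of_int (n - 1) *s f (n - 1 - 1) c)"
      by (simp only: module_hom.scale[OF lin_T] module_hom.neg[OF lin_T] scale_minus_right minus_diff_eq
          diff_minus_eq_add uminus_add_conv_diff)
  qed
  show "\<exists>K. loc K (koszul i (par b)) (\<lambda>n c. - (of_int n *s f (n - 1) c)) (a b)" for b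
    using assms loc_deriv[OF _ a_fld] unfolding good_def by blast
  show "- (of_int n *s f (n - 1) v) = 0" if "0 \<le> n" for n
    using assms that by (cases "n = 0") (auto simp: good_def)
qed (use assms in \<open>auto simp: good_def intro!: subspace_scale[OF sub_P] subspace_neg[OF sub_P] simp del: add_bit_eq_xor\<close>)

text \<open>
  Goddard's uniqueness argument. By covariance \<open>f(z)\<close> annihilates the vacuum as soon as its
  constant term does. If it annihilates \<open>w\<close>, then \<open>(x - z)^K f(x) a(z) w = 0\<close> by locality, and
  \<open>x - z\<close> can be cancelled because \<open>a(z) w\<close> has finitely many negative powers of \<open>z\<close>.
\<close>

lemma good_zero:
  assumes f: "good i f" and 0: "f (- 1) v = 0"
  shows "f n c = 0"
proof -
  have nn: "f n v = 0" if "0 \<le> n" for n using f that by (auto simp: good_def)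
  have "f (- 1 - int k) v = 0" for k
  proof (induction k)
    case (Suc k)
    have "T (f (- 1 - int k) v) = f (- 1 - int k) (T v) - of_int (- 1 - int k) *s f (- 1 - int k - 1) v"
      using f unfolding good_def covariant_def by blast
    then have "of_int (- 1 - int k) *s f (- 1 - int k - 1) v = 0"
      by (simp add: Suc T_v fld_zero[OF good_fld[OF f]] module_hom.zero[OF lin_T])
    moreover have "of_int (- 1 - int k) \<noteq> (0::'k)" unfolding of_int_eq_0_iff by simp
    ultimately have "f (- 1 - int k - 1) v = 0" by (simp only: scale_eq_0_iff) simp
    moreover have "- 1 - int k - 1 = - 1 - int (Suc k)" by simp
    ultimately show ?case by (simp only:)
  qed (simp add: 0)
  note neg = this
  have "f n v = 0" if "n < 0" for n
  proof -
    have "- 1 - int (nat (- 1 - n)) = n" using that by simp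
    then show ?thesis using neg[of "nat (- 1 - n)"] by (simp only:)
  qed
  with nn have v: "f n v = 0" for n
    by (cases "0 \<le> n") auto
  have w: "\<forall>n. f n w = 0" if "words v a par j w" for w j
    using that
  proof induction
    case (words_app j w b m)
    obtain K where "loc K (koszul i (par b)) f (a b)" using f unfolding good_def by blast
    moreover have "supercomm (koszul i (par b)) f (a b) w = (\<lambda>k m. f k (a b m w))"
      using words_app by (auto simp: supercomm_def fun_eq_iff fld_zero[OF a_fld])
    ultimately have "(Delta ^^ K) (\<lambda>k m. f k (a b m w)) = (\<lambda>m n. 0)"
      unfolding loc_def by metis
    then have "(Delta ^^ K) (\<lambda>k m. f k (a b m w)) k m = 0" for k m by metis
    then show ?case
      by (intro allI Delta_funpow_inj[OF bdd_fld[OF good_fld[OF f] a_fld], of K])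
  qed (simp add: v)
  interpret L: module_hom scale scale "f n" using good_fld[OF f] by (rule fld_lin)
  have P: "f n x = 0" if "x \<in> P j" for x j
  proof -
    have "span {w. words v a par j w} \<subseteq> {x. f n x = 0}"
      by (rule span_minimal) (use w in \<open>auto simp: L.subspace_kernel\<close>)
    then show ?thesis using words_P[OF that] by auto
  qed
  obtain y z where "c = y + z" "y \<in> P 0" "z \<in> P 1" using P_sum by blast
  then show ?thesis by (simp add: L.add P)
qed

lemma good_unique:
  assumes "good i f" "good i g" "f (- 1) v = g (- 1) v"
  shows "f = g"
proof -
  have "good i (\<lambda>n c. f n c + (- 1) *s g n c)"
    by (rule good_plus[OF assms(1) good_scale[OF assms(2)]])
  from good_zero[OF this] assms(3) show ?thesis by (auto simp: fun_eq_iff)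
qed

definition nth_prod :: "bit \<Rightarrow> 'b \<Rightarrow> int \<Rightarrow> (int \<Rightarrow> 'v \<Rightarrow> 'v) \<Rightarrow> int \<Rightarrow> 'v \<Rightarrow> 'v" where
  "nth_prod i b \<nu> g = (\<lambda>q c. tcomm \<nu> (koszul (par b) i) (a b) g c 0 q)"

text \<open>
  The fields of the words: the smallest space that contains the identity field and is closed
  under the products with generating fields.
\<close>

inductive wfield :: "bit \<Rightarrow> (int \<Rightarrow> 'v \<Rightarrow> 'v) \<Rightarrow> bool" where
  wfield_id: "wfield 0 (\<lambda>n c. if n = - 1 then c else 0)"
| wfield_zero: "wfield i (\<lambda>n c. 0)"
| wfield_plus: "wfield i f \<Longrightarrow> wfield i g \<Longrightarrow> wfield i (\<lambda>n c. f n c + g n c)"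
| wfield_scale: "wfield i f \<Longrightarrow> wfield i (\<lambda>n c. r *s f n c)"
| wfield_prod: "wfield i g \<Longrightarrow> wfield (par b + i) (nth_prod i b \<nu> g)"

lemma fld_id: "fld (\<lambda>n c. if n = - 1 then c else 0)"
  unfolding fld_def
proof (intro conjI allI)
  show "lin (\<lambda>c. if n = - 1 then c else 0)" for n :: int by (rule linI) auto
  show "\<exists>n0::int. \<forall>n\<ge>n0. (if n = - 1 then c else 0) = 0" for c :: 'v
    by (intro exI[of _ 0]) auto
qed

lemma wfield_fld: "wfield i f \<Longrightarrow> fld f"
  by (induction rule: wfield.induct) (auto simp: fld_id fld_0 fld_plus fld_scaled nth_prod_def intro!: fld_tcomm a_fld)

text \<open>
  A field that is local to the generating fields is local to every field of this space. The
  statement is about all such \<open>f\<close> at once because the step by Dong's lemma also needs the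
  locality of the generating field \<open>a b\<close> and \<open>g\<close>, which is the induction hypothesis for
  \<open>f = a b\<close>.
\<close>

lemma wfield_loc:
  assumes "wfield j g" "fld f" "\<And>b. \<exists>K. loc K (koszul i (par b)) f (a b)"
  shows "\<exists>K. loc K (koszul i j) f g"
  using assms
proof (induction arbitrary: f i rule: wfield.induct)
  case wfield_id
  have "loc 0 (koszul i 0) f (\<lambda>n c. if n = - 1 then c else 0)"
    using wfield_id by (auto simp: loc_def supercomm_def fun_eq_iff fld_zero)
  then show ?case ..
next
  case (wfield_zero j)
  have "loc 0 (koszul i j) f (\<lambda>n c. 0)"
    using wfield_zero by (auto simp: loc_def supercomm_def fun_eq_iff fld_zero)
  then show ?case ..
next
  case (wfield_plus j g g')
  obtain K L where "loc K (koszul i j) f g" "loc L (koszul i j) f g'"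
    using wfield_plus.IH wfield_plus.prems by meson
  then have "loc K (koszul i j) g f" "loc L (koszul i j) g' f" by (auto intro: loc_sym)
  then have "loc (max K L) (koszul i j) (\<lambda>n c. g n c + g' n c) f" using wfield_plus.prems(1) by (rule loc_add)
  then show ?case using loc_sym koszul_sq by blast
next
  case (wfield_scale j g r)
  obtain K where "loc K (koszul i j) f g"
    using wfield_scale.IH wfield_scale.prems by meson
  then have "loc K (koszul i j) g f" by (auto intro: loc_sym)
  then have "loc K (koszul i j) (\<lambda>n c. r *s g n c) f" using wfield_scale.prems(1) by (rule loc_scale)
  then show ?case using loc_sym koszul_sq by blast
next
  case (wfield_prod j g b \<nu>)
  obtain K where "loc K (koszul i (par b)) f (a b)" using wfield_prod.prems by blast
  moreover obtain L where "loc L (koszul i j) f g" using wfield_prod.IH wfield_prod.prems by blast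
  moreover obtain M where "loc M (koszul (par b) j) (a b) g" using wfield_prod.IH[OF a_fld a_loc] by blast
  ultimately show ?case
    unfolding koszul_add nth_prod_def by (intro Dong wfield_prod.prems a_fld wfield_fld[OF wfield_prod.hyps])
qed

lemma wfield_loc_a:
  assumes "wfield i g" shows "\<exists>K. loc K (koszul i (par b)) g (a b)"
proof -
  obtain K where "loc K (koszul (par b) i) (a b) g" using wfield_loc[OF assms a_fld a_loc] by blast
  then have "loc K (koszul i (par b)) g (a b)" unfolding koszul_sym[of i] by (rule loc_sym) simp
  then show ?thesis ..
qed

lemma wfield_good: "wfield i f \<Longrightarrow> good i f"
proof (induction rule: wfield.induct)
  case wfield_id
  show ?case
    unfolding good_def using wfield_loc_a[OF wfield.wfield_id] sub_P
    by (auto simp: fld_id covariant_def module_hom.zero[OF lin_T] subspace_0)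
next
  case (wfield_zero i)
  show ?case
    unfolding good_def using wfield_loc_a[OF wfield.wfield_zero] sub_P
    by (auto simp: fld_0 covariant_def module_hom.zero[OF lin_T] subspace_0)
next
  case (wfield_prod i g b \<nu>)
  let ?s = "koszul (par b) i"
  have g: "fld g" "covariant T g" using wfield_prod by (auto simp: good_def)
  show ?case
    unfolding good_def
  proof (intro conjI allI impI)
    show "\<exists>K. loc K (koszul (par b + i) (par b')) (nth_prod i b \<nu> g) (a b')" for b'
      by (rule wfield_loc_a[OF wfield.wfield_prod[OF wfield_prod.hyps]])
    show "fld (nth_prod i b \<nu> g)" unfolding nth_prod_def by (intro fld_tcomm a_fld g)
    show "covariant T (nth_prod i b \<nu> g)"
      unfolding covariant_def nth_prod_def covariant_tcomm[OF lin_T a_fld a_covariant g] by (simp add: mderiv_def)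
    show "nth_prod i b \<nu> g n v = 0" if "0 \<le> n" for n
      using imul_sum[of n 0 "\<lambda>m n. a b m (g n v)" \<nu> 0] imul_sum[of 0 0 "\<lambda>n m. g n (a b m v)" \<nu> n] that wfield_prod.IH
      by (auto simp: nth_prod_def tcomm_def good_def fld_zero[OF a_fld] fld_zero[OF g(1)] a_vac)
    show "nth_prod i b \<nu> g n c \<in> P (par b + i + j)" if "c \<in> P j" for n j c
      unfolding nth_prod_def
    proof (rule tcomm_mem[OF sub_P a_fld g(1)])
      have gP: "g n c \<in> P (i + j)" if "c \<in> P j" for n j c
        using wfield_prod.IH that unfolding good_def by blast
      show "a b m (g n c) \<in> P (par b + i + j)" for m n
        using a_P[OF gP[OF that]] by (simp only: add.assoc)
      show "g n (a b m c) \<in> P (par b + i + j)" for m n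
        using gP[OF a_P[OF that]] by (simp only: add.assoc add.left_commute)
    qed
  qed
qed (auto intro: good_plus good_scale)

lemma wfield_exists:
  assumes "x \<in> P i" shows "\<exists>f. wfield i f \<and> f (- 1) v = x"
proof -
  have w: "\<exists>f. wfield i f \<and> f (- 1) v = w" if "words v a par i w" for i w
    using that
  proof induction
    case words_vac
    show ?case by (intro exI conjI, rule wfield_id) simp
  next
    case (words_app i w b n)
    then obtain g where g: "wfield i g" "g (- 1) v = w" by blast
    have gv: "g n v = 0" if "0 \<le> n" for n using wfield_good[OF g(1)] that by (simp add: good_def)
    have "imul n (\<lambda>m n. a b m (g n v)) 0 (- 1) = a b n w"
      using imul_sum[of "- 1" 1 "\<lambda>m n. a b m (g n v)" n 0] by (simp add: gv fld_zero[OF a_fld] g)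
    moreover have "imul n (\<lambda>n m. g n (a b m v)) (- 1) 0 = 0"
      using imul_sum[of 0 0 "\<lambda>n m. g n (a b m v)" n "- 1"] by (simp add: a_vac fld_zero[OF wfield_fld[OF g(1)]])
    ultimately have "nth_prod i b n g (- 1) v = a b n w"
      by (simp add: nth_prod_def tcomm_def)
    then show ?case using wfield_prod[OF g(1)] by blast
  qed
  have "span {w. words v a par i w} \<subseteq> {f (- 1) v | f. wfield i f}"
  proof (rule span_minimal)
    show "{w. words v a par i w} \<subseteq> {f (- 1) v | f. wfield i f}" using w by force
    show "subspace {f (- 1) v | f. wfield i f}"
    proof (rule subspaceI)
      show "0 \<in> {f (- 1) v | f. wfield i f}"
        using wfield_zero[of i] by (auto intro!: exI[of _ "\<lambda>n c. 0"])
      show "x + y \<in> {f (- 1) v | f. wfield i f}" if xy: "x \<in> {f (- 1) v | f. wfield i f}" "y \<in> {f (- 1) v | f. wfield i f}" for x y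
      proof -
        obtain f g where "wfield i f" "wfield i g" "x = f (- 1) v" "y = g (- 1) v" using xy by blast
        then show ?thesis using wfield_plus[of i f g] by force
      qed
      show "c *s x \<in> {f (- 1) v | f. wfield i f}" if x: "x \<in> {f (- 1) v | f. wfield i f}" for c x
      proof -
        obtain f where "wfield i f" "x = f (- 1) v" using x by blast
        then show ?thesis using wfield_scale[of i f c] by force
      qed
    qed
  qed
  then show ?thesis using words_P[OF assms] by auto
qed


text \<open>
  The parity components are kept apart, as locality has no meaning for a field of mixed parity.
\<close>

definition is_state_field :: "'v \<Rightarrow> (int \<Rightarrow> 'v \<Rightarrow> 'v) \<Rightarrow> bool" where
  "is_state_field x h \<longleftrightarrow> (\<exists>f g. wfield 0 f \<and> wfield 1 g \<and> h = (\<lambda>n c. f n c + g n c) \<and> h (- 1) v = x)"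

definition Y :: "'v \<Rightarrow> int \<Rightarrow> 'v \<Rightarrow> 'v" where
  "Y x = (SOME h. is_state_field x h)"

lemma wfield_vP: "wfield i f \<Longrightarrow> f (- 1) v \<in> P i"
  using wfield_good v_P unfolding good_def by (metis add.right_neutral)

lemma is_state_field_unique:
  assumes "is_state_field x h" "is_state_field x h'" shows "h = h'"
proof -
  obtain f g where fg: "wfield 0 f" "wfield 1 g" "h = (\<lambda>n c. f n c + g n c)" "h (- 1) v = x"
    using assms(1) unfolding is_state_field_def by blast
  obtain f' g' where fg': "wfield 0 f'" "wfield 1 g'" "h' = (\<lambda>n c. f' n c + g' n c)" "h' (- 1) v = x"
    using assms(2) unfolding is_state_field_def by blast
  have "f (- 1) v - f' (- 1) v = g' (- 1) v - g (- 1) v"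
  proof -
    have "f (- 1) v + g (- 1) v = f' (- 1) v + g' (- 1) v"
      using fg(4) fg'(4) unfolding fg(3) fg'(3) by simp
    then show ?thesis by (simp add: algebra_simps)
  qed
  moreover have "f (- 1) v - f' (- 1) v \<in> P 0" "g' (- 1) v - g (- 1) v \<in> P 1"
    using fg fg' wfield_vP by (auto intro: subspace_diff[OF sub_P])
  ultimately have "f (- 1) v - f' (- 1) v = 0" "g' (- 1) v - g (- 1) v = 0"
    using P_disj by (metis Int_iff singletonD)+
  then have "f = f'" "g = g'"
    using good_unique[OF wfield_good wfield_good] fg(1,2) fg'(1,2) by simp_all
  then show ?thesis by (simp add: fg fg')
qed

lemma is_state_field_Y: "is_state_field x (Y x)"
proof -
  obtain y z where x: "x = y + z" "y \<in> P 0" "z \<in> P 1" using P_sum by blast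
  obtain f g where "wfield 0 f" "f (- 1) v = y" "wfield 1 g" "g (- 1) v = z"
    using wfield_exists x(2,3) by meson
  then have "is_state_field x (\<lambda>n c. f n c + g n c)" using x(1) unfolding is_state_field_def by blast
  then show ?thesis unfolding Y_def by (rule someI[of "is_state_field x"])
qed

lemma Y_eq: "is_state_field x h \<Longrightarrow> Y x = h"
  using is_state_field_unique[OF is_state_field_Y] by blast

lemma is_state_field_wfield: assumes "wfield i f" shows "is_state_field (f (- 1) v) f"
proof (cases i)
  case zero
  then show ?thesis
    using assms wfield_zero[of 1] unfolding is_state_field_def by (intro exI[of _ f] exI[of _ "\<lambda>n c. 0"]) auto
next
  case one
  then show ?thesis
    using assms wfield_zero[of 0] unfolding is_state_field_def by (intro exI[of _ "\<lambda>n c. 0"] exI[of _ f]) auto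
qed

lemma Y_wfield: "wfield i f \<Longrightarrow> Y (f (- 1) v) = f"
  by (intro Y_eq is_state_field_wfield)

lemma wfield_Y: assumes "x \<in> P i" shows "wfield i (Y x)"
  using wfield_exists[OF assms] Y_wfield by metis

lemma Y_v: "Y x (- 1) v = x"
  using is_state_field_Y[of x] by (auto simp: is_state_field_def)

lemma Y_add: "Y (x + y) = (\<lambda>n c. Y x n c + Y y n c)"
proof (rule Y_eq)
  obtain f g where fg: "wfield 0 f" "wfield 1 g" "Y x = (\<lambda>n c. f n c + g n c)"
    using is_state_field_Y[of x] unfolding is_state_field_def by blast
  obtain f' g' where fg': "wfield 0 f'" "wfield 1 g'" "Y y = (\<lambda>n c. f' n c + g' n c)"
    using is_state_field_Y[of y] unfolding is_state_field_def by blast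
  show "is_state_field (x + y) (\<lambda>n c. Y x n c + Y y n c)"
    unfolding is_state_field_def
    by (intro exI conjI, rule wfield_plus[OF fg(1) fg'(1)], rule wfield_plus[OF fg(2) fg'(2)])
      (simp_all add: Y_v, simp add: fg fg' algebra_simps)
qed

lemma Y_scale: "Y (r *s x) = (\<lambda>n c. r *s Y x n c)"
proof (rule Y_eq)
  obtain f g where fg: "wfield 0 f" "wfield 1 g" "Y x = (\<lambda>n c. f n c + g n c)"
    using is_state_field_Y[of x] unfolding is_state_field_def by blast
  show "is_state_field (r *s x) (\<lambda>n c. r *s Y x n c)"
    unfolding is_state_field_def
    by (intro exI conjI, rule wfield_scale[OF fg(1)], rule wfield_scale[OF fg(2)])
      (simp_all add: Y_v, simp add: fg algebra_simps)
qed

lemma Y_vac: "Y v n x = (if n = - 1 then x else 0)"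
  using Y_wfield[OF wfield_id] by simp

lemma Y_sum: obtains f g where "good 0 f" "good 1 g" "Y x = (\<lambda>n c. f n c + g n c)"
proof -
  obtain f g where "wfield 0 f" "wfield 1 g" "Y x = (\<lambda>n c. f n c + g n c)"
    using is_state_field_Y[of x] unfolding is_state_field_def by blast
  then show thesis using that wfield_good by blast
qed

lemma Y_fld: "fld (Y x)"
proof -
  obtain f g where fg: "good 0 f" "good 1 g" "Y x = (\<lambda>n c. f n c + g n c)"
    by (rule Y_sum)
  show ?thesis unfolding fg(3) using fg(1,2) by (auto intro!: fld_plus dest: good_fld)
qed

lemma Y_covariant: "covariant T (Y x)"
proof -
  obtain f g where fg: "good 0 f" "good 1 g" "Y x = (\<lambda>n c. f n c + g n c)"
    by (rule Y_sum)
  show ?thesis using fg(1,2) module_hom.add[OF lin_T]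
    by (auto simp: fg(3) good_def covariant_def algebra_simps)
qed

lemma Y_reg: "0 \<le> n \<Longrightarrow> Y x n v = 0"
proof -
  obtain f g where fg: "good 0 f" "good 1 g" "Y x = (\<lambda>n c. f n c + g n c)"
    by (rule Y_sum)
  then show "0 \<le> n \<Longrightarrow> Y x n v = 0" by (simp add: good_def)
qed

lemma Y_transl: "Y x (- 1 - 1) v = T x"
proof -
  have "T (Y x (- 1) v) = Y x (- 1) (T v) - of_int (- 1) *s Y x (- 1 - 1) v"
    using Y_covariant[of x] unfolding covariant_def by blast
  then show ?thesis by (simp add: Y_v T_v fld_zero[OF Y_fld])
qed

text \<open>
  The derivative of a good field is good, so both sides agree by uniqueness.
\<close>

lemma Y_T: "Y (T x) = (\<lambda>n c. - (of_int n *s Y x (n - 1) c))"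
proof -
  have hom: "Y (T x) = (\<lambda>n c. - (of_int n *s Y x (n - 1) c))" if x: "x \<in> P i" for x i
  proof -
    have Tx: "T x \<in> P i"
      using wfield_good[OF wfield_Y[OF x]] v_P unfolding good_def Y_transl[symmetric] by (metis add.right_neutral)
    show ?thesis
      by (rule good_unique[OF wfield_good[OF wfield_Y[OF Tx]] good_deriv[OF wfield_good[OF wfield_Y[OF x]]]])
        (use Y_transl[of x] in \<open>simp add: Y_v\<close>)
  qed
  obtain y z where x: "x = y + z" "y \<in> P 0" "z \<in> P 1" using P_sum by blast
  show ?thesis
    by (simp add: x(1) module_hom.add[OF lin_T] Y_add hom[OF x(2)] hom[OF x(3)] algebra_simps)
qed

definition state_va :: "('k, 'v) vertex_alg" where
  "state_va = \<lparr>smul = scale, car = UNIV, part = P, nprod = (\<lambda>n x y. Y x n y), vac = v\<rparr>"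

lemma Y_transl_pow: "Y x (- 1 - int k) v = (1 / fact k) *s (T ^^ k) x"
proof (induction k)
  case 0
  show ?case by (simp add: Y_v)
next
  case (Suc k)
  have "T (Y x (- 1 - int k) v) = - (of_int (- 1 - int k) *s Y x (- 1 - int k - 1) v)"
    using Y_covariant[of x] unfolding covariant_def by (simp add: T_v fld_zero[OF Y_fld])
  then have "(1 / fact k) *s (T ^^ Suc k) x = of_nat (Suc k) *s Y x (- 1 - int (Suc k)) v"
    unfolding Suc module_hom.scale[OF lin_T] by (simp add: algebra_simps)
  then have "(1 / of_nat (Suc k)) *s (1 / fact k) *s (T ^^ Suc k) x
      = (1 / of_nat (Suc k)) *s of_nat (Suc k) *s Y x (- 1 - int (Suc k)) v"
    by (simp only:)
  moreover have "of_nat (Suc k) \<noteq> (0::'k)" by (rule of_nat_neq_0)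
  ultimately show ?case by (simp add: mult.commute del: of_nat_Suc)
qed

theorem vertex_algebra_state_va: "vertex_algebra state_va"
proof -
  have tr: "transl state_va x = T x" for x
    using Y_transl[of x] by (simp add: transl_def state_va_def)
  have tr_pow: "(transl state_va ^^ k) x = (T ^^ k) x" for k x
    by (induction k) (auto simp: tr)
  show ?thesis
  proof (intro vertex_algebra.intro vertex_algebra_axioms.intro)
    show "vector_space (smul state_va)" by (simp add: state_va_def vector_space_axioms)
    show "module.subspace (smul state_va) (car state_va)" by (simp add: state_va_def)
    show "module.subspace (smul state_va) (part state_va i)" for i by (simp add: state_va_def sub_P)
    show "car state_va = {x + y |x y. x \<in> part state_va 0 \<and> y \<in> part state_va 1}"
      using P_sum by (auto simp: state_va_def)
    show "part state_va 0 \<inter> part state_va 1 = {0}" by (simp add: state_va_def P_disj)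
    show "vac state_va \<in> part state_va 0" by (simp add: state_va_def v_P)
    show "nprod state_va n a b \<in> part state_va (i + j)" if "a \<in> part state_va i" "b \<in> part state_va j" for a b n i j
      using wfield_good[OF wfield_Y] that by (simp add: state_va_def good_def del: add_bit_eq_xor)
    show "\<exists>n0. \<forall>n\<ge>n0. nprod state_va n a b = 0" for a b
      using Y_fld[of a] by (simp add: state_va_def fld_def)
    show "nprod state_va n a (vac state_va) = divided_transl state_va (nat (- n - 1)) a" if "n < 0" for a n
      using Y_transl_pow[of a "nat (- n - 1)"] that by (simp add: divided_transl_def tr_pow) (simp add: state_va_def)
    show "nprod state_va n (transl state_va a) b = smul state_va (of_int (- n)) (nprod state_va (n - 1) a b)" for a b n
      unfolding tr by (simp add: state_va_def Y_T)
    show "nprod state_va n a (transl state_va b) = smul state_va (of_int n) (nprod state_va (n - 1) a b) + transl state_va (nprod state_va n a b)" for a b n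
      unfolding tr using Y_covariant[of a] by (simp add: state_va_def covariant_def)
    show "\<exists>M. locality_order state_va (if i = 1 \<and> j = 1 then - 1 else 1) a b M"
      if "a \<in> part state_va i" "b \<in> part state_va j" for a b i j
    proof -
      have ab: "a \<in> P i" "b \<in> P j" using that by (simp_all add: state_va_def)
      obtain K where K: "loc K (koszul i j) (Y a) (Y b)"
        using wfield_loc[OF wfield_Y[OF ab(2)] Y_fld wfield_loc_a[OF wfield_Y[OF ab(1)]]] by blast
      have "locality_order state_va (koszul i j) a b (int K)"
        unfolding locality_order_def
      proof (intro ballI allI)
        fix c m n
        have "imul (int K) (\<lambda>m n. Y a m (Y b n c)) m n = koszul i j *s (- 1) powi (int K) *s imul (int K) (\<lambda>n m. Y b n (Y a m c)) n m"
          using loc_tcomm_zero[OF K order_refl, of c m n] by (simp add: tcomm_def)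
        then show "Sum_any (\<lambda>k::nat. smul state_va ((- 1) ^ k * (of_int (int K) gchoose k))
            (nprod state_va (m + int K - int k) a (nprod state_va (n + int k) b c))) =
          smul state_va (koszul i j) (Sum_any (\<lambda>k::nat. smul state_va ((- 1) powi (int K - int k) * (of_int (int K) gchoose k))
            (nprod state_va (n + int K - int k) b (nprod state_va (m + int k) a c))))"
          unfolding state_va_def vertex_alg.simps
            Sum_any_imul[where F = "\<lambda>m n. Y a m (Y b n c)"] Sum_any_mi'[where F = "\<lambda>n m. Y b n (Y a m c)"] .
      qed
      then show ?thesis unfolding koszul_def by blast
    qed
  qed (auto simp: state_va_def Y_add Y_scale fld_add[OF Y_fld] fld_scale[OF Y_fld] Y_vac Y_reg)
qed

lemma nprod_state_va_a: "nprod state_va n (a b (- 1) v) = a b n"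
proof -
  have "a b (- 1) v \<in> P (par b)" using a_P[OF v_P] by (metis add.right_neutral)
  then have "Y (a b (- 1) v) = a b"
    by (intro good_unique[OF wfield_good[OF wfield_Y] good_a]) (auto simp: Y_v)
  then show ?thesis by (simp add: state_va_def fun_eq_iff)
qed

end

section \<open>Convolution of modes\<close>

context char0_space begin

text \<open>
  The modes of \<open>\<theta>(u) F(u)\<close>, where both series are in the same variable.
\<close>

definition conv :: "(int \<Rightarrow> 'v \<Rightarrow> 'v) \<Rightarrow> (int \<Rightarrow> 'v) \<Rightarrow> int \<Rightarrow> 'v" where
  "conv \<theta> F m = Sum_any (\<lambda>j. \<theta> (m - 1 - j) (F j))"

lemma conv_eq:
  assumes "\<And>i. lin (\<theta> i)" "finite S" "\<And>j. j \<notin> S \<Longrightarrow> F j = 0"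
  shows "conv \<theta> F m = (\<Sum>j\<in>S. \<theta> (m - 1 - j) (F j))"
  unfolding conv_def
  by (rule Sum_any.expand_superset) (use assms module_hom.zero in \<open>force+\<close>)

lemma conv_shift: "conv \<theta> (\<lambda>j. F (j + c)) m = conv \<theta> F (m + c)"
proof -
  have "bij (\<lambda>j::int. j + c)"
    by (rule bijI') (auto simp: algebra_simps intro: exI[of _ "y - c" for y])
  then show ?thesis
    unfolding conv_def
    by (rule Sum_any.reindex_cong[symmetric]) (auto simp: fun_eq_iff algebra_simps)
qed

lemma conv_imul:
  assumes \<theta>: "\<And>i. lin (\<theta> i)" and S: "finite S" "\<And>j i. j \<notin> S \<Longrightarrow> F j i = 0"
    and b: "\<And>j i. i0 \<le> i \<Longrightarrow> F j i = 0"
  shows "conv \<theta> (\<lambda>j. imul \<nu> F j i) m = imul \<nu> (\<lambda>m i. conv \<theta> (\<lambda>j. F j i) m) m i"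
proof -
  define K where "K = nat (i0 - i)"
  have K: "i0 \<le> i + int K" by (simp add: K_def)
  define S' where "S' = (\<Union>k<K. (\<lambda>s. s - \<nu> + int k) ` S)"
  have S': "finite S'" using S(1) by (simp add: S'_def)
  have F0: "F (j + \<nu> - int k) i' = 0" if "j \<notin> S'" "k < K" for j k i'
  proof (rule S(2), rule notI)
    assume "j + \<nu> - int k \<in> S"
    then have "j \<in> (\<lambda>s. s - \<nu> + int k) ` S" by (intro image_eqI[of _ _ "j + \<nu> - int k"]) auto
    then show False using that by (auto simp: S'_def)
  qed
  have imul: "imul \<nu> F j i = (\<Sum>k<K. sbinom \<nu> k *s F (j + \<nu> - int k) (i + int k))" for j
    by (rule imul_sum) (use K in \<open>simp add: b\<close>)
  have "conv \<theta> (\<lambda>j. imul \<nu> F j i) m = (\<Sum>j\<in>S'. \<theta> (m - 1 - j) (imul \<nu> F j i))"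
    by (rule conv_eq[OF \<theta> S']) (simp add: imul F0)
  also have "\<dots> = (\<Sum>k<K. sbinom \<nu> k *s (\<Sum>j\<in>S'. \<theta> (m - 1 - j) (F (j + \<nu> - int k) (i + int k))))"
    unfolding imul module_hom.sum[OF \<theta>] module_hom.scale[OF \<theta>] scale_sum_right by (rule sum.swap)
  also have "\<dots> = (\<Sum>k<K. sbinom \<nu> k *s conv \<theta> (\<lambda>j. F j (i + int k)) (m + \<nu> - int k))"
  proof (intro sum.cong refl arg_cong[where f = "scale _"])
    fix k assume k: "k \<in> {..<K}"
    have "(\<Sum>j\<in>S'. \<theta> (m - 1 - j) (F (j + \<nu> - int k) (i + int k))) = conv \<theta> (\<lambda>j. F (j + (\<nu> - int k)) (i + int k)) m"
      by (subst conv_eq[OF \<theta> S']) (use F0 k in \<open>auto simp: add_diff_eq\<close>)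
    then show "(\<Sum>j\<in>S'. \<theta> (m - 1 - j) (F (j + \<nu> - int k) (i + int k))) = conv \<theta> (\<lambda>j. F j (i + int k)) (m + \<nu> - int k)"
      using conv_shift[of \<theta> "\<lambda>j. F j (i + int k)" "\<nu> - int k" m] by (simp add: add_diff_eq)
  qed
  also have "\<dots> = imul \<nu> (\<lambda>m i. conv \<theta> (\<lambda>j. F j i) m) m i"
    by (rule imul_sum[symmetric]) (use K in \<open>simp add: b conv_def module_hom.zero[OF \<theta>]\<close>)
  finally show ?thesis .
qed

end

section \<open>The polynomial ring\<close>

text \<open>
  The polynomial ring in the variables \<open>x_b^(n)\<close>, as the monoid algebra of the multisets of
  pairs \<open>(n, b)\<close>. The modes of the series \<open>x_b(w) = \<Sum> x_b^(n) w^n\<close> are called \<open>jet b\<close> below; they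
  vanish for nonnegative indices.
\<close>

type_synonym ('b, 'k) jets = "(nat \<times> 'b) multiset \<Rightarrow>\<^sub>0 'k"

definition sc :: "'k::field_char_0 \<Rightarrow> ('b, 'k) jets \<Rightarrow> ('b, 'k) jets" where
  "sc c f = Poly_Mapping.single 0 c * f"

definition mon :: "(nat \<times> 'b) multiset \<Rightarrow> ('b, 'k::field_char_0) jets" where
  "mon M = Poly_Mapping.single M 1"

definition jet :: "'b \<Rightarrow> int \<Rightarrow> ('b, 'k::field_char_0) jets" where
  "jet b i = (if i < 0 then mon {#(nat (- i - 1), b)#} else 0)"

interpretation H: char0_space sc
proof
  show "sc a (sc b x) = sc (a * b) x" for a b and x :: "('b, 'k::field_char_0) jets"
    by (simp add: sc_def mult.assoc[symmetric] mult_single)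
qed (simp_all add: sc_def algebra_simps single_add)

lemma lookup_sc: "Poly_Mapping.lookup (sc c f) M = c * Poly_Mapping.lookup f M"
  by (simp add: sc_def mult_map_scale_conv_mult[symmetric] lookup_map_times)

lemma keys_sc: "Poly_Mapping.keys (sc c f) \<subseteq> Poly_Mapping.keys f"
  by (auto simp: in_keys_iff lookup_sc)

lemma sc_mult: "f * sc c g = sc c (f * g)" "sc c f * g = sc c (f * g)"
  by (simp_all add: sc_def mult.left_commute mult.assoc)

lemma mon_empty [simp]: "mon {#} = 1"
  by (simp add: mon_def)

lemma mon_add: "mon (M + M') = mon M * mon M'"
  by (simp add: mon_def mult_single)

lemma jet_neg: "jet b (- int n - 1) = mon {#(n, b)#}"
  by (simp add: jet_def)

lemma jet_nonneg: "0 \<le> i \<Longrightarrow> jet b i = 0"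
  by (simp add: jet_def)

lemma mon_add_mset: "mon (add_mset (n, b) M) = jet b (- int n - 1) * mon M"
  using mon_add[of "{#(n, b)#}" M] by (simp add: jet_neg)

lemma jets_expand: "f = (\<Sum>M\<in>Poly_Mapping.keys f. sc (Poly_Mapping.lookup f M) (mon M))"
proof (rule poly_mapping_eqI)
  fix k
  have "(\<Sum>M\<in>Poly_Mapping.keys f. Poly_Mapping.lookup f M * (1 when M = k))
      = (\<Sum>M\<in>Poly_Mapping.keys f. if M = k then Poly_Mapping.lookup f k else 0)"
    by (intro sum.cong) auto
  then show "Poly_Mapping.lookup f k = Poly_Mapping.lookup (\<Sum>M\<in>Poly_Mapping.keys f. sc (Poly_Mapping.lookup f M) (mon M)) k"
    by (simp add: lookup_sum lookup_sc mon_def lookup_single sum.delta in_keys_iff)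
qed

lemma subspace_monoI:
  assumes "H.subspace S" "\<And>M. M \<in> Poly_Mapping.keys f \<Longrightarrow> mon M \<in> S"
  shows "f \<in> S"
  by (subst jets_expand) (intro H.subspace_sum H.subspace_scale assms)

text \<open>
  Most identities of operators on the polynomial ring are proved with this rule: it suffices to
  know how the operators act on \<open>1\<close> and how they move past \<open>x_b(w)\<close>.
\<close>

lemma jets_induct [case_names one x add sc]:
  assumes "P 1" "\<And>b n f. P f \<Longrightarrow> P (jet b (- int n - 1) * f)"
    "\<And>f g. P f \<Longrightarrow> P g \<Longrightarrow> P (f + g)" "\<And>c f. P f \<Longrightarrow> P (sc c f)"
  shows "P f"
proof -
  have mon: "P (mon M)" for M
    by (induction M) (auto simp: mon_add_mset assms(1,2))
  have 0: "P 0" using assms(4)[OF assms(1), of 0] by simp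
  have "H.subspace {f. P f}"
    by (rule H.subspaceI) (use 0 assms(3,4) in blast)+
  then have "f \<in> {f. P f}"
    by (rule subspace_monoI) (use mon in blast)
  then show ?thesis by simp
qed

definition lin_ext :: "('k \<Rightarrow> 'v \<Rightarrow> 'v) \<Rightarrow> ((nat \<times> 'b) multiset \<Rightarrow> 'v) \<Rightarrow> ('b, 'k::field_char_0) jets \<Rightarrow> 'v::ab_group_add" where
  "lin_ext s \<phi> f = (\<Sum>M\<in>Poly_Mapping.keys f. s (Poly_Mapping.lookup f M) (\<phi> M))"

context char0_space begin

lemma lin_ext_superset:
  assumes "finite S" "Poly_Mapping.keys f \<subseteq> S"
  shows "lin_ext scale \<phi> f = (\<Sum>M\<in>S. Poly_Mapping.lookup f M *s \<phi> M)"
  unfolding lin_ext_def using assms by (intro sum.mono_neutral_left) (auto simp: in_keys_iff)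

lemma lin_ext_hom:
  fixes \<phi> :: "(nat \<times> 'b) multiset \<Rightarrow> 'v"
  shows "module_hom sc scale (lin_ext scale \<phi>)"
proof (intro module_hom.intro module_hom_axioms.intro)
  show "module sc" by unfold_locales
  show "module scale" by unfold_locales
  fix f g :: "('b, 'k) jets" and c
  let ?S = "Poly_Mapping.keys f \<union> Poly_Mapping.keys g"
  show "lin_ext scale \<phi> (f + g) = lin_ext scale \<phi> f + lin_ext scale \<phi> g"
    by (subst (1 2 3) lin_ext_superset[of ?S])
      (use keys_add[of f g] in \<open>auto simp: lookup_add scale_left_distrib sum.distrib\<close>)
  show "lin_ext scale \<phi> (sc c f) = c *s lin_ext scale \<phi> f"
    by (subst (1 2) lin_ext_superset[of "Poly_Mapping.keys f"])
      (use keys_sc[of c f] in \<open>auto simp: lookup_sc scale_sum_right\<close>)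
qed

lemma lin_ext_mono [simp]: "lin_ext scale \<phi> (mon M) = \<phi> M"
  by (simp add: lin_ext_def mon_def)

end

lemma lin_mult: "H.lin ((*) g)"
  by (rule H.linI) (simp_all add: algebra_simps sc_mult)

section \<open>Twists\<close>

text \<open>
  The twist \<open>\<theta>(u)\<close> with exponents \<open>\<nu>\<close>, signs \<open>\<epsilon>\<close> and initial series \<open>J\<close> is determined by
  \<open>\<theta>(u) 1 = J(u)\<close> and \<open>\<theta>(u) x_b(w) = \<epsilon>_b \<iota>_(u,w) (u - w)^(\<nu>_b) x_b(w) \<theta>(u)\<close>. It is defined by
  removing one variable at a time; the order is irrelevant because the factors commute. With
  \<open>J = 1\<close> it is the homomorphism \<open>\<Gamma>\<close> of the introduction, and with \<open>J(u) = x_a(u)\<close> it is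
  \<open>x_a(u) \<Gamma>(u)\<close>.
\<close>

definition twist_step :: "('b \<Rightarrow> int) \<Rightarrow> ('b \<Rightarrow> 'k) \<Rightarrow> nat \<times> 'b \<Rightarrow> (int \<Rightarrow> ('b, 'k::field_char_0) jets) \<Rightarrow> int \<Rightarrow> ('b, 'k) jets" where
  "twist_step \<nu> \<epsilon> = (\<lambda>(n, b) F m. sc (\<epsilon> b) (H.imul (\<nu> b) (\<lambda>m i. jet b i * F m) m (- int n - 1)))"

definition twist :: "('b \<Rightarrow> int) \<Rightarrow> ('b \<Rightarrow> 'k) \<Rightarrow> (int \<Rightarrow> ('b, 'k::field_char_0) jets) \<Rightarrow> int \<Rightarrow> ('b, 'k) jets \<Rightarrow> ('b, 'k) jets" where
  "twist \<nu> \<epsilon> J m = lin_ext sc (\<lambda>M. fold_mset (twist_step \<nu> \<epsilon>) J M m)"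

lemma bdd_jet: "bdd (\<lambda>m i. jet b i * F m)" "bdd (\<lambda>m i. F m * jet b i)"
  by (rule bddI[of 0]; simp add: jet_nonneg)+

lemma twist_step_commute: "twist_step \<nu> \<epsilon> y \<circ> twist_step \<nu> \<epsilon> z = twist_step \<nu> \<epsilon> z \<circ> twist_step \<nu> \<epsilon> (y :: nat \<times> 'b)"
proof -
  obtain n b n' b' where yz: "y = (n, b)" "z = (n', b')" by (cases y, cases z) blast
  have *: "twist_step \<nu> \<epsilon> (n, b) (twist_step \<nu> \<epsilon> (n', b') F) m
     = sc (\<epsilon> b * \<epsilon> b') (H.imul (\<nu> b) (\<lambda>m i. H.imul (\<nu> b') (\<lambda>m i'. jet b i * jet b' i' * F m) m (- int n' - 1)) m (- int n - 1))"
    for n b n' b' F m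
    by (simp add: twist_step_def sc_mult H.imul_scale mult.assoc H.imul_map[OF lin_mult bdd_jet(1), symmetric])
  show ?thesis
  proof (intro ext, unfold o_apply yz *)
    fix F m
    show "sc (\<epsilon> b * \<epsilon> b') (H.imul (\<nu> b) (\<lambda>m i. H.imul (\<nu> b') (\<lambda>m i'. jet b i * jet b' i' * F m) m (- int n' - 1)) m (- int n - 1))
        = sc (\<epsilon> b' * \<epsilon> b) (H.imul (\<nu> b') (\<lambda>m i. H.imul (\<nu> b) (\<lambda>m i'. jet b' i * jet b i' * F m) m (- int n - 1)) m (- int n' - 1))"
      by (subst H.mi12_mi13[where ?m0.0 = 0 and ?n0.0 = 0]) (auto simp: jet_nonneg ac_simps)
  qed
qed

interpretation twist_comm: comp_fun_commute "twist_step \<nu> \<epsilon>"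
  by (unfold_locales, rule twist_step_commute)

lemma twist_lin: "H.lin (twist \<nu> \<epsilon> J m)"
  unfolding twist_def by (rule H.lin_ext_hom)

lemmas twist_plus = module_hom.add[OF twist_lin]
lemmas twist_sc = module_hom.scale[OF twist_lin]
lemmas twist_zero = module_hom.zero[OF twist_lin]

lemma twist_1 [simp]: "twist \<nu> \<epsilon> J m 1 = J m"
  unfolding twist_def mon_empty[symmetric] H.lin_ext_mono by simp

lemma jets_lin_eq:
  assumes L: "module_hom sc s L" "module_hom sc s L'" and "\<And>M. L (mon M) = L' (mon M)"
  shows "L f = L' f"
proof -
  interpret L: module_hom sc s L by fact
  interpret L': module_hom sc s L' by fact
  show ?thesis
    by (subst (1 2) jets_expand) (simp add: L.sum L'.sum L.scale L'.scale assms)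
qed

lemma twist_x: "twist \<nu> \<epsilon> J m (jet b i * f) = sc (\<epsilon> b) (H.imul (\<nu> b) (\<lambda>m i. jet b i * twist \<nu> \<epsilon> J m f) m i)"
proof (cases "i < 0")
  case True
  then have i: "i = - int (nat (- i - 1)) - 1" by simp
  show ?thesis
  proof (rule jets_lin_eq[of sc "\<lambda>f. twist \<nu> \<epsilon> J m (jet b i * f)"
        "\<lambda>f. sc (\<epsilon> b) (H.imul (\<nu> b) (\<lambda>m i. jet b i * twist \<nu> \<epsilon> J m f) m i)"])
    show "H.lin (\<lambda>f. twist \<nu> \<epsilon> J m (jet b i * f))"
      by (rule H.linI) (simp_all add: algebra_simps twist_plus sc_mult twist_sc)
    show "H.lin (\<lambda>f. sc (\<epsilon> b) (H.imul (\<nu> b) (\<lambda>m i. jet b i * twist \<nu> \<epsilon> J m f) m i))"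
      by (rule H.linI)
        (simp_all add: distrib_left twist_plus sc_mult twist_sc H.imul_add bdd_jet H.imul_scale H.scale_right_distrib mult.commute)
    fix M
    have "twist \<nu> \<epsilon> J m (jet b i * mon M) = fold_mset (twist_step \<nu> \<epsilon>) J (add_mset (nat (- i - 1), b) M) m"
      by (subst i, subst mon_add_mset[symmetric]) (simp add: twist_def del: twist_comm.fold_mset_add_mset)
    also have "\<dots> = sc (\<epsilon> b) (H.imul (\<nu> b) (\<lambda>m i. jet b i * twist \<nu> \<epsilon> J m (mon M)) m i)"
    proof -
      have "fold_mset (twist_step \<nu> \<epsilon>) J (add_mset (nat (- i - 1), b) M) m
          = twist_step \<nu> \<epsilon> (nat (- i - 1), b) (\<lambda>m. twist \<nu> \<epsilon> J m (mon M)) m"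
        by (simp add: twist_def)
      also have "\<dots> = sc (\<epsilon> b) (H.imul (\<nu> b) (\<lambda>m i. jet b i * twist \<nu> \<epsilon> J m (mon M)) m (- int (nat (- i - 1)) - 1))"
        by (simp only: twist_step_def prod.case)
      finally show ?thesis by (simp only: i[symmetric])
    qed
    finally show "twist \<nu> \<epsilon> J m (jet b i * mon M) = sc (\<epsilon> b) (H.imul (\<nu> b) (\<lambda>m i. jet b i * twist \<nu> \<epsilon> J m (mon M)) m i)" .
  qed
next
  case False
  then show ?thesis
    using H.imul_sum[of i 0 "\<lambda>m i. jet b i * twist \<nu> \<epsilon> J m f" "\<nu> b" m]
    by (simp add: jet_nonneg twist_zero)
qed

lemma twist_x_sum: "twist \<nu> \<epsilon> J m (jet b (- int n - 1) * f)
   = sc (\<epsilon> b) (\<Sum>k\<le>n. sc (sbinom (\<nu> b) k) (jet b (- int n - 1 + int k) * twist \<nu> \<epsilon> J (m + \<nu> b - int k) f))"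
  unfolding twist_x
  by (subst H.imul_sum[where K = "Suc n"]) (auto simp: jet_nonneg lessThan_Suc_atMost)

lemma twist_trunc:
  assumes "\<And>m. m0 \<le> m \<Longrightarrow> J m = 0"
  shows "\<exists>m0. \<forall>m\<ge>m0. twist \<nu> \<epsilon> J m f = 0"
proof (induction f rule: jets_induct)
  case one
  show ?case by (intro exI[of _ m0]) (simp add: assms)
next
  case (x b n f)
  then obtain m1 where m1: "\<And>m. m1 \<le> m \<Longrightarrow> twist \<nu> \<epsilon> J m f = 0" by blast
  show ?case
    by (intro exI[of _ "m1 - \<nu> b + int n"]) (simp add: twist_x_sum m1)
next
  case (add f g)
  then obtain m1 m2 where "\<And>m. m1 \<le> m \<Longrightarrow> twist \<nu> \<epsilon> J m f = 0" "\<And>m. m2 \<le> m \<Longrightarrow> twist \<nu> \<epsilon> J m g = 0" by blast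
  then show ?case by (intro exI[of _ "max m1 m2"]) (simp add: twist_plus)
next
  case (sc c f)
  then show ?case by (auto simp: twist_sc)
qed

lemma twist_fld: "(\<And>m. m0 \<le> m \<Longrightarrow> J m = 0) \<Longrightarrow> H.fld (twist \<nu> \<epsilon> J)"
  unfolding H.fld_def using twist_lin twist_trunc by blast

lemma twist_finite:
  assumes "finite {m. J m \<noteq> 0}"
  shows "finite {m. twist \<nu> \<epsilon> J m f \<noteq> 0}"
proof (induction f rule: jets_induct)
  case one
  show ?case by (simp add: assms)
next
  case (x b n f)
  let ?S = "{m. twist \<nu> \<epsilon> J m f \<noteq> 0}"
  have "{m. twist \<nu> \<epsilon> J m (jet b (- int n - 1) * f) \<noteq> 0} \<subseteq> (\<Union>k\<le>n. (\<lambda>s. s - \<nu> b + int k) ` ?S)"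
  proof
    fix m assume m: "m \<in> {m. twist \<nu> \<epsilon> J m (jet b (- int n - 1) * f) \<noteq> 0}"
    have "\<exists>k\<le>n. twist \<nu> \<epsilon> J (m + \<nu> b - int k) f \<noteq> 0"
    proof (rule ccontr)
      assume "\<not> (\<exists>k\<le>n. twist \<nu> \<epsilon> J (m + \<nu> b - int k) f \<noteq> 0)"
      then show False using m by (simp add: twist_x_sum)
    qed
    then obtain k where "k \<le> n" "twist \<nu> \<epsilon> J (m + \<nu> b - int k) f \<noteq> 0" by blast
    then show "m \<in> (\<Union>k\<le>n. (\<lambda>s. s - \<nu> b + int k) ` ?S)"
      by (intro UN_I[of k] image_eqI[of _ _ "m + \<nu> b - int k"]) auto
  qed
  then show ?case by (rule finite_subset) (use x in simp)
next
  case (add f g)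
  have "{m. twist \<nu> \<epsilon> J m (f + g) \<noteq> 0} \<subseteq> {m. twist \<nu> \<epsilon> J m f \<noteq> 0} \<union> {m. twist \<nu> \<epsilon> J m g \<noteq> 0}"
    by (auto simp: twist_plus)
  then show ?case by (rule finite_subset) (use add in simp)
next
  case (sc c f)
  have "{m. twist \<nu> \<epsilon> J m (sc c f) \<noteq> 0} \<subseteq> {m. twist \<nu> \<epsilon> J m f \<noteq> 0}"
    by (auto simp: twist_sc)
  then show ?case by (rule finite_subset) (use sc in simp)
qed

definition unit_ser :: "int \<Rightarrow> ('b, 'k::field_char_0) jets" where
  "unit_ser m = (if m = - 1 then 1 else 0)"

lemma finite_unit_ser: "finite {m. unit_ser m \<noteq> 0}"
  by (rule finite_subset[of _ "{- 1}"]) (auto simp: unit_ser_def)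

lemma twist_unit_ser_finite: "finite {m. twist \<nu> \<epsilon> unit_ser m f \<noteq> 0}"
  by (rule twist_finite[OF finite_unit_ser])

text \<open>
  In \<open>\<theta>(u) \<Gamma>(u)\<close> the factors \<open>(u - w)^\<nu>\<close> and \<open>(u - w)^(\<nu>')\<close> that appear in front of \<open>x_b(w)\<close>
  multiply.
\<close>

lemma conv_twist:
  "H.conv (twist \<nu> \<epsilon> J) (\<lambda>j. twist \<nu>' \<epsilon>' unit_ser j f) m = twist (\<lambda>b. \<nu> b + \<nu>' b) (\<lambda>b. \<epsilon> b * \<epsilon>' b) J m f"
proof (induction f arbitrary: m rule: jets_induct)
  case one
  show ?case by (subst H.conv_eq[where S = "{- 1}"]) (auto simp: twist_lin unit_ser_def)
next
  case (x b n f)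
  let ?i = "- int n - 1"
  let ?\<theta> = "twist \<nu> \<epsilon> J" and ?\<Gamma> = "twist \<nu>' \<epsilon>' unit_ser"
  let ?R = "twist (\<lambda>b. \<nu> b + \<nu>' b) (\<lambda>b. \<epsilon> b * \<epsilon>' b) J"
  define S where "S = {j. ?\<Gamma> j f \<noteq> 0}"
  have S: "finite S" "\<And>j. j \<notin> S \<Longrightarrow> ?\<Gamma> j f = 0" by (auto simp: S_def twist_unit_ser_finite)
  have "H.conv ?\<theta> (\<lambda>j. ?\<Gamma> j (jet b ?i * f)) m
    = H.conv ?\<theta> (\<lambda>j. H.imul (\<nu>' b) (\<lambda>j i. sc (\<epsilon>' b) (jet b i * ?\<Gamma> j f)) j ?i) m"
    by (simp add: twist_x H.imul_scale)
  also have "\<dots> = H.imul (\<nu>' b) (\<lambda>m i. H.conv ?\<theta> (\<lambda>j. sc (\<epsilon>' b) (jet b i * ?\<Gamma> j f)) m) m ?i"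
    by (rule H.conv_imul[where S = S and ?i0.0 = 0]) (auto simp: twist_lin S jet_nonneg)
  also have "(\<lambda>m i. H.conv ?\<theta> (\<lambda>j. sc (\<epsilon>' b) (jet b i * ?\<Gamma> j f)) m)
      = (\<lambda>m i. H.imul (\<nu> b) (\<lambda>m i. sc (\<epsilon> b * \<epsilon>' b) (jet b i * ?R m f)) m i)"
  proof (intro ext)
    fix m i
    have "H.conv ?\<theta> (\<lambda>j. sc (\<epsilon>' b) (jet b i * ?\<Gamma> j f)) m = (\<Sum>j\<in>S. sc (\<epsilon>' b) (?\<theta> (m - 1 - j) (jet b i * ?\<Gamma> j f)))"
      by (subst H.conv_eq[where S = S]) (auto simp: twist_lin S twist_sc)
    also have "\<dots> = (\<Sum>j\<in>S. sc (\<epsilon> b * \<epsilon>' b) (H.imul (\<nu> b) (\<lambda>m i. jet b i * ?\<theta> (m - 1 - j) (?\<Gamma> j f)) m i))"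
      using H.imul_shift[of "\<nu> b" "\<lambda>m i. jet b i * ?\<theta> m (?\<Gamma> j f)" "- 1 - j" 0 m i for j]
      by (simp add: twist_x mult.commute algebra_simps)
    also have "\<dots> = sc (\<epsilon> b * \<epsilon>' b) (H.imul (\<nu> b) (\<lambda>m i. \<Sum>j\<in>S. jet b i * ?\<theta> (m - 1 - j) (?\<Gamma> j f)) m i)"
      by (subst H.imul_sumf) (auto simp: S bdd_jet H.scale_sum_right)
    also have "(\<lambda>m i. \<Sum>j\<in>S. jet b i * ?\<theta> (m - 1 - j) (?\<Gamma> j f)) = (\<lambda>m i. jet b i * H.conv ?\<theta> (\<lambda>j. ?\<Gamma> j f) m)"
      by (subst H.conv_eq[where S = S]) (auto simp: twist_lin S sum_distrib_left)
    also have "sc (\<epsilon> b * \<epsilon>' b) (H.imul (\<nu> b) \<dots> m i) = H.imul (\<nu> b) (\<lambda>m i. sc (\<epsilon> b * \<epsilon>' b) (jet b i * ?R m f)) m i"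
      by (simp add: x H.imul_scale)
    finally show "H.conv ?\<theta> (\<lambda>j. sc (\<epsilon>' b) (jet b i * ?\<Gamma> j f)) m
      = H.imul (\<nu> b) (\<lambda>m i. sc (\<epsilon> b * \<epsilon>' b) (jet b i * ?R m f)) m i" .
  qed
  also have "H.imul (\<nu>' b) (\<lambda>m i. H.imul (\<nu> b) (\<lambda>m i. sc (\<epsilon> b * \<epsilon>' b) (jet b i * ?R m f)) m i) m ?i
      = H.imul (\<nu>' b + \<nu> b) (\<lambda>m i. sc (\<epsilon> b * \<epsilon>' b) (jet b i * ?R m f)) m ?i"
    by (subst H.imul_imul) (auto simp: jet_nonneg intro: bddI[of 0])
  also have "\<dots> = ?R m (jet b ?i * f)"
    by (simp add: twist_x H.imul_scale add.commute)
  finally show ?case .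
next
  case (add f g)
  let ?S = "{j. twist \<nu>' \<epsilon>' unit_ser j f \<noteq> 0} \<union> {j. twist \<nu>' \<epsilon>' unit_ser j g \<noteq> 0}"
  have S: "finite ?S" by (simp add: twist_unit_ser_finite)
  show ?case
    unfolding twist_plus add[symmetric]
    by (subst (1 2 3) H.conv_eq[OF twist_lin S]) (auto simp: twist_plus sum.distrib)
next
  case (sc c f)
  let ?S = "{j. twist \<nu>' \<epsilon>' unit_ser j f \<noteq> 0}"
  have S: "finite ?S" by (simp add: twist_unit_ser_finite)
  show ?case
    unfolding twist_sc sc[symmetric]
    by (subst (1 2) H.conv_eq[OF twist_lin S]) (auto simp: twist_sc H.scale_sum_right)
qed

lemma twist_trivial:
  assumes "\<And>b. \<nu> b = 0" "\<And>b. \<epsilon> b = 1"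
  shows "twist \<nu> \<epsilon> J m f = J m * f"
proof (rule jets_induct[of "\<lambda>f. twist \<nu> \<epsilon> J m f = J m * f"])
  show "twist \<nu> \<epsilon> J m (jet b (- int n - 1) * f) = J m * (jet b (- int n - 1) * f)"
    if "twist \<nu> \<epsilon> J m f = J m * f" for b n f
    by (simp add: twist_x assms H.imul_0 that mult.left_commute)
qed (simp_all add: twist_plus twist_sc algebra_simps sc_mult)

lemma twist_commute:
  "twist \<nu> \<epsilon> unit_ser m (twist \<nu>' \<epsilon>' unit_ser n f) = twist \<nu>' \<epsilon>' unit_ser n (twist \<nu> \<epsilon> unit_ser m f)"
proof (induction f arbitrary: m n rule: jets_induct)
  case one
  show ?case by (auto simp: unit_ser_def twist_zero)
next
  case (x b k f)
  have *: "twist \<nu> \<epsilon> J m (twist \<nu>' \<epsilon>' J' n (jet b i * f)) = sc (\<epsilon>' b * \<epsilon> b)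
     (H.imul (\<nu>' b) (\<lambda>n i. H.imul (\<nu> b) (\<lambda>m i. jet b i * twist \<nu> \<epsilon> J m (twist \<nu>' \<epsilon>' J' n f)) m i) n i)"
    for \<nu> \<epsilon> \<nu>' \<epsilon>' J J' m n i
    by (simp add: twist_x[of \<nu>'] twist_sc H.imul_map[OF twist_lin bdd_jet(1), symmetric])
      (simp add: twist_x H.imul_scale)
  show ?case
    unfolding *
    by (subst H.mi13_mi23[where ?n0.0 = 0]) (auto simp: jet_nonneg x mult.commute)
qed (simp_all add: twist_plus twist_sc)

section \<open>Gradings of the polynomial ring\<close>

definition supp_in :: "((nat \<times> 'b) multiset \<Rightarrow> bool) \<Rightarrow> ('b, 'k::field_char_0) jets set" where
  "supp_in Q = {f. \<forall>M\<in>Poly_Mapping.keys f. Q M}"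

definition colors :: "(nat \<times> 'b) multiset \<Rightarrow> 'b multiset" where
  "colors M = image_mset snd M"

definition energy :: "(nat \<times> 'b) multiset \<Rightarrow> nat" where
  "energy M = (\<Sum>y\<in>#M. fst y)"

lemma colors_simps [simp]: "colors {#} = {#}" "colors (add_mset y M) = add_mset (snd y) (colors M)"
  by (simp_all add: colors_def)

lemma energy_simps [simp]: "energy {#} = 0" "energy (add_mset y M) = fst y + energy M"
  by (simp_all add: energy_def)

lemma size_colors: "size (colors M) = size M"
  by (simp add: colors_def)

lemma subspace_supp_in: "H.subspace (supp_in Q)"
proof (rule H.subspaceI)
  show "0 \<in> supp_in Q" by (simp add: supp_in_def)
  show "f + g \<in> supp_in Q" if "f \<in> supp_in Q" "g \<in> supp_in Q" for f g :: "('b, 'k::field_char_0) jets"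
    using that keys_add[of f g] by (auto simp: supp_in_def)
  show "sc c f \<in> supp_in Q" if "f \<in> supp_in Q" for c and f :: "('b, 'k::field_char_0) jets"
    using that keys_sc[of c f] by (auto simp: supp_in_def)
qed

lemma mon_supp_in: "Q M \<Longrightarrow> mon M \<in> supp_in Q"
  by (simp add: supp_in_def mon_def)

lemma supp_in_mono: "f \<in> supp_in Q \<Longrightarrow> (\<And>M. Q M \<Longrightarrow> Q' M) \<Longrightarrow> f \<in> supp_in Q'"
  by (auto simp: supp_in_def)

lemma supp_in_subset:
  assumes "f \<in> supp_in Q" "H.subspace S" "\<And>M. Q M \<Longrightarrow> mon M \<in> S"
  shows "f \<in> S"
  by (rule subspace_monoI) (use assms in \<open>auto simp: supp_in_def\<close>)

lemma jet_supp_in: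
  fixes f :: "('b, 'k::field_char_0) jets"
  assumes f: "f \<in> supp_in Q" and Q: "\<And>n M. i = - int n - 1 \<Longrightarrow> Q M \<Longrightarrow> Q' (add_mset (n, b) M)"
  shows "jet b i * f \<in> supp_in Q'"
proof (cases "i < 0")
  case True
  then have i: "i = - int (nat (- i - 1)) - 1" by simp
  have "f \<in> {f. jet b i * f \<in> supp_in Q'}"
  proof (rule supp_in_subset[OF f])
    show "H.subspace {f. jet b i * f \<in> supp_in Q'}"
      by (rule H.subspaceI)
        (auto simp: distrib_left sc_mult intro: H.subspace_add H.subspace_scale H.subspace_0 subspace_supp_in)
    show "(mon M :: ('b, 'k) jets) \<in> {f. jet b i * f \<in> supp_in Q'}" if "Q M" for M
    proof -
      have "(mon (add_mset (nat (- i - 1), b) M) :: ('b, 'k) jets) \<in> supp_in Q'"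
        by (rule mon_supp_in) (rule Q[OF i that])
      then show ?thesis unfolding mon_add_mset by (simp only: i[symmetric] mem_Collect_eq)
    qed
  qed
  then show ?thesis by simp
next
  case False
  then show ?thesis using H.subspace_0[OF subspace_supp_in] by (simp add: jet_nonneg)
qed

lemma twist_colors:
  assumes J: "\<And>m. J m \<in> supp_in (\<lambda>M. colors M = \<mu>)" and f: "f \<in> supp_in (\<lambda>M. colors M = \<kappa>)"
  shows "twist \<nu> \<epsilon> J m f \<in> supp_in (\<lambda>M. colors M = \<mu> + \<kappa>)"
proof -
  have mon: "twist \<nu> \<epsilon> J m (mon M) \<in> supp_in (\<lambda>M'. colors M' = \<mu> + colors M)" for M m
  proof (induction M arbitrary: m)
    case (add y M)
    obtain n b where y: "y = (n, b)" by (cases y)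
    show ?case
      unfolding y mon_add_mset twist_x_sum
      by (intro H.subspace_scale H.subspace_sum subspace_supp_in jet_supp_in[OF add]) auto
  qed (simp add: J)
  have "f \<in> {f. twist \<nu> \<epsilon> J m f \<in> supp_in (\<lambda>M. colors M = \<mu> + \<kappa>)}"
  proof (rule supp_in_subset[OF f])
    show "H.subspace {f. twist \<nu> \<epsilon> J m f \<in> supp_in (\<lambda>M. colors M = \<mu> + \<kappa>)}"
      by (rule H.subspaceI)
        (auto simp: twist_plus twist_sc twist_zero intro: H.subspace_add H.subspace_scale H.subspace_0 subspace_supp_in)
    show "mon M \<in> {f. twist \<nu> \<epsilon> J m f \<in> supp_in (\<lambda>M. colors M = \<mu> + \<kappa>)}" if "colors M = \<kappa>" for M
      using mon[of m M] that by simp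
  qed
  then show ?thesis by simp
qed

text \<open>
  The operator \<open>\<Gamma>(u)\<close> is homogeneous: the coefficient of \<open>u^(-m-1)\<close> lowers the sum of the upper
  indices by the number of powers of \<open>u\<close> that are missing from \<open>\<Prod> u^(\<nu>_b)\<close>.
\<close>

lemma twist_energy:
  "twist \<nu> \<epsilon> unit_ser m (mon M) \<in> supp_in (\<lambda>M'. colors M' = colors M
     \<and> int (energy M') = int (energy M) - m - 1 - (\<Sum>b\<in>#colors M. \<nu> b))"
proof (induction M arbitrary: m)
  case empty
  have "1 \<in> supp_in (\<lambda>M'. colors M' = {#} \<and> energy M' = 0)" unfolding mon_empty[symmetric] by (rule mon_supp_in) simp
  then show ?case using H.subspace_0[OF subspace_supp_in] by (auto simp: unit_ser_def)
next
  case (add y M)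
  obtain n b where y: "y = (n, b)" by (cases y)
  show ?case
    unfolding y mon_add_mset twist_x_sum
    by (intro H.subspace_scale H.subspace_sum subspace_supp_in jet_supp_in[OF add]) auto
qed

section \<open>The translation operator\<close>

text \<open>
  The translation operator is the derivation with \<open>x_b^(n) \<mapsto> (n+1) x_b^(n+1)\<close>. The first
  component of the fold is the monomial itself, as needed for the Leibniz rule.
\<close>

definition tstep :: "nat \<times> 'b \<Rightarrow> ('b, 'k::field_char_0) jets \<times> ('b, 'k) jets \<Rightarrow> ('b, 'k) jets \<times> ('b, 'k) jets" where
  "tstep = (\<lambda>(n, b) (F, G). (jet b (- int n - 1) * F,
     jet b (- int n - 1) * G + sc (of_nat (n + 1)) (jet b (- int n - 2) * F)))"

interpretation tstep_comm: comp_fun_commute tstep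
  by unfold_locales (auto simp: tstep_def fun_eq_iff algebra_simps sc_mult)

lemma tstep_simps:
  "fst (tstep (n, b) FG) = jet b (- int n - 1) * fst FG"
  "snd (tstep (n, b) FG) = jet b (- int n - 1) * snd FG + sc (of_nat (n + 1)) (jet b (- int n - 2) * fst FG)"
  by (cases FG; simp add: tstep_def)+

definition jetT :: "('b, 'k::field_char_0) jets \<Rightarrow> ('b, 'k) jets" where
  "jetT = lin_ext sc (\<lambda>M. snd (fold_mset tstep (1, 0) M))"

lemma lin_jetT: "H.lin jetT"
  unfolding jetT_def by (rule H.lin_ext_hom)

lemma jetT_1: "jetT 1 = 0"
  unfolding jetT_def mon_empty[symmetric] H.lin_ext_mono by simp

lemma jetT_x:
  fixes f :: "('b, 'k::field_char_0) jets"
  shows "jetT (jet b i * f) = jet b i * jetT f - sc (of_int i) (jet b (i - 1) * f)"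
proof (cases "i < 0")
  case True
  define n where "n = nat (- i - 1)"
  have i: "i = - int n - 1" using True by (simp add: n_def)
  show ?thesis
  proof (rule jets_lin_eq[of sc "\<lambda>f. jetT (jet b i * f)" "\<lambda>f. jet b i * jetT f - sc (of_int i) (jet b (i - 1) * f)"])
    show "H.lin (\<lambda>f. jetT (jet b i * f))"
      by (rule H.linI) (simp_all add: distrib_left module_hom.add[OF lin_jetT] sc_mult module_hom.scale[OF lin_jetT])
    show "H.lin (\<lambda>f. jet b i * jetT f - sc (of_int i) (jet b (i - 1) * f))"
      by (rule H.linI)
        (simp_all add: algebra_simps module_hom.add[OF lin_jetT] sc_mult module_hom.scale[OF lin_jetT]
          H.scale_right_distrib H.scale_right_diff_distrib)
    fix M
    have fst: "fst (fold_mset tstep (1, 0) M) = (mon M :: ('b, 'k) jets)" for M :: "(nat \<times> 'b) multiset"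
      by (induction M) (auto simp: tstep_simps mon_add_mset)
    have "jetT (jet b i * mon M :: ('b, 'k) jets) = snd (fold_mset tstep (1, 0) (add_mset (n, b) M))"
      unfolding i mon_add_mset[symmetric] by (simp add: jetT_def del: tstep_comm.fold_mset_add_mset)
    also have "\<dots> = jet b i * jetT (mon M) - sc (of_int i) (jet b (i - 1) * mon M)"
      by (simp add: tstep_simps fst jetT_def i H.scale_left_diff_distrib algebra_simps)
    finally show "jetT (jet b i * mon M :: ('b, 'k) jets) = jet b i * jetT (mon M) - sc (of_int i) (jet b (i - 1) * mon M)" .
  qed
next
  case False
  then show ?thesis
    by (cases "i = 0") (simp_all add: jet_nonneg module_hom.zero[OF lin_jetT])
qed

text \<open>
  The factor \<open>(u - w)^\<nu>\<close> is annihilated by \<open>\<partial>/\<partial>u + \<partial>/\<partial>w\<close>, so covariance of \<open>J\<close> is inherited.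
\<close>

lemma twist_covariant:
  assumes J: "\<And>m. jetT (J m) = - sc (of_int m) (J (m - 1))"
  shows "H.covariant jetT (twist \<nu> \<epsilon> J)"
  unfolding H.covariant_def
proof (intro allI)
  note T = module_hom.add[OF lin_jetT] module_hom.scale[OF lin_jetT]
  fix m f
  show "jetT (twist \<nu> \<epsilon> J m f) = twist \<nu> \<epsilon> J m (jetT f) - sc (of_int m) (twist \<nu> \<epsilon> J (m - 1) f)"
  proof (induction f arbitrary: m rule: jets_induct)
    case one
    show ?case by (simp add: J jetT_1 twist_zero)
  next
    case (x b n f)
    let ?i = "- int n - 1" and ?\<theta> = "twist \<nu> \<epsilon> J"
    let ?F = "\<lambda>m i. jet b i * ?\<theta> m f"
    have "jetT (?\<theta> m (jet b ?i * f)) = sc (\<epsilon> b) (H.imul (\<nu> b) (\<lambda>m i. jetT (?F m i)) m ?i)"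
      by (simp add: twist_x T H.imul_map[OF lin_jetT bdd_jet(1)])
    also have "(\<lambda>m i. jetT (?F m i)) = (\<lambda>m i. jet b i * ?\<theta> m (jetT f) + H.mderiv ?F m i)"
      by (auto simp: fun_eq_iff jetT_x x H.mderiv_def algebra_simps sc_mult)
    also have "sc (\<epsilon> b) (H.imul (\<nu> b) \<dots> m ?i) = ?\<theta> m (jet b ?i * jetT f) + sc (\<epsilon> b) (H.mderiv (H.imul (\<nu> b) ?F) m ?i)"
      by (simp add: H.imul_add bdd_jet H.bdd_mderiv H.imul_mderiv twist_x H.scale_right_distrib)
    also have "sc (\<epsilon> b) (H.mderiv (H.imul (\<nu> b) ?F) m ?i)
        = - sc (of_int m) (?\<theta> (m - 1) (jet b ?i * f)) - sc (of_int ?i) (?\<theta> m (jet b (?i - 1) * f))"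
      by (simp only: H.mderiv_def twist_x H.scale_right_diff_distrib H.scale_minus_right H.scale_left_commute)
    also have "?\<theta> m (jet b ?i * jetT f) + \<dots> = ?\<theta> m (jetT (jet b ?i * f)) - sc (of_int m) (?\<theta> (m - 1) (jet b ?i * f))"
      by (simp add: jetT_x module_hom.diff[OF twist_lin] twist_sc)
    finally show ?case .
  qed (simp_all add: T twist_plus twist_sc H.scale_right_distrib H.scale_right_diff_distrib H.scale_left_commute)
qed

section \<open>The vertex algebra on the polynomial ring\<close>

definition par_of :: "('b \<Rightarrow> 'b \<Rightarrow> int) \<Rightarrow> 'b \<Rightarrow> bit" where
  "par_of N b = of_int (N b b)"

text \<open>
  The fields \<open>x_a(u) \<Gamma>_a(u)\<close> with all signs equal to \<open>1\<close> satisfy locality up to the sign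
  \<open>(-1)^(N(a,b) + N(a,a) N(b,b))\<close>. This sign is \<open>1\<close> for \<open>a = b\<close>, and for \<open>a \<noteq> b\<close> it is corrected
  by inserting it on one side of the diagonal, which is chosen with the help of the order on the
  colors.
\<close>

definition eps :: "('b::linorder \<Rightarrow> 'b \<Rightarrow> int) \<Rightarrow> 'b \<Rightarrow> 'b \<Rightarrow> 'k::field_char_0" where
  "eps N a b = (if a \<le> b then 1 else koszul (par_of N a) (par_of N b) * (- 1) powi N a b)"

lemma of_int_bit: "(of_int n :: bit) = (if even n then 0 else 1)"
proof -
  have "(of_int (2 * k) :: bit) = 0" for k by simp
  moreover have "(of_int (2 * k + 1) :: bit) = 1" for k by simp
  ultimately show ?thesis by (metis evenE oddE)
qed

lemma m1_powi: "((- 1) powi n :: 'k::field) = (if even n then 1 else - 1)"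
  by (cases "0 \<le> n") (auto simp: power_int_def minus_one_power_iff even_nat_iff)

lemma koszul_powi_diag: "koszul (par_of N a) (par_of N a) * (- 1) powi N a a = (1 :: 'k::field_char_0)"
  by (simp add: par_of_def of_int_bit koszul_def m1_powi)

lemma eps_sq: "eps N a b * eps N a b = 1"
  by (auto simp: eps_def koszul_def m1_powi)

lemma eps_flip:
  assumes "N a b = N b a"
  shows "(eps N a b :: 'k::field_char_0) = koszul (par_of N a) (par_of N b) * (- 1) powi N a b * eps N b a"
proof (cases "a = b")
  case True
  then show ?thesis using koszul_powi_diag[of N a, where 'k='k] by (simp add: eps_def)
next
  case False
  then show ?thesis
    using assms by (auto simp: eps_def koszul_sym[of "par_of N a"]) (auto simp: koszul_def m1_powi)
qed

text \<open>
  The vertex operator \<open>a(u)\<close> on the polynomial ring, the operator \<open>\<Gamma>_a(u)^(-1)\<close>, and \<open>\<Gamma>_a(u)\<close>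
  itself.
\<close>

definition vop :: "('b::linorder \<Rightarrow> 'b \<Rightarrow> int) \<Rightarrow> 'b \<Rightarrow> int \<Rightarrow> ('b, 'k::field_char_0) jets \<Rightarrow> ('b, 'k) jets" where
  "vop N a = twist (\<lambda>b. - N a b) (eps N a) (jet a)"

definition untwist :: "('b::linorder \<Rightarrow> 'b \<Rightarrow> int) \<Rightarrow> 'b \<Rightarrow> int \<Rightarrow> ('b, 'k::field_char_0) jets \<Rightarrow> ('b, 'k) jets" where
  "untwist N a = twist (N a) (eps N a) unit_ser"

definition retwist :: "('b::linorder \<Rightarrow> 'b \<Rightarrow> int) \<Rightarrow> 'b \<Rightarrow> int \<Rightarrow> ('b, 'k::field_char_0) jets \<Rightarrow> ('b, 'k) jets" where
  "retwist N a = twist (\<lambda>b. - N a b) (eps N a) unit_ser"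

lemma jet_conv: "H.conv (vop N a) (\<lambda>j. untwist N a j f) m = jet a m * f"
  unfolding vop_def untwist_def by (subst conv_twist) (simp add: twist_trivial eps_sq)

lemma vop_conv:
  fixes f :: "('b::linorder, 'k::field_char_0) jets"
  shows "H.conv (\<lambda>m f. jet a m * f) (\<lambda>j. retwist N a j f) m = vop N a m f"
proof -
  have *: "(\<lambda>m f :: ('b, 'k) jets. jet a m * f) = twist (\<lambda>b. 0) (\<lambda>b. 1) (jet a)"
    by (simp add: fun_eq_iff twist_trivial)
  show ?thesis unfolding vop_def retwist_def * by (simp add: conv_twist)
qed

lemma untwist_retwist_conv: "H.conv (untwist N a) (\<lambda>j. retwist N a j f) m = unit_ser m * f"
  unfolding retwist_def untwist_def by (subst conv_twist) (simp add: twist_trivial eps_sq)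

lemma vop_1: "vop N a m 1 = jet a m"
  by (simp add: vop_def)

lemma vop_fld: "H.fld (vop N a)"
  unfolding vop_def by (rule twist_fld[of 0]) (simp add: jet_nonneg)

lemma vop_covariant: "H.covariant jetT (vop N a)"
  unfolding vop_def
proof (rule twist_covariant)
  show "jetT (jet a m) = - sc (of_int m) (jet a (m - 1))" for m
    using jetT_x[of a m 1] by (simp add: jetT_1)
qed

lemma vop_colors:
  assumes "f \<in> supp_in (\<lambda>M. colors M = \<kappa>)"
  shows "vop N a m f \<in> supp_in (\<lambda>M. colors M = add_mset a \<kappa>)"
proof -
  have "jet a m \<in> supp_in (\<lambda>M. colors M = {#a#})" for m
    using jet_supp_in[OF mon_supp_in[of "\<lambda>M. M = {#}" "{#}"], of m "\<lambda>M. colors M = {#a#}" a] by simp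
  from twist_colors[OF this assms] show ?thesis by (simp add: vop_def)
qed

lemma twist_twist_x:
  "twist \<nu> \<epsilon> J m (twist \<nu>' \<epsilon>' J' n (jet b i * f)) = sc (\<epsilon>' b * \<epsilon> b)
     (H.imul (\<nu>' b) (\<lambda>n i. H.imul (\<nu> b) (\<lambda>m i. jet b i * twist \<nu> \<epsilon> J m (twist \<nu>' \<epsilon>' J' n f)) m i) n i)"
  by (simp add: twist_x[of \<nu>'] twist_sc H.imul_map[OF twist_lin bdd_jet(1), symmetric])
    (simp add: twist_x H.imul_scale)

text \<open>
  Both \<open>a(w) b(z)\<close> and \<open>b(z) a(w)\<close> move past \<open>x_c(t)\<close> with the same factors, so the commutator
  has to be computed only on \<open>1\<close>. There \<open>a(w) b(z) 1\<close> and \<open>b(z) a(w) 1\<close> are expansions of the same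
  \<open>\<plusminus> (w - z)^(-N(a,b)) x_a(w) x_b(z)\<close>, and the power \<open>\<bar>N(a,b)\<bar>\<close> of \<open>w - z\<close> makes it a polynomial
  multiple of a power series.
\<close>

lemma vop_loc:
  assumes N: "N a b = N b a"
  shows "H.loc (nat \<bar>N a b\<bar>) (koszul (par_of N a) (par_of N b)) (vop N a) (vop N b :: int \<Rightarrow> ('b::linorder, 'k::field_char_0) jets \<Rightarrow> _)"
  unfolding H.loc_def
proof
  let ?L = "nat \<bar>N a b\<bar>" and ?s = "koszul (par_of N a) (par_of N b) :: 'k"
  fix f :: "('b, 'k) jets"
  note lin = module_hom.add[OF twist_lin] module_hom.scale[OF twist_lin]
  show "(Delta ^^ ?L) (H.supercomm ?s (vop N a) (vop N b) f) = (\<lambda>m n. 0)"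
  proof (induction f rule: jets_induct)
    case one
    define d where "d = nat (int ?L - N a b)"
    have d: "int d = int ?L - N a b" by (simp add: d_def)
    define Z :: "int \<Rightarrow> int \<Rightarrow> ('b, 'k) jets" where "Z m n = jet b n * jet a m" for m n
    define Zt :: "int \<Rightarrow> int \<Rightarrow> ('b, 'k) jets" where "Zt n m = jet a m * jet b n" for m n
    have bdd: "bdd Z" "bdd Zt" unfolding Z_def[abs_def] Zt_def[abs_def] by (rule bdd_jet)+
    have ab: "vop N a m (jet b n) = sc (eps N a b) (H.imul (- N a b) Z m n)" for m n
      using twist_x[of "\<lambda>b. - N a b" "eps N a" "jet a" m b n 1] by (simp add: vop_def Z_def[abs_def])
    have ba: "vop N b n (jet a m) = sc (eps N b a) (H.imul (- N a b) Zt n m)" for m n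
      using twist_x[of "\<lambda>a. - N b a" "eps N b" "jet b" n a m 1] by (simp add: vop_def Zt_def[abs_def] N)
    have D: "(Delta ^^ ?L) (H.imul (- N a b) Z) = (Delta ^^ d) Z" "(Delta ^^ ?L) (H.imul (- N a b) Zt) = (Delta ^^ d) Zt"
    proof -
      have "int ?L + - N a b = int d" using d by linarith
      then show "(Delta ^^ ?L) (H.imul (- N a b) Z) = (Delta ^^ d) Z" "(Delta ^^ ?L) (H.imul (- N a b) Zt) = (Delta ^^ d) Zt"
        by (simp_all only: H.Delta_funpow_imul bdd H.imul_nat_Delta)
    qed
    have tr: "(Delta ^^ d) Zt n m = sc ((- 1) ^ d) ((Delta ^^ d) Z m n)" for m n
    proof -
      have "Zt = (\<lambda>m n. Z n m)" by (simp add: fun_eq_iff Z_def Zt_def mult.commute)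
      then show ?thesis using H.Delta_pow_transpose[of d Z n m] by (simp only:)
    qed
    have "(- 1) ^ ?L * (- 1) ^ d = ((- 1) powi N a b :: 'k)"
    proof -
      have "even (?L + d) = even (int ?L + int d)" by simp
      also have "\<dots> = even (N a b)" unfolding d by auto
      finally show ?thesis
        by (cases "even ?L"; cases "even d"; cases "even (N a b)") (simp_all add: minus_one_power_iff m1_powi)
    qed
    moreover have "(Delta ^^ ?L) (H.supercomm ?s (vop N a) (vop N b) 1) m n = sc (eps N a b - ?s * ((- 1) ^ ?L * (- 1) ^ d) * eps N b a) ((Delta ^^ d) Z m n)" for m n
      unfolding H.supercomm_def[abs_def] vop_1 ab ba Delta_funpow_diff H.Delta_pow_scale D
        H.Delta_pow_transpose[of ?L "H.imul (- N a b) Zt"] tr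
      by (simp add: H.scale_left_diff_distrib algebra_simps)
    moreover have "eps N a b = ?s * (- 1) powi N a b * eps N b a" by (rule eps_flip) (rule N)
    ultimately show ?case by (auto simp: fun_eq_iff)
  next
    case (x c k f)
    let ?i = "- int k - 1"
    define \<Phi> where "\<Phi> F = (\<lambda>m n. H.imul (- N b c) (\<lambda>n i. H.imul (- N a c) (\<lambda>m i. jet c i * F m n) m i) n ?i)" for F :: "int \<Rightarrow> int \<Rightarrow> ('b, 'k) jets"
    have bdd: "bdd (\<lambda>n i. H.imul (- N a c) (\<lambda>m i. jet c i * F m n) m i)" for m and F :: "int \<Rightarrow> int \<Rightarrow> ('b, 'k) jets"
      by (rule bddI[of 0], subst H.imul_sum[where K = 0]) (auto simp: jet_nonneg)
    have \<Phi>_diff: "\<Phi> (\<lambda>m n. F m n - G m n) = (\<lambda>m n. \<Phi> F m n - \<Phi> G m n)" for F G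
      by (simp add: \<Phi>_def right_diff_distrib H.imul_diff bdd_jet bdd fun_eq_iff)
    have \<Phi>_sc: "\<Phi> (\<lambda>m n. sc c (F m n)) = (\<lambda>m n. sc c (\<Phi> F m n))" for c F
      by (simp add: \<Phi>_def sc_mult H.imul_scale fun_eq_iff)
    have \<Phi>_1: "\<Phi> (\<lambda>m n. F (m + 1) n) = (\<lambda>m n. \<Phi> F (m + 1) n)" for F
    proof -
      have "H.imul (- N a c) (\<lambda>m i. jet c i * F (m + 1) n) m i = H.imul (- N a c) (\<lambda>m i. jet c i * F m n) (m + 1) i" for m n i
        using H.imul_shift[of "- N a c" "\<lambda>m i. jet c i * F m n" 1 0 m i] by simp
      then show ?thesis by (simp add: \<Phi>_def)
    qed
    have \<Phi>_2: "\<Phi> (\<lambda>m n. F m (n + 1)) = (\<lambda>m n. \<Phi> F m (n + 1))" for F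
      unfolding \<Phi>_def
      using H.imul_shift[of "- N b c" "\<lambda>n i. H.imul (- N a c) (\<lambda>m i. jet c i * F m n) m i" 1 0 n ?i for m n]
      by (simp add: fun_eq_iff)
    have "Delta (\<Phi> F) = \<Phi> (Delta F)" for F
      unfolding Delta_def[abs_def] \<Phi>_diff \<Phi>_1 \<Phi>_2 ..
    then have \<Phi>_Delta: "(Delta ^^ j) (\<Phi> F) = \<Phi> ((Delta ^^ j) F)" for j F
      by (induction j) auto
    have A: "vop N a m (vop N b n (jet c ?i * f)) = sc (eps N b c * eps N a c) (\<Phi> (\<lambda>m n. vop N a m (vop N b n f)) m n)" for m n
      unfolding vop_def twist_twist_x \<Phi>_def ..
    have B: "vop N b n (vop N a m (jet c ?i * f)) = sc (eps N b c * eps N a c) (\<Phi> (\<lambda>m n. vop N b n (vop N a m f)) m n)" for m n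
      unfolding vop_def twist_twist_x \<Phi>_def
      by (subst H.mi13_mi23[where ?n0.0 = 0]) (auto simp: jet_nonneg mult.commute)
    have "H.supercomm ?s (vop N a) (vop N b) (jet c ?i * f) = (\<lambda>m n. sc (eps N b c * eps N a c) (\<Phi> (H.supercomm ?s (vop N a) (vop N b) f) m n))"
      unfolding H.supercomm_def[abs_def] A B \<Phi>_diff \<Phi>_sc
      by (simp add: fun_eq_iff H.scale_right_diff_distrib mult.commute)
    then have "(Delta ^^ ?L) (H.supercomm ?s (vop N a) (vop N b) (jet c ?i * f))
        = (\<lambda>m n. sc (eps N b c * eps N a c) (\<Phi> (\<lambda>m n. 0) m n))"
      by (simp only: H.Delta_pow_scale \<Phi>_Delta x)
    then show ?case by (simp add: \<Phi>_def)
  next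
    case (add f g)
    have "H.supercomm ?s (vop N a) (vop N b) (f + g) = (\<lambda>m n. H.supercomm ?s (vop N a) (vop N b) f m n + H.supercomm ?s (vop N a) (vop N b) g m n)"
      by (auto simp: H.supercomm_def vop_def lin fun_eq_iff H.scale_right_distrib)
    then show ?case by (simp add: Delta_funpow_add add)
  next
    case (sc c f)
    have "H.supercomm ?s (vop N a) (vop N b) (sc c f) = (\<lambda>m n. sc c (H.supercomm ?s (vop N a) (vop N b) f m n))"
      by (auto simp: H.supercomm_def vop_def lin fun_eq_iff H.scale_right_diff_distrib H.scale_left_commute)
    then show ?case by (simp add: H.Delta_pow_scale sc)
  qed
qed

lemma untwist_colors: "untwist N a j (mon M) \<in> supp_in (\<lambda>M'. colors M' = colors M)"
  unfolding untwist_def by (rule supp_in_mono[OF twist_energy]) simp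

lemma untwist_finite: "finite {j. untwist N a j f \<noteq> 0}"
  unfolding untwist_def by (rule twist_unit_ser_finite)

lemma retwist_finite: "finite {j. retwist N a j f \<noteq> 0}"
  unfolding retwist_def by (rule twist_unit_ser_finite)

text \<open>
  The monomials are obtained from \<open>1\<close> by the operators \<open>a(u)\<close>, since
  \<open>x_a(u) M = a(u) \<Gamma>_a(u)^(-1) M\<close> and \<open>\<Gamma>_a(u)^(-1) M\<close> is a combination of monomials with the
  colors of \<open>M\<close>. The family \<open>S\<close> is indexed by colors so that parity or membership in a set of
  colors can be built into it.
\<close>

lemma mon_by_words:
  fixes S :: "'b multiset \<Rightarrow> ('b::linorder, 'k::field_char_0) jets set"
  assumes sub: "\<And>\<mu>. H.subspace (S \<mu>)" and one: "1 \<in> S {#}"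
    and app: "\<And>b n f \<mu>. b \<in> B \<Longrightarrow> set_mset \<mu> \<subseteq> B \<Longrightarrow> f \<in> S \<mu> \<Longrightarrow> vop N b n f \<in> S (add_mset b \<mu>)"
    and M: "set_mset (colors M) \<subseteq> B"
  shows "mon M \<in> S (colors M)"
  using M
proof (induction "size M" arbitrary: M)
  case 0
  then show ?case by (simp add: one)
next
  case (Suc k)
  then obtain y M' where M': "M = add_mset y M'" by (metis size_eq_Suc_imp_eq_union add_mset_add_single)
  obtain n b where y: "y = (n, b)" by (cases y)
  have k: "size M' = k" "set_mset (colors M') \<subseteq> B" "b \<in> B" using Suc.prems Suc.hyps(2) by (auto simp: M' y)
  have G: "untwist N b j (mon M') \<in> S (colors M')" for j
  proof (rule supp_in_subset[OF untwist_colors sub])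
    fix M'' assume c: "colors M'' = colors M'"
    have "size M'' = k" using c k(1) by (metis size_colors)
    from Suc.hyps(1)[OF this[symmetric]] show "mon M'' \<in> S (colors M')" using c k(2) by simp
  qed
  have "(mon M :: ('b, 'k) jets) = H.conv (vop N b) (\<lambda>j. untwist N b j (mon M')) (- int n - 1)"
    by (simp add: M' y mon_add_mset jet_conv)
  also have "\<dots> = (\<Sum>j\<in>{j. untwist N b j (mon M' :: ('b, 'k) jets) \<noteq> 0}. vop N b (- int n - 1 - 1 - j) (untwist N b j (mon M')))"
    by (rule H.conv_eq) (auto simp: vop_def twist_lin untwist_finite)
  also have "\<dots> \<in> S (add_mset b (colors M'))"
    by (intro H.subspace_sum sub app k G)
  finally show ?case by (simp add: M' y)
qed

definition jet_part :: "('b \<Rightarrow> 'b \<Rightarrow> int) \<Rightarrow> bit \<Rightarrow> ('b, 'k::field_char_0) jets set" where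
  "jet_part N i = supp_in (\<lambda>M. (\<Sum>b\<in>#colors M. par_of N b) = i)"

locale sym_form =
  fixes N :: "'b::linorder \<Rightarrow> 'b \<Rightarrow> int" and dummy :: "'k::field_char_0 itself"
  assumes N_sym: "N a b = N b a"
begin

sublocale W: vacuum_fields "sc :: 'k \<Rightarrow> ('b, 'k) jets \<Rightarrow> ('b, 'k) jets" "jet_part N" 1 jetT "vop N" "par_of N"
proof (intro vacuum_fields.intro vacuum_fields_axioms.intro)
  show "char0_space (sc :: 'k \<Rightarrow> ('b, 'k) jets \<Rightarrow> ('b, 'k) jets)" by (rule H.char0_space_axioms)
  show "H.subspace (jet_part N i :: ('b, 'k) jets set)" for i unfolding jet_part_def by (rule subspace_supp_in)
  show "\<exists>y z. x = y + z \<and> y \<in> jet_part N 0 \<and> z \<in> jet_part N 1" for x :: "('b, 'k) jets"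
  proof -
    let ?S = "{x :: ('b, 'k) jets. \<exists>y z. x = y + z \<and> y \<in> jet_part N 0 \<and> z \<in> jet_part N 1}"
    have "?S = {y + z |y z. y \<in> jet_part N 0 \<and> z \<in> jet_part N 1}" by blast
    then have sub: "H.subspace ?S"
      using H.subspace_sums[of "jet_part N 0" "jet_part N 1"] by (simp add: jet_part_def subspace_supp_in)
    have "mon M \<in> ?S" for M
    proof (cases "(\<Sum>b\<in>#colors M. par_of N b)")
      case zero
      then have "mon M \<in> jet_part N 0" by (auto simp: jet_part_def intro: mon_supp_in)
      moreover have "0 \<in> jet_part N 1" unfolding jet_part_def by (rule H.subspace_0[OF subspace_supp_in])
      ultimately show ?thesis by (intro CollectI exI[of _ "mon M"] exI[of _ 0]) simp
    next
      case one
      then have "mon M \<in> jet_part N 1" by (auto simp: jet_part_def intro: mon_supp_in)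
      moreover have "0 \<in> jet_part N 0" unfolding jet_part_def by (rule H.subspace_0[OF subspace_supp_in])
      ultimately show ?thesis by (intro CollectI exI[of _ 0] exI[of _ "mon M"]) simp
    qed
    then have "x \<in> ?S" by (rule subspace_monoI[OF sub])
    then show ?thesis by blast
  qed
  show "jet_part N 0 \<inter> jet_part N 1 = {0 :: ('b, 'k) jets}"
  proof -
    have "f = 0" if "f \<in> jet_part N 0" "f \<in> jet_part N 1" for f :: "('b, 'k) jets"
    proof (rule ccontr)
      assume "f \<noteq> 0"
      then obtain M where "M \<in> Poly_Mapping.keys f" by (metis keys_eq_empty ex_in_conv)
      then show False using that by (auto simp: jet_part_def supp_in_def)
    qed
    moreover have "(0 :: ('b, 'k) jets) \<in> jet_part N i" for i
      unfolding jet_part_def by (rule H.subspace_0[OF subspace_supp_in])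
    ultimately show ?thesis by blast
  qed
  show "(1 :: ('b, 'k) jets) \<in> jet_part N 0" unfolding jet_part_def mon_empty[symmetric] by (rule mon_supp_in) simp
  show "H.lin (jetT :: ('b, 'k) jets \<Rightarrow> _)" by (rule lin_jetT)
  show "jetT (1 :: ('b, 'k) jets) = 0" by (rule jetT_1)
  show "H.fld (vop N b :: _ \<Rightarrow> ('b, 'k) jets \<Rightarrow> _)" for b by (rule vop_fld)
  show "vop N b n (1 :: ('b, 'k) jets) = 0" if "0 \<le> n" for b n using that by (simp add: vop_1 jet_nonneg)
  show "H.covariant jetT (vop N b :: _ \<Rightarrow> ('b, 'k) jets \<Rightarrow> _)" for b by (rule vop_covariant)
  show "vop N b n f \<in> jet_part N (par_of N b + i)" if "f \<in> jet_part N i" for f :: "('b, 'k) jets" and i b n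
  proof -
    have "f \<in> {f. vop N b n f \<in> jet_part N (par_of N b + i)}"
    proof (rule supp_in_subset)
      show "f \<in> supp_in (\<lambda>M. (\<Sum>b\<in>#colors M. par_of N b) = i)" using that by (simp add: jet_part_def)
      show "H.subspace {f. vop N b n f \<in> jet_part N (par_of N b + i)}"
        unfolding jet_part_def vop_def
        by (rule H.subspaceI)
          (auto simp: twist_plus twist_sc twist_zero intro: H.subspace_add H.subspace_scale H.subspace_0 subspace_supp_in
            simp del: add_bit_eq_xor)
      show "mon M \<in> {f. vop N b n f \<in> jet_part N (par_of N b + i)}" if "(\<Sum>b\<in>#colors M. par_of N b) = i" for M
      proof -
        have "vop N b n (mon M) \<in> supp_in (\<lambda>M'. colors M' = add_mset b (colors M))"
          by (rule vop_colors[OF mon_supp_in]) simp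
        then have "vop N b n (mon M) \<in> jet_part N (par_of N b + i)"
          unfolding jet_part_def by (rule supp_in_mono) (simp add: that del: add_bit_eq_xor)
        then show ?thesis by simp
      qed
    qed
    then show ?thesis by simp
  qed
  show "\<exists>K. H.loc K (koszul (par_of N b) (par_of N b')) (vop N b) (vop N b' :: _ \<Rightarrow> ('b, 'k) jets \<Rightarrow> _)" for b b'
    using vop_loc[of N b b', OF N_sym[of b b']] by blast
  show "x \<in> H.span {w. words 1 (vop N) (par_of N) i w}" if "x \<in> jet_part N i" for x :: "('b, 'k) jets" and i
  proof (rule supp_in_subset)
    show "x \<in> supp_in (\<lambda>M. (\<Sum>b\<in>#colors M. par_of N b) = i)" using that by (simp add: jet_part_def)
    show "H.subspace (H.span {w. words 1 (vop N) (par_of N) i w})" by (rule H.subspace_span)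
    let ?S = "\<lambda>\<mu>. H.span {w :: ('b, 'k) jets. words 1 (vop N) (par_of N) (\<Sum>b\<in>#\<mu>. par_of N b) w}"
    have app: "vop N b n f \<in> ?S (add_mset b \<mu>)" if "f \<in> ?S \<mu>" for b n f \<mu>
    proof -
      have "?S \<mu> \<subseteq> {f. vop N b n f \<in> ?S (add_mset b \<mu>)}"
      proof (rule H.span_minimal)
        show "H.subspace {f. vop N b n f \<in> ?S (add_mset b \<mu>)}"
          unfolding vop_def
          by (rule H.subspaceI)
            (auto simp: twist_plus twist_sc twist_zero intro: H.span_add H.span_scale H.span_zero)
        show "{w. words 1 (vop N) (par_of N) (\<Sum>b\<in>#\<mu>. par_of N b) w} \<subseteq> {f. vop N b n f \<in> ?S (add_mset b \<mu>)}"
          by (auto intro!: H.span_base words_app simp del: add_bit_eq_xor)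
      qed
      then show ?thesis using that by blast
    qed
    show "mon M \<in> H.span {w :: ('b, 'k) jets. words 1 (vop N) (par_of N) i w}"
      if "(\<Sum>b\<in>#colors M. par_of N b) = i" for M
    proof -
      have "mon M \<in> ?S (colors M)"
      proof (rule mon_by_words[where B = UNIV and N = N and S = ?S])
        show "1 \<in> ?S {#}" by (simp add: H.span_base words_vac)
        show "vop N b n f \<in> ?S (add_mset b \<mu>)" if "f \<in> ?S \<mu>" for b n f \<mu>
          using that by (rule app)
      qed (rule H.subspace_span subset_UNIV)+
      then show ?thesis by (simp only: that)
    qed
  qed
qed

lemma W_gens: "bounded_gens W.state_va B N (\<lambda>b. jet b (- 1) :: ('b, 'k) jets)"
  unfolding bounded_gens_def
proof (intro conjI ballI allI impI)
  fix a assume "a \<in> B"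
  have "mon {#(0, a)#} \<in> jet_part N (of_int (N a a))"
    unfolding jet_part_def by (rule mon_supp_in) (simp add: par_of_def)
  then show "jet a (- 1) \<in> part W.state_va (of_int (N a a))"
    by (simp add: W.state_va_def jet_def)
next
  fix a b n assume n: "N a b \<le> n"
  have "nprod W.state_va n (jet a (- 1)) (jet b (- 1)) = vop N a n (jet b (- 1))"
    using W.nprod_state_va_a[of n a] by (simp add: vop_1)
  also have "\<dots> = 0"
    using twist_x_sum[of "\<lambda>b. - N a b" "eps N a" "jet a" n b 0 1] n by (simp add: vop_def jet_nonneg)
  finally show "nprod W.state_va n (jet a (- 1)) (jet b (- 1)) = 0" .
qed

lemma nprod_W: "nprod W.state_va n (jet b (- 1)) = vop N b n"
  using W.nprod_state_va_a[of n b] by (simp add: vop_1)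

end

section \<open>Mapping the polynomial ring to a space with local fields\<close>

context char0_space begin

lemma imul_hom:
  assumes "module_hom sc scale L" "bdd F"
  shows "imul \<nu> (\<lambda>m n. L (F m n)) m n = L (H.imul \<nu> F m n)"
proof -
  interpret L: module_hom sc scale L by fact
  obtain a where a: "\<And>m n. a \<le> n \<Longrightarrow> F m n = 0" using assms(2) by (metis bdd_pw)
  define K where "K = nat (a - n)"
  have K: "a \<le> n + int K" by (simp add: K_def)
  have "imul \<nu> (\<lambda>m n. L (F m n)) m n = (\<Sum>k<K. sbinom \<nu> k *s L (F (m + \<nu> - int k) (n + int k)))"
    by (rule imul_sum) (use K in \<open>simp add: a L.zero\<close>)
  moreover have "H.imul \<nu> F m n = (\<Sum>k<K. sc (sbinom \<nu> k) (F (m + \<nu> - int k) (n + int k)))"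
    by (rule H.imul_sum) (use K in \<open>simp add: a\<close>)
  ultimately show ?thesis by (simp add: L.sum L.scale)
qed

end

text \<open>
  A space with a vacuum vector and fields that are local of the exact orders \<open>N\<close>.
\<close>

locale local_module = char0_space scale
  for scale :: "'k::field_char_0 \<Rightarrow> 'v::ab_group_add \<Rightarrow> 'v" (infixr "*s" 75) +
  fixes v :: 'v and Y :: "'b::linorder \<Rightarrow> int \<Rightarrow> 'v \<Rightarrow> 'v" and N :: "'b \<Rightarrow> 'b \<Rightarrow> int"
  assumes N_sym: "N a b = N b a"
    and Y_fld: "fld (Y b)"
    and Y_vac: "0 \<le> n \<Longrightarrow> Y b n v = 0"
    and Y_loc: "tcomm (N a b) (koszul (par_of N a) (par_of N b)) (Y a) (Y b) c m n = 0"
begin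

lemmas Y_lin = fld_lin[OF Y_fld]

text \<open>
  The map \<open>g\<close> is to satisfy \<open>g(x_a(u) f) = Y_a(u) g(\<Gamma>_a(u)^(-1) f)\<close>. This is used as a recursion on
  the size of a monomial, with an arbitrary choice of the variable that is split off;
  \<open>R_sym\<close> shows that the choice does not matter. Note that \<open>\<Gamma>_a(u)^(-1)\<close> preserves sizes.
\<close>

primrec gk :: "nat \<Rightarrow> (nat \<times> 'b) multiset \<Rightarrow> 'v" where
  "gk 0 M = v"
| "gk (Suc k) M = (let y = SOME y. y \<in># M in
     conv (Y (snd y)) (\<lambda>j. lin_ext scale (gk k) (untwist N (snd y) j (mon (M - {#y#})))) (- int (fst y) - 1))"

definition g :: "('b, 'k) jets \<Rightarrow> 'v" where
  "g = lin_ext scale (\<lambda>M. gk (size M) M)"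

lemma g_hom: "module_hom sc scale g"
  unfolding g_def by (rule lin_ext_hom)

sublocale g: module_hom sc scale g by (rule g_hom)

text \<open>
  The modes of \<open>Y_a(u) g(\<Gamma>_a(u)^(-1) f)\<close>.
\<close>

definition R :: "'b \<Rightarrow> int \<Rightarrow> ('b, 'k) jets \<Rightarrow> 'v" where
  "R a m f = conv (Y a) (\<lambda>j. g (untwist N a j f)) m"

lemma R_eq:
  assumes "finite S" "\<And>j. j \<notin> S \<Longrightarrow> untwist N a j f = 0"
  shows "R a m f = (\<Sum>j\<in>S. Y a (m - 1 - j) (g (untwist N a j f)))"
  unfolding R_def by (rule conv_eq[OF Y_lin assms(1)]) (simp add: assms(2) g.zero)

lemma R_zero: "R a m 0 = 0"
  using R_eq[of "{}" a 0] by (simp add: untwist_def twist_zero)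

lemma R_add: "R a m (f + f') = R a m f + R a m f'"
proof -
  let ?S = "{j. untwist N a j f \<noteq> 0} \<union> {j. untwist N a j f' \<noteq> 0}"
  have S: "finite ?S" by (simp add: untwist_finite)
  have p: "untwist N a j (f + f') = untwist N a j f + untwist N a j f'" for j by (simp add: untwist_def twist_plus)
  show ?thesis
    by (subst (1 2 3) R_eq[OF S]) (auto simp: p g.add fld_add[OF Y_fld] sum.distrib)
qed

lemma R_sc: "R a m (sc c f) = c *s R a m f"
proof -
  let ?S = "{j. untwist N a j f \<noteq> 0}"
  have S: "finite ?S" by (simp add: untwist_finite)
  have p: "untwist N a j (sc c f) = sc c (untwist N a j f)" for j by (simp add: untwist_def twist_sc)
  show ?thesis
    by (subst (1 2) R_eq[OF S]) (auto simp: p g.scale fld_scale[OF Y_fld] scale_sum_right)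
qed

lemma sub_D1: "H.subspace {f. \<forall>a m. g (jet a m * f) = R a m f}"
  by (rule H.subspaceI) (auto simp: R_zero R_add R_sc g.zero distrib_left g.add sc_mult g.scale)

lemma untwist_size: "untwist N a j (mon M) \<in> supp_in (\<lambda>M'. size M' = size M)"
  by (rule supp_in_mono[OF untwist_colors]) (metis size_colors)

lemma untwist_untwist: "untwist N a j (untwist N b i f) = untwist N b i (untwist N a j f)"
  unfolding untwist_def by (rule twist_commute)

text \<open>
  The formula
  \<open>R_a(u) (x_b(w) f) = \<epsilon> (u - w)^(N(a,b)) Y_a(u) Y_b(w) g(\<Gamma>_b(w)^(-1) \<Gamma>_a(u)^(-1) f)\<close>, under the hypothesis
  that \<open>g(x_b(w) f') = R_b(w) f'\<close> is known for the coefficients \<open>f'\<close> of \<open>\<Gamma>_a(u)^(-1) f\<close>.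
\<close>

lemma R_x:
  assumes D1: "\<And>j n. g (jet b n * untwist N a j f) = R b n (untwist N a j f)"
  shows "R a m (jet b n * f) = eps N a b *s (\<Sum>j\<in>{j. untwist N a j f \<noteq> 0}. \<Sum>i\<in>{i. untwist N b i f \<noteq> 0}.
     imul (N a b) (\<lambda>m n. Y a m (Y b n (g (untwist N b i (untwist N a j f))))) (m - 1 - j) (n - 1 - i))"
proof -
  let ?S = "{j. untwist N a j f \<noteq> 0}" and ?S' = "{i. untwist N b i f \<noteq> 0}"
  let ?c = "\<lambda>i j. g (untwist N b i (untwist N a j f))"
  have S: "finite ?S" "finite ?S'" by (simp_all add: untwist_finite)
  have S'0: "untwist N b i (untwist N a j f) = 0" if "i \<notin> ?S'" for i j
    using that by (subst untwist_untwist) (simp add: untwist_def twist_zero)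
  have "g (untwist N a j (jet b n * f)) = imul (N a b) (\<lambda>j n. eps N a b *s g (jet b n * untwist N a j f)) j n" for j n
  proof -
    have "g (untwist N a j (jet b n * f)) = eps N a b *s g (H.imul (N a b) (\<lambda>j n. jet b n * untwist N a j f) j n)"
      by (simp add: untwist_def twist_x g.scale)
    then show ?thesis by (simp add: imul_scale imul_hom[OF g_hom bdd_jet(1)])
  qed
  then have "R a m (jet b n * f) = conv (Y a) (\<lambda>j. imul (N a b) (\<lambda>j n. eps N a b *s g (jet b n * untwist N a j f)) j n) m"
    by (simp add: R_def)
  also have "\<dots> = imul (N a b) (\<lambda>m n. conv (Y a) (\<lambda>j. eps N a b *s g (jet b n * untwist N a j f)) m) m n"
    by (rule conv_imul[where S = ?S and ?i0.0 = 0]) (auto simp: Y_lin S jet_nonneg g.zero)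
  also have "(\<lambda>m n. conv (Y a) (\<lambda>j. eps N a b *s g (jet b n * untwist N a j f)) m)
     = (\<lambda>m n. \<Sum>j\<in>?S. \<Sum>i\<in>?S'. eps N a b *s Y a (m - 1 - j) (Y b (n - 1 - i) (?c i j)))"
  proof (intro ext)
    fix m n
    have R: "R b n (untwist N a j f) = (\<Sum>i\<in>?S'. Y b (n - 1 - i) (?c i j))" for j
      by (rule R_eq[OF S(2) S'0])
    show "conv (Y a) (\<lambda>j. eps N a b *s g (jet b n * untwist N a j f)) m
      = (\<Sum>j\<in>?S. \<Sum>i\<in>?S'. eps N a b *s Y a (m - 1 - j) (Y b (n - 1 - i) (?c i j)))"
      by (subst conv_eq[OF Y_lin S(1)])
        (auto simp: D1 R R_zero g.zero module_hom.sum[OF Y_lin] module_hom.scale[OF Y_lin] scale_sum_right)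
  qed
  also have "imul (N a b) (\<lambda>m n. \<Sum>j\<in>?S. \<Sum>i\<in>?S'. eps N a b *s Y a (m - 1 - j) (Y b (n - 1 - i) (?c i j))) m n
      = (\<Sum>j\<in>?S. \<Sum>i\<in>?S'. imul (N a b) (\<lambda>m n. eps N a b *s Y a (m - 1 - j) (Y b (n - 1 - i) (?c i j))) m n)"
  proof -
    have bdd: "bdd (\<lambda>m n. eps N a b *s Y a (m - 1 - j) (Y b (n - 1 - i) c))" for i j c
      using bdd_map[OF bdd_shift[OF bdd_fld[OF Y_fld Y_fld, of a b c], of "- 1 - j" "- 1 - i"], of "scale (eps N a b)"]
      by (simp add: algebra_simps)
    show ?thesis
      by (subst imul_sumf[OF S(1)]) (simp_all add: bdd_sum S bdd imul_sumf)
  qed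
  also have "\<dots> = (\<Sum>j\<in>?S. \<Sum>i\<in>?S'. eps N a b *s imul (N a b) (\<lambda>m n. Y a m (Y b n (?c i j))) (m - 1 - j) (n - 1 - i))"
  proof (intro sum.cong refl)
    fix i j
    show "imul (N a b) (\<lambda>m n. eps N a b *s Y a (m - 1 - j) (Y b (n - 1 - i) (?c i j))) m n
      = eps N a b *s imul (N a b) (\<lambda>m n. Y a m (Y b n (?c i j))) (m - 1 - j) (n - 1 - i)"
      using imul_shift[of "N a b" "\<lambda>m n. Y a m (Y b n (?c i j))" "- 1 - j" "- 1 - i" m n]
      by (simp add: imul_scale algebra_simps)
  qed
  finally show ?thesis by (simp add: scale_sum_right)
qed

text \<open>
  The right-hand side of the preceding formula is symmetric, by locality of order \<open>N(a,b)\<close>.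
\<close>

lemma R_sym:
  assumes D1: "\<And>a m j b. g (jet a m * untwist N b j f) = R a m (untwist N b j f)"
  shows "R a m (jet b n * f) = R b n (jet a m * f)"
proof -
  have e: "eps N a b * (koszul (par_of N a) (par_of N b) * (- 1) powi N a b) = (eps N b a :: 'k)"
    by (subst eps_flip[of N a b]) (auto simp: N_sym[of a b] koszul_def m1_powi)
  have l: "imul (N a b) (\<lambda>m n. Y a m (Y b n c)) m n
      = (koszul (par_of N a) (par_of N b) * (- 1) powi N a b) *s imul (N a b) (\<lambda>n m. Y b n (Y a m c)) n m" for c m n
    using Y_loc[of a b c m n] by (simp add: tcomm_def)
  show ?thesis
    unfolding R_x[OF D1] l scale_sum_right scale_scale e
    by (subst sum.swap) (simp add: untwist_untwist[of b _ a] N_sym[of b a])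
qed

lemma lin_ext_gk:
  assumes "f \<in> supp_in (\<lambda>M. size M = k)"
  shows "lin_ext scale (gk k) f = g f"
  unfolding g_def lin_ext_def using assms by (intro sum.cong) (auto simp: supp_in_def)

text \<open>
  Induction on the size. The symmetry of \<open>R\<close> on smaller monomials gives independence of the
  variable that is split off. It also shows that the modes with \<open>m \<ge> 0\<close> vanish, because after the
  exchange they involve the factor \<open>x_a(u)\<close>, which has no such modes.
\<close>

lemma g_x_mon: "g (jet a m * mon M) = R a m (mon M)"
proof (induction "size M" arbitrary: M a m)
  case 0
  then have M: "M = {#}" by simp
  have *: "R a m (mon {#}) = Y a m v" for a m
    by (subst R_eq[of "{- 1}"]) (auto simp: untwist_def unit_ser_def, simp add: g_def mon_empty[symmetric] del: mon_empty)
  show ?case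
  proof (cases "m < 0")
    case True
    then have m: "m = - int (nat (- m - 1)) - 1" by simp
    have "g (jet a m * mon M) = g (mon {#(nat (- m - 1), a)#})"
      using M True by (simp add: jet_def)
    also have "\<dots> = conv (Y a) (\<lambda>j. lin_ext scale (gk 0) (untwist N a j (mon {#}))) m"
      using m by (simp add: g_def)
    also have "\<dots> = R a m (mon {#})"
      using lin_ext_gk[OF untwist_size[of a _ "{#}"]] by (simp add: R_def)
    finally show ?thesis by (simp add: M)
  next
    case False
    then show ?thesis using M *[of a m] by (simp add: jet_nonneg g.zero Y_vac)
  qed
next
  case (Suc k)
  have D1: "g (jet a m * f) = R a m f" if "f \<in> supp_in (\<lambda>M. size M = k)" for a m f
    using supp_in_subset[OF that sub_D1] Suc.hyps(1) by blast
  have sym: "R a m (jet b n * mon M') = R b n (jet a m * mon M')" if "size M' = k" for a m b n M'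
    by (rule R_sym, rule D1) (use untwist_size that in metis)
  show ?case
  proof (cases "m < 0")
    case True
    define n where "n = nat (- m - 1)"
    have m: "m = - int n - 1" using True by (simp add: n_def)
    define P where "P = add_mset (n, a) M"
    define y where "y = (SOME y. y \<in># P)"
    have y: "y \<in># P" unfolding y_def by (rule someI[of _ "(n, a)"]) (simp add: P_def)
    have sP: "size P = Suc (Suc k)" using Suc.hyps(2) by (simp add: P_def)
    have "g (jet a m * mon M) = g (mon P)" by (simp add: m P_def mon_add_mset)
    also have "\<dots> = conv (Y (snd y)) (\<lambda>j. lin_ext scale (gk (Suc k)) (untwist N (snd y) j (mon (P - {#y#})))) (- int (fst y) - 1)"
      by (simp add: g_def sP Let_def y_def del: gk.simps) (simp only: gk.simps(2)[of "Suc k"] Let_def)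
    also have "\<dots> = R (snd y) (- int (fst y) - 1) (mon (P - {#y#}))"
    proof -
      have "size (P - {#y#}) = Suc k" using sP y by (simp add: size_Diff_singleton)
      then have "lin_ext scale (gk (Suc k)) (untwist N (snd y) j (mon (P - {#y#}))) = g (untwist N (snd y) j (mon (P - {#y#})))" for j
        by (intro lin_ext_gk) (metis untwist_size)
      then show ?thesis unfolding R_def by (simp only:)
    qed
    also have "\<dots> = R a m (mon M)"
    proof (cases "y = (n, a)")
      case True
      then show ?thesis by (simp add: P_def m)
    next
      case False
      then have "y \<in># M" using y by (simp add: P_def)
      then obtain M' where M': "M = add_mset y M'" by (metis insert_DiffM)
      have "P - {#y#} = add_mset (n, a) M'" by (simp add: P_def M')
      moreover have "size M' = k" using Suc.hyps(2) by (simp add: M')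
      ultimately show ?thesis
        using sym[of M' "snd y" "- int (fst y) - 1" a "- int n - 1"]
        by (simp add: M' m flip: mon_add_mset)
    qed
    finally show ?thesis .
  next
    case False
    obtain y M' where M': "M = add_mset y M'" using Suc.hyps(2) by (metis size_eq_Suc_imp_eq_union add_mset_add_single)
    have "size M' = k" using Suc.hyps(2) by (simp add: M')
    then have "R a m (jet (snd y) (- int (fst y) - 1) * mon M') = R (snd y) (- int (fst y) - 1) (jet a m * mon M')"
      by (rule sym)
    then show ?thesis
      using False by (simp add: jet_nonneg R_zero g.zero M' flip: mon_add_mset)
  qed
qed

lemma g_x: "g (jet a m * f) = R a m f"
proof -
  have "f \<in> supp_in (\<lambda>M. True)" by (simp add: supp_in_def)
  from supp_in_subset[OF this sub_D1] show ?thesis using g_x_mon by blast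
qed

lemma g_1: "g 1 = v"
  by (simp add: g_def mon_empty[symmetric] del: mon_empty)

text \<open>
  Write \<open>a(u) = x_a(u) \<Gamma>_a(u)\<close> and use \<open>g(x_a(u) f) = Y_a(u) g(\<Gamma>_a(u)^(-1) f)\<close> for
  \<open>\<Gamma>_a(u) f\<close>.
\<close>

lemma g_vop: "g (vop N a m f) = Y a m (g f)"
proof -
  define S where "S = {j. retwist N a j f \<noteq> 0}"
  have S: "finite S" "\<And>j. j \<notin> S \<Longrightarrow> retwist N a j f = 0" by (auto simp: S_def retwist_finite)
  define T where "T = insert (- 1) (\<Union>j\<in>S. (\<lambda>i. i + 1 + j) ` {i. untwist N a i (retwist N a j f) \<noteq> 0})"
  have T: "finite T" by (simp add: T_def S untwist_finite)
  have T0: "untwist N a (p - 1 - j) (retwist N a j f) = 0" if "p \<notin> T" for p j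
  proof (cases "j \<in> S")
    case True
    show ?thesis
    proof (rule ccontr)
      assume "untwist N a (p - 1 - j) (retwist N a j f) \<noteq> 0"
      then have "p \<in> (\<lambda>i. i + 1 + j) ` {i. untwist N a i (retwist N a j f) \<noteq> 0}"
        by (intro image_eqI[of _ _ "p - 1 - j"]) auto
      then show False using that True by (auto simp: T_def)
    qed
  next
    case False
    then show ?thesis by (simp add: S(2) untwist_def twist_zero)
  qed
  have "vop N a m f = (\<Sum>j\<in>S. jet a (m - 1 - j) * retwist N a j f)"
    unfolding vop_conv[symmetric] by (rule H.conv_eq[OF lin_mult S])
  then have "g (vop N a m f) = (\<Sum>j\<in>S. R a (m - 1 - j) (retwist N a j f))"
    by (simp add: g.sum g_x)
  also have "\<dots> = (\<Sum>j\<in>S. \<Sum>p\<in>T. Y a (m - 1 - p) (g (untwist N a (p - 1 - j) (retwist N a j f))))"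
  proof (rule sum.cong[OF refl])
    fix j
    have "R a (m - 1 - j) (retwist N a j f) = conv (Y a) (\<lambda>p. g (untwist N a (p - 1 - j) (retwist N a j f))) m"
      using conv_shift[of "Y a" "\<lambda>i. g (untwist N a i (retwist N a j f))" "- 1 - j" m] by (simp add: R_def algebra_simps)
    also have "\<dots> = (\<Sum>p\<in>T. Y a (m - 1 - p) (g (untwist N a (p - 1 - j) (retwist N a j f))))"
      by (rule conv_eq[OF Y_lin T]) (simp add: T0 g.zero)
    finally show "R a (m - 1 - j) (retwist N a j f) = (\<Sum>p\<in>T. Y a (m - 1 - p) (g (untwist N a (p - 1 - j) (retwist N a j f))))" .
  qed
  also have "\<dots> = (\<Sum>p\<in>T. Y a (m - 1 - p) (g (\<Sum>j\<in>S. untwist N a (p - 1 - j) (retwist N a j f))))"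
    by (subst sum.swap) (simp add: g.sum module_hom.sum[OF Y_lin])
  also have "\<dots> = (\<Sum>p\<in>T. Y a (m - 1 - p) (g (unit_ser p * f)))"
  proof (intro sum.cong refl arg_cong[where f = "\<lambda>x. Y a _ (g x)"])
    fix p
    have "H.conv (untwist N a) (\<lambda>j. retwist N a j f) p = (\<Sum>j\<in>S. untwist N a (p - 1 - j) (retwist N a j f))"
      by (rule H.conv_eq[OF _ S]) (simp add: untwist_def twist_lin)
    then show "(\<Sum>j\<in>S. untwist N a (p - 1 - j) (retwist N a j f)) = unit_ser p * f"
      by (simp add: untwist_retwist_conv)
  qed
  also have "\<dots> = (\<Sum>p\<in>T. if p = - 1 then Y a m (g f) else 0)"
    by (intro sum.cong refl) (auto simp: unit_ser_def g.zero module_hom.zero[OF Y_lin])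
  also have "\<dots> = Y a m (g f)"
    using T by (simp add: sum.delta) (simp add: T_def)
  finally show ?thesis .
qed

end


section \<open>Vertex algebras with bounded generators\<close>

context char0_space begin

lemma Delta_pow_mem:
  assumes S: "subspace S" and "bdd F" "\<And>m n. (Delta ^^ j) F m n \<in> S"
  shows "F m n \<in> S"
  using assms(2,3)
proof (induction j arbitrary: F m n)
  case (Suc j)
  have D: "Delta F m n \<in> S" for m n
    by (rule Suc.IH) (use Suc.prems in \<open>auto simp: bdd_Delta funpow_swap1\<close>)
  obtain n0 where n0: "\<And>m n. n0 \<le> n \<Longrightarrow> F m n = 0" using Suc.prems(1) by (metis bdd_pw)
  have "\<forall>m. F m (n0 - int k) \<in> S" for k
  proof (induction k)
    case 0
    then show ?case by (simp add: n0 subspace_0[OF S])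
  next
    case (Suc k)
    show ?case
    proof
      fix m
      have "F m (n0 - int (Suc k)) = Delta F (m - 1) (n0 - int (Suc k)) + F (m - 1) (n0 - int k)"
        by (simp add: Delta_def algebra_simps)
      then show "F m (n0 - int (Suc k)) \<in> S" using D Suc by (simp add: subspace_add[OF S])
    qed
  qed
  note k = this
  show ?case
  proof (cases "n0 \<le> n")
    case True
    then show ?thesis by (simp add: n0 subspace_0[OF S])
  next
    case False
    then have "n = n0 - int (nat (n0 - n))" by simp
    then show ?thesis using k[of "nat (n0 - n)"] by metis
  qed
qed simp

lemma loc_of_tcomm:
  assumes "fld f" "fld g" "\<And>c m n. tcomm \<nu> s f g c m n = 0"
  shows "loc (nat \<nu>) s f g"
  unfolding loc_def
proof
  fix c
  define j where "j = nat (int (nat \<nu>) - \<nu>)"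
  have "\<nu> + int j = int (nat \<nu>)" by (simp add: j_def)
  then have "(Delta ^^ nat \<nu>) (supercomm s f g c) = (Delta ^^ j) (tcomm \<nu> s f g c)"
    by (simp only: Delta_pow_tcomm[OF assms(1,2)] tcomm_nat[symmetric])
  also have "tcomm \<nu> s f g c = (\<lambda>m n. 0)" by (simp add: fun_eq_iff assms(3))
  finally show "(Delta ^^ nat \<nu>) (supercomm s f g c) = (\<lambda>m n. 0)" by simp
qed

text \<open>
  As \<open>f(w) g(z) v = e^(zT) f(w - z) g_(-1) v\<close>, the bound on the modes of \<open>f\<close> means that
  \<open>(w - z)^\<nu> f(w) g(z) v\<close> is a power series in \<open>w\<close> and \<open>z\<close>. The induction on the power of \<open>z\<close> uses
  the differential equation \<open>T P = (\<partial>/\<partial>w + \<partial>/\<partial>z) P\<close> instead of the exponential.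
\<close>

lemma regular_on_vac:
  assumes T: "lin T" "T v = 0" and f: "fld f" "covariant T f" and g: "fld g" "covariant T g"
    and reg: "\<And>n. 0 \<le> n \<Longrightarrow> g n v = 0" and bound: "\<And>n. \<nu> \<le> n \<Longrightarrow> f n (g (- 1) v) = 0"
    and m: "0 \<le> m"
  shows "imul \<nu> (\<lambda>m n. f m (g n v)) m n = 0"
proof -
  let ?P = "imul \<nu> (\<lambda>m n. f m (g n v))"
  have nn: "?P m n = 0" if "0 \<le> n" for m n
    using imul_sum[of n 0 "\<lambda>m n. f m (g n v)"] that by (simp add: reg fld_zero[OF f(1)])
  have "\<forall>m\<ge>0. ?P m (- 1 - int k) = 0" for k
  proof (induction k)
    case 0
    show ?case
      by (intro allI impI, subst imul_sum[where K = 1]) (auto simp: reg fld_zero[OF f(1)] bound)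
  next
    case (Suc k)
    show ?case
    proof (intro allI impI)
      fix m :: int assume m: "0 \<le> m"
      have "T (?P m (- 1 - int k)) = mderiv ?P m (- 1 - int k)"
        using covariant_imul[OF T(1) f g, of \<nu> v m "- 1 - int k"] by (simp add: T(2) fld_zero f(1) g(1))
      moreover have "of_int m *s ?P (m - 1) (- 1 - int k) = 0"
        using Suc m by (cases "m = 0") auto
      ultimately have "of_int (- 1 - int k) *s ?P m (- 1 - int k - 1) = 0"
        using Suc m module_hom.zero[OF T(1)] unfolding mderiv_def by (simp del: of_int_diff)
      moreover have "of_int (- 1 - int k) \<noteq> (0::'k)" unfolding of_int_eq_0_iff by simp
      ultimately have "?P m (- 1 - int k - 1) = 0" by (simp only: scale_eq_0_iff) simp
      moreover have "- 1 - int k - 1 = - 1 - int (Suc k)" by simp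
      ultimately show "?P m (- 1 - int (Suc k)) = 0" by (simp only:)
    qed
  qed
  note neg = this
  show ?thesis
  proof (cases "0 \<le> n")
    case False
    then have "- 1 - int (nat (- 1 - n)) = n" by simp
    then show ?thesis using neg[of "nat (- 1 - n)"] m by (metis)
  qed (rule nn)
qed

end

sublocale vertex_algebra \<subseteq> char0_space "smul V"
  by unfold_locales

locale gen_va = vertex_algebra V
  for V :: "('k::field_char_0, 'v::ab_group_add) vertex_alg" +
  fixes B :: "'b::linorder set" and N :: "'b \<Rightarrow> 'b \<Rightarrow> int" and gen :: "'b \<Rightarrow> 'v"
  assumes N_sym_B: "a \<in> B \<Longrightarrow> b \<in> B \<Longrightarrow> N a b = N b a"
    and gens: "bounded_gens V B N gen"
begin

text \<open>
  A linear projection onto the carrier, which makes all operators of the vertex algebra linear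
  maps of the ambient space.
\<close>

definition proj :: "'v \<Rightarrow> 'v" where
  "proj = (SOME p. lin p \<and> range p \<subseteq> car V \<and> (\<forall>x\<in>car V. p x = x))"

lemma proj: "lin proj" "proj x \<in> car V" "x \<in> car V \<Longrightarrow> proj x = x"
proof -
  interpret pair: vector_space_pair "smul V" "smul V" ..
  have "\<exists>p. p ` UNIV \<subseteq> car V \<and> Vector_Spaces.linear (smul V) (smul V) p \<and> (\<forall>x\<in>car V. p (id x) = x)"
  proof (rule pair.linear_exists_left_inverse_on[OF _ subspace_car])
    show "Vector_Spaces.linear (smul V) (smul V) id"
      unfolding linear_iff_module_hom by (rule linI) simp_all
  qed simp
  then have "\<exists>p. lin p \<and> range p \<subseteq> car V \<and> (\<forall>x\<in>car V. p x = x)"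
    by (auto simp: linear_iff_module_hom)
  from someI_ex[OF this] have "lin proj \<and> range proj \<subseteq> car V \<and> (\<forall>x\<in>car V. proj x = x)"
    unfolding proj_def .
  then show "lin proj" "proj x \<in> car V" "x \<in> car V \<Longrightarrow> proj x = x" by auto
qed

lemmas proj_add = module_hom.add[OF proj(1)] and proj_scale = module_hom.scale[OF proj(1)]

definition act :: "'v \<Rightarrow> int \<Rightarrow> 'v \<Rightarrow> 'v" where
  "act u n c = nprod V n u (proj c)"

lemma act_car: "u \<in> car V \<Longrightarrow> act u n c \<in> car V"
  by (simp add: act_def nprod_car proj)

lemma act_eq: "c \<in> car V \<Longrightarrow> act u n c = nprod V n u c"
  by (simp add: act_def proj)

lemma act_fld: "u \<in> car V \<Longrightarrow> fld (act u)"
  unfolding fld_def act_def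
  by (auto intro!: linI nprod_eventually_0 simp: proj_add proj_scale nprod_add_right nprod_smul_right proj)

lemma act_loc:
  assumes "u \<in> part V i" "w \<in> part V j"
  shows "\<exists>K. loc K (koszul i j) (act u) (act w)"
proof -
  obtain M where M: "locality_order V (koszul i j) u w M"
    using locality[OF assms] by (auto simp: koszul_def)
  have c: "u \<in> car V" "w \<in> car V" using assms part_subset_car by blast+
  have "tcomm M (koszul i j) (act u) (act w) c m n = 0" for c m n
  proof -
    have "imul M (\<lambda>m n. nprod V m u (nprod V n w (proj c))) m n
      = smul V (koszul i j) (smul V ((- 1) powi M) (imul M (\<lambda>n m. nprod V n w (nprod V m u (proj c))) n m))"
      using M proj(2)[of c] unfolding locality_order_def
        Sum_any_imul[where F = "\<lambda>m n. nprod V m u (nprod V n w c)" for c]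
        Sum_any_mi'[where F = "\<lambda>n m. nprod V n w (nprod V m u c)" for c] by blast
    then show ?thesis
      unfolding tcomm_def by (simp add: act_def proj nprod_car c)
  qed
  from loc_of_tcomm[OF act_fld[OF c(1)] act_fld[OF c(2)] this] show ?thesis ..
qed

lemma act_vac_nonneg: "u \<in> car V \<Longrightarrow> 0 \<le> n \<Longrightarrow> act u n (vac V) = 0"
  by (simp add: act_eq vac_car vac_right_nonneg)

lemma act_vac_m1: "u \<in> car V \<Longrightarrow> act u (- 1) (vac V) = u"
  by (simp add: act_eq vac_car vac_right_neg divided_transl_def)

definition derV :: "'v \<Rightarrow> 'v" where
  "derV c = transl V (proj c)"

lemma derV_lin: "lin derV"
  unfolding derV_def transl_def
  by (rule linI) (simp_all add: proj_add proj_scale nprod_add_left nprod_smul_left proj vac_car)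

lemma derV_vac: "derV (vac V) = 0"
  by (simp add: derV_def transl_def proj vac_car vac_left)

lemma act_covariant: "u \<in> car V \<Longrightarrow> covariant derV (act u)"
  unfolding covariant_def derV_def act_def
  by (simp add: proj nprod_car transl_def vac_car) (simp add: transl_def[symmetric] transl_right proj)

text \<open>
  \<open>N\<close> is symmetric only on \<open>B\<close>. Colors outside \<open>B\<close> get the zero field, which is local of any order.
\<close>

definition N' :: "'b \<Rightarrow> 'b \<Rightarrow> int" where
  "N' a b = (if a \<in> B \<and> b \<in> B then N a b else 0)"

definition gact :: "'b \<Rightarrow> int \<Rightarrow> 'v \<Rightarrow> 'v" where
  "gact b = (if b \<in> B then act (gen b) else (\<lambda>n c. 0))"

lemma gen_part: "b \<in> B \<Longrightarrow> gen b \<in> part V (par_of N' b)"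
  using gens by (simp add: bounded_gens_def par_of_def N'_def)

lemma gen_car: "b \<in> B \<Longrightarrow> gen b \<in> car V"
  using gen_part part_subset_car by blast

lemma gen_bound: "a \<in> B \<Longrightarrow> b \<in> B \<Longrightarrow> N a b \<le> n \<Longrightarrow> act (gen a) n (gen b) = 0"
  using gens by (simp add: bounded_gens_def act_eq gen_car)

text \<open>
  Locality of some order and the vanishing of \<open>a_(n) b\<close> for \<open>n \<ge> N(a,b)\<close> imply locality of order
  \<open>N(a,b)\<close>. On the vacuum, both terms of the commutator with the factor \<open>(w - z)^(N(a,b))\<close> are power
  series by \<open>regular_on_vac\<close>, and they agree after multiplication by a power of \<open>w - z\<close>, hence agree.
  From the vacuum, the identity spreads to all vectors.
\<close>

lemma exact_loc:
  assumes ab: "a \<in> B" "b \<in> B"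
  shows "tcomm (N a b) (koszul (par_of N' a) (par_of N' b)) (act (gen a)) (act (gen b)) c m n = 0"
proof -
  let ?f = "act (gen a)" and ?g = "act (gen b)" and ?s = "koszul (par_of N' a) (par_of N' b) :: 'k" and ?N = "N a b"
  note c = gen_car[OF ab(1)] gen_car[OF ab(2)]
  note f = act_fld[OF c(1)] act_covariant[OF c(1)] and g = act_fld[OF c(2)] act_covariant[OF c(2)]
  let ?P = "imul ?N (\<lambda>m n. ?f m (?g n (vac V)))" and ?Q = "imul ?N (\<lambda>n m. ?g n (?f m (vac V)))"
  have Q: "?Q n m = 0" if "0 \<le> n" for m n
    by (rule regular_on_vac[OF derV_lin derV_vac g f])
      (use that in \<open>auto simp: act_vac_nonneg c act_vac_m1 gen_bound ab N_sym_B[OF ab]\<close>)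
  have P: "?P m n = 0" if "0 \<le> n" for m n
    using imul_sum[of n 0 "\<lambda>m n. ?f m (?g n (vac V))"] that by (simp add: act_vac_nonneg c fld_zero[OF f(1)])
  have vac: "tcomm ?N ?s ?f ?g (vac V) m n = 0" for m n
  proof -
    obtain K where K: "loc K ?s ?f ?g" using act_loc[OF gen_part[OF ab(1)] gen_part[OF ab(2)]] by blast
    define j where "j = nat (int K - ?N)"
    show ?thesis
    proof (rule Delta_funpow_inj[where j = j])
      show "bdd (tcomm ?N ?s ?f ?g (vac V))"
        by (rule bddI[of 0]) (simp add: tcomm_def P Q)
      show "(Delta ^^ j) (tcomm ?N ?s ?f ?g (vac V)) m n = 0" for m n
        unfolding Delta_pow_tcomm[OF f(1) g(1)] by (rule loc_tcomm_zero[OF K]) (simp add: j_def)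
    qed
  qed
  have hom: "tcomm ?N ?s ?f ?g x m n = 0" if x: "x \<in> part V i" for x i m n
  proof -
    have xc: "x \<in> car V" using x part_subset_car by blast
    obtain K L where KL: "loc K (koszul i (par_of N' a)) (act x) ?f" "loc L (koszul i (par_of N' b)) (act x) ?g"
      using act_loc[OF x gen_part[OF ab(1)]] act_loc[OF x gen_part[OF ab(2)]] by blast
    have "tcomm ?N ?s ?f ?g (act x (- 1) (vac V)) m n = 0"
      by (rule tcomm_zero_from_vac[OF act_fld[OF xc] f(1) g(1) KL])
        (auto simp: vac act_vac_nonneg xc, auto simp: koszul_def split: if_splits)
    then show ?thesis by (simp add: act_vac_m1 xc)
  qed
  obtain y z where yz: "proj c = y + z" "y \<in> part V 0" "z \<in> part V 1"
    using proj(2)[of c] unfolding car_eq by blast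
  have "tcomm ?N ?s ?f ?g c m n = tcomm ?N ?s ?f ?g (proj c) m n"
    by (simp add: tcomm_def act_def proj)
  also have "\<dots> = 0"
    unfolding yz(1) module_hom.add[OF lin_tcomm[OF f(1) g(1)]] by (simp add: hom[OF yz(2)] hom[OF yz(3)])
  finally show ?thesis .
qed

sublocale local_module "smul V" "vac V" gact N'
proof unfold_locales
  show "N' a b = N' b a" for a b by (auto simp: N'_def N_sym_B)
  show "fld (gact b)" for b by (simp add: gact_def act_fld gen_car fld_0)
  show "gact b n (vac V) = 0" if "0 \<le> n" for b n using that by (simp add: gact_def act_vac_nonneg gen_car)
  show "tcomm (N' a b) (koszul (par_of N' a) (par_of N' b)) (gact a) (gact b) c m n = 0" for a b c m n
  proof (cases "a \<in> B \<and> b \<in> B")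
    case True
    then show ?thesis using exact_loc[of a b] by (simp add: gact_def N'_def)
  next
    case False
    have z: "act u n 0 = 0" if "u \<in> car V" for u n using fld_zero[OF act_fld[OF that]] .
    show ?thesis using False by (auto simp: tcomm_def gact_def z gen_car)
  qed
qed

abbreviation wd :: "bit \<Rightarrow> 'v \<Rightarrow> bool" where "wd \<equiv> words (vac V) gact (par_of N')"

lemma wd_part: "wd i w \<Longrightarrow> w \<in> part V i"
proof (induction rule: words.induct)
  case words_vac
  show ?case by (rule vac_even)
next
  case (words_app i w b n)
  have "w \<in> car V" using words_app part_subset_car by blast
  then show ?case
    using nprod_part[OF gen_part words_app(2), of b n] subspace_0[OF subspace_part]
    by (simp add: gact_def act_eq del: add_bit_eq_xor)
qed

text \<open>
  The span \<open>U\<close> of the words is closed under all products. For words \<open>u\<close> and \<open>x = a_(m) x'\<close>, locality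
  expresses \<open>(w - z)^K u(w) a(z) x'\<close> through \<open>a(z) u(w) x'\<close>, whose coefficients lie in \<open>U\<close> by induction;
  the factor is then removed by induction on the power of \<open>z\<close>. The case \<open>x = 1\<close> holds because \<open>U\<close> is
  closed under translation.
\<close>

lemma gact_span:
  assumes S: "subspace S" "vac V \<in> S" "\<And>b n x. x \<in> S \<Longrightarrow> gact b n x \<in> S"
    and gen: "car V = generated V (gen ` B)"
  shows "car V \<subseteq> S"
proof -
  define U where "U = span {w. \<exists>i. wd i w}"
  have sU: "subspace U" by (simp add: U_def)
  have wU: "w \<in> U" if "wd i w" for i w using that by (auto simp: U_def intro: span_base)
  have "w \<in> S" if "wd i w" for i w
    using that by induction (use S in auto)
  then have US: "U \<subseteq> S" unfolding U_def by (intro span_minimal S(1)) auto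
  have lin_mem: "L x \<in> U" if L: "lin L" "\<And>i w. wd i w \<Longrightarrow> L w \<in> U" and x: "x \<in> U" for L x
  proof -
    interpret L: module_hom "smul V" "smul V" L by (rule L(1))
    have "U \<subseteq> {x. L x \<in> U}"
      unfolding U_def by (rule span_minimal)
        (use L(2) in \<open>auto simp: U_def L.add L.scale L.zero span_zero span_add span_scale intro!: subspaceI\<close>)
    then show ?thesis using x by blast
  qed
  have YU: "gact b n x \<in> U" if "x \<in> U" for b n x
    by (rule lin_mem[OF Y_lin _ that]) (use words_app wU in metis)
  have DwU: "derV w \<in> U" if "wd i w" for i w
    using that
  proof induction
    case (words_app i w b n)
    have "covariant derV (gact b)"
      by (auto simp: gact_def act_covariant gen_car) (simp add: covariant_def module_hom.zero[OF derV_lin])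
    then have "derV (gact b n w) = gact b n (derV w) - smul V (of_int n) (gact b (n - 1) w)" by (simp add: covariant_def)
    then show ?case using words_app by (simp add: YU wU subspace_diff[OF sU] subspace_scale[OF sU])
  qed (simp add: derV_vac subspace_0[OF sU])
  have DU: "derV x \<in> U" if "x \<in> U" for x by (rule lin_mem[OF derV_lin _ that]) (rule DwU)
  have ww: "\<forall>n. act u n x \<in> U" if u: "wd i u" and x: "wd j x" for i j u x
    using x
  proof induction
    case words_vac
    have uc: "u \<in> car V" using wd_part[OF u] part_subset_car by blast
    have "(transl V ^^ k) u \<in> U" for k
    proof (induction k)
      case (Suc k)
      then show ?case using DU[OF Suc] by (simp add: derV_def proj transl_pow_car uc)
    qed (simp add: wU[OF u])
    then have "act u n (vac V) \<in> U" if "n < 0" for n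
      using that by (simp add: act_eq uc vac_car vac_right_neg divided_transl_def subspace_scale[OF sU])
    then have "act u n (vac V) \<in> U" for n
      by (cases "0 \<le> n") (simp_all add: act_vac_nonneg uc subspace_0[OF sU])
    then show ?case ..
  next
    case (words_app j x b m)
    show ?case
    proof (cases "b \<in> B")
      case True
      have uc: "u \<in> car V" using wd_part[OF u] part_subset_car by blast
      let ?s = "koszul i (par_of N' b) :: 'k"
      obtain K where "loc K ?s (act u) (gact b)"
        using act_loc[OF wd_part[OF u] gen_part[OF True]] True by (auto simp: gact_def)
      then have "(Delta ^^ K) (supercomm ?s (act u) (gact b) x) = (\<lambda>m n. 0)" by (simp add: loc_def)
      then have "(Delta ^^ K) (\<lambda>k m. act u k (gact b m x)) k m = smul V ?s ((Delta ^^ K) (\<lambda>k m. gact b m (act u k x)) k m)" for k m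
        unfolding supercomm_def[abs_def] Delta_funpow_diff Delta_pow_scale by (simp add: fun_eq_iff)
      moreover have "(Delta ^^ K) F k m \<in> U" if "\<And>k m. F k m \<in> U" for F k m
        using that by (induction K arbitrary: k m) (auto simp: Delta_def subspace_diff[OF sU])
      ultimately have "(Delta ^^ K) (\<lambda>k m. act u k (gact b m x)) k m \<in> U" for k m
        using words_app by (simp add: subspace_scale[OF sU] YU)
      then show ?thesis
        by (intro allI) (rule Delta_pow_mem[OF sU bdd_fld[OF act_fld[OF uc] Y_fld]])
    next
      case False
      have uc: "u \<in> car V" using wd_part[OF u] part_subset_car by blast
      show ?thesis using False by (simp add: gact_def fld_zero[OF act_fld[OF uc]] subspace_0[OF sU])
    qed
  qed
  have Uc: "U \<subseteq> car V"
    unfolding U_def by (rule span_minimal[OF _ subspace_car]) (use wd_part part_subset_car in blast)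
  have wx: "act u n x \<in> U" if u: "wd i u" and x: "x \<in> U" for i u n x
  proof (rule lin_mem[OF _ _ x])
    show "lin (act u n)" using act_fld wd_part[OF u] part_subset_car by (blast intro: fld_lin)
  qed (use ww[OF u] in blast)
  have UU: "nprod V n u x \<in> U" if u: "u \<in> U" and x: "x \<in> U" for n u x
  proof -
    have "lin (\<lambda>u. nprod V n (proj u) (proj x))"
      by (rule linI) (simp_all add: proj_add proj_scale nprod_add_left nprod_smul_left proj)
    moreover have "nprod V n (proj w) (proj x) \<in> U" if "wd i w" for i w
    proof -
      have "proj w = w" using wd_part[OF that] part_subset_car proj(3) by blast
      then show ?thesis using wx[OF that x, of n] by (simp add: act_def)
    qed
    ultimately have "nprod V n (proj u) (proj x) \<in> U" using u by (rule lin_mem)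
    moreover have "proj u = u" "proj x = x" using u x Uc proj(3) by blast+
    ultimately show ?thesis by simp
  qed
  have "x \<in> U" if "x \<in> generated V (gen ` B)" for x
    using that
  proof induction
    case gen_vac
    show ?case by (rule wU) (rule words.words_vac)
  next
    case (gen_base x)
    then obtain b where b: "b \<in> B" "x = gen b" by blast
    have "gact b (- 1) (vac V) = gen b" using b by (simp add: gact_def act_vac_m1 gen_car)
    then show ?case using YU[OF wU[OF words.words_vac], of b "- 1"] b by simp
  qed (simp_all add: subspace_add[OF sU] subspace_scale[OF sU] UU)
  then show ?thesis using gen US by blast
qed

end

section \<open>Monomials and colored partitions\<close>

lemma energy_eq: "energy M = (\<Sum>(n, a)\<in>#M. n)"
  by (simp add: energy_def case_prod_unfold)

lemma colors_plus [simp]: "colors (M + M') = colors M + colors M'"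
  by (simp add: colors_def)

lemma energy_plus [simp]: "energy (M + M') = energy M + energy M'"
  by (simp add: energy_def)

text \<open>
  A monomial of weight \<open>lam\<close> is recovered from its variables with positive upper index, because
  the number of variables with upper index \<open>0\<close> is then known for every color.
\<close>

lemma partitions_bij:
  fixes q :: rat
  assumes "set_mset lam \<subseteq> B"
  shows "bij_betw (filter_mset (\<lambda>y. 0 < fst y)) {M. colors M = lam \<and> of_nat (energy M) = q}
    (bounded_colored_partitions B lam q)"
proof (rule bij_betw_byWitness[where f' = "\<lambda>P. P + image_mset (Pair 0) (lam - colors P)"])
  let ?\<phi> = "filter_mset (\<lambda>y. 0 < fst y) :: (nat \<times> 'a) multiset \<Rightarrow> _" and ?z = "filter_mset (\<lambda>y. \<not> 0 < fst y) :: (nat \<times> 'a) multiset \<Rightarrow> _"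
  have split: "?\<phi> M + ?z M = M" for M by (simp add: multiset_partition[symmetric])
  have z: "image_mset (Pair 0) (colors (?z M)) = ?z M" for M
  proof -
    have "image_mset (Pair 0) (colors (?z M)) = image_mset (\<lambda>y. y) (?z M)"
      unfolding colors_def multiset.map_comp by (rule image_mset_cong) (auto simp: prod_eq_iff)
    then show ?thesis by simp
  qed
  have energy_z: "energy (?z M) = 0" for M by (auto simp: energy_def)
  have c: "colors (?\<phi> M) + colors (?z M) = colors M" and e: "energy (?\<phi> M) = energy M" for M
  proof -
    show "colors (?\<phi> M) + colors (?z M) = colors M" by (simp only: colors_plus[symmetric] split)
    have "energy (?\<phi> M) + energy (?z M) = energy M" by (simp only: energy_plus[symmetric] split)
    then show "energy (?\<phi> M) = energy M" by (simp only: energy_z add_0_right)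
  qed
  have sub: "colors P \<subseteq># lam" if P: "P \<in> bounded_colored_partitions B lam q" for P
  proof (rule mset_subset_eqI)
    fix a
    show "count (colors P) a \<le> count lam a"
    proof (cases "a \<in> B")
      case False
      then have "a \<notin># colors P"
        using P by (auto simp: bounded_colored_partitions_def colored_partitions_def colors_def)
      then show ?thesis by (simp add: not_in_iff)
    qed (use P in \<open>auto simp: bounded_colored_partitions_def colors_def\<close>)
  qed
  have energy_0: "energy (image_mset (Pair 0) L) = 0" for L :: "'a multiset"
    by (auto simp: energy_def)
  have col_0: "colors (image_mset (Pair 0) L) = L" for L :: "'a multiset"
    by (simp add: colors_def multiset.map_comp o_def)
  show "\<forall>M\<in>{M. colors M = lam \<and> of_nat (energy M) = q}. ?\<phi> M + image_mset (Pair 0) (lam - colors (?\<phi> M)) = M"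
  proof
    fix M assume "M \<in> {M. colors M = lam \<and> of_nat (energy M) = q}"
    then have "lam - colors (?\<phi> M) = colors (?z M)" using c[of M] by auto
    then show "?\<phi> M + image_mset (Pair 0) (lam - colors (?\<phi> M)) = M" using z split by metis
  qed
  show "\<forall>P\<in>bounded_colored_partitions B lam q. ?\<phi> (P + image_mset (Pair 0) (lam - colors P)) = P"
  proof
    fix P assume P: "P \<in> bounded_colored_partitions B lam q"
    have "?\<phi> P = P"
      using P by (auto simp: bounded_colored_partitions_def colored_partitions_def filter_mset_eq_conv)
    moreover have "?\<phi> (image_mset (Pair 0) L) = {#}" for L :: "'a multiset"
      by (induction L) auto
    ultimately show "?\<phi> (P + image_mset (Pair 0) (lam - colors P)) = P" by simp
  qed
  show "?\<phi> ` {M. colors M = lam \<and> of_nat (energy M) = q} \<subseteq> bounded_colored_partitions B lam q"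
  proof (rule image_subsetI)
    fix M assume "M \<in> {M. colors M = lam \<and> of_nat (energy M) = q}"
    then have M: "colors M = lam" "of_nat (energy M) = q" by auto
    have "a \<in> B" if "(n, a) \<in># M" for n a
      using that assms M(1) by (force simp: colors_def)
    moreover have "count (colors (?\<phi> M)) a \<le> count lam a" for a
      using arg_cong[OF c[of M], of "\<lambda>L. count L a"] M(1) by simp
    ultimately show "?\<phi> M \<in> bounded_colored_partitions B lam q"
      using M(2) e[of M] by (auto simp: bounded_colored_partitions_def colored_partitions_def energy_eq[symmetric] colors_def)
  qed
  show "(\<lambda>P. P + image_mset (Pair 0) (lam - colors P)) ` bounded_colored_partitions B lam q
      \<subseteq> {M. colors M = lam \<and> of_nat (energy M) = q}"
    using sub by (auto simp: energy_0 col_0 energy_eq[symmetric] bounded_colored_partitions_def colored_partitions_def)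
qed

definition dmin :: "('b \<Rightarrow> 'b \<Rightarrow> int) \<Rightarrow> 'b multiset \<Rightarrow> rat" where
  "dmin N \<mu> = - of_int (\<Sum>a\<in>#\<mu>. \<Sum>b\<in>#\<mu>. N a b) / 2"

lemma dmin_add:
  assumes "\<And>b. b \<in># \<mu> \<Longrightarrow> N a b = N b a"
  shows "dmin N (add_mset a \<mu>) = dmin N \<mu> - of_int (\<Sum>b\<in>#\<mu>. N a b) - of_int (N a a) / 2"
proof -
  have "(\<Sum>b\<in>#\<mu>. N b a) = (\<Sum>b\<in>#\<mu>. N a b)"
    using assms by (metis (mono_tags, lifting) image_mset_cong)
  then show ?thesis by (simp add: dmin_def sum_mset.distrib field_simps)
qed

lemma dmin_half: "dmin N \<mu> \<in> half_ints"
  by (simp add: half_ints_def dmin_def)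

lemma half_ints_add_int: "d \<in> half_ints \<Longrightarrow> of_int k + d \<in> half_ints"
  by (simp add: half_ints_def distrib_left)

definition deg :: "('b \<Rightarrow> 'b \<Rightarrow> int) \<Rightarrow> (nat \<times> 'b) multiset \<Rightarrow> rat" where
  "deg N M = of_nat (energy M) + dmin N (colors M)"

lemma deg_half: "deg N M \<in> half_ints"
  using half_ints_add_int[OF dmin_half, of "int (energy M)"] by (simp add: deg_def)

section \<open>Dimensions of the homogeneous components\<close>

context gen_va begin

lemma supp_in_mon: "H.subspace {f. g f \<in> S}" if "subspace S"
  using that by (auto intro!: H.subspaceI simp: g.zero g.add g.scale subspace_0 subspace_add subspace_scale)

lemma g_car: "g f \<in> car V"
proof -
  have "mon M \<in> {f. g f \<in> car V}" for M
  proof (rule mon_by_words[where S = "\<lambda>\<mu>. {f. g f \<in> car V}" and B = UNIV and N = N'])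
    show "H.subspace {f. g f \<in> car V}" by (rule supp_in_mon[OF subspace_car])
    show "1 \<in> {f. g f \<in> car V}" by (simp add: g_1 vac_car)
    show "vop N' b n f \<in> {f. g f \<in> car V}" for b n f
      using subspace_0[OF subspace_car] by (simp add: g_vop gact_def act_car gen_car)
  qed simp
  from subspace_monoI[OF supp_in_mon[OF subspace_car] this] show ?thesis by simp
qed

lemma g_surj:
  assumes "car V = generated V (gen ` B)" "x \<in> car V"
  shows "\<exists>f. x = g f"
proof -
  have "car V \<subseteq> range g"
  proof (rule gact_span[OF _ _ _ assms(1)])
    show "subspace (range g)" using g.subspace_image[OF H.subspace_UNIV] .
    show "vac V \<in> range g" using g_1 by (metis rangeI)
    show "gact b n x \<in> range g" if x: "x \<in> range g" for b n x
    proof -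
      obtain f where "x = g f" using x by blast
      then show ?thesis by (simp add: g_vop[symmetric])
    qed
  qed
  then show ?thesis using assms(2) by blast
qed

text \<open>
  The field of a color outside \<open>B\<close> is zero, and \<open>g(x_a(u) f) = Y_a(u) g(...)\<close>.
\<close>

lemma g_outside:
  assumes "\<not> set_mset (colors M) \<subseteq> B"
  shows "g (mon M) = 0"
proof -
  obtain a where a: "a \<in># colors M" "a \<notin> B" using assms by blast
  then obtain n M' where M: "M = add_mset (n, a) M'"
    by (auto simp: colors_def) (metis insert_DiffM)
  have Y: "gact a = (\<lambda>n c. 0)" using a by (simp add: gact_def)
  show ?thesis unfolding M mon_add_mset g_x R_def Y by (simp add: conv_def)
qed

text \<open>
  Induction on the size: \<open>g(x_b^(n) M')\<close> is a combination of the \<open>b_(m) g(M'')\<close> where the \<open>M''\<close> are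
  the monomials in the corresponding coefficient of \<open>\<Gamma>_b(u)^(-1) M'\<close>. Their colors and upper indices
  are known from \<open>twist_energy\<close>, and \<open>dmin_add\<close> shows that the degrees match.
\<close>

lemma g_homogeneous:
  assumes G: "weight_degree_grading V B N gen G" and M: "set_mset (colors M) \<subseteq> B"
  shows "g (mon M) \<in> G (colors M) (deg N M)"
  using M
proof (induction "size M" arbitrary: M)
  case 0
  then show ?case using G by (simp add: weight_degree_grading_def g_1 deg_def dmin_def)
next
  case (Suc k)
  then obtain y M' where M': "M = add_mset y M'" by (metis size_eq_Suc_imp_eq_union add_mset_add_single)
  obtain n b where y: "y = (n, b)" by (cases y)
  let ?\<kappa> = "colors M'"
  have k: "size M' = k" "set_mset ?\<kappa> \<subseteq> B" "b \<in> B" using Suc.prems Suc.hyps(2) by (auto simp: M' y)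
  have sub: "subspace (G \<mu> e)" if "set_mset \<mu> \<subseteq> B" "e \<in> half_ints" for \<mu> e
    using G that by (simp add: weight_degree_grading_def direct_sum_decomp_def)
  have prod: "nprod V n x y \<in> G (\<mu> + \<mu>') (e + e' - of_int n - 1)"
    if "set_mset \<mu> \<subseteq> B" "set_mset \<mu>' \<subseteq> B" "e \<in> half_ints" "e' \<in> half_ints" "x \<in> G \<mu> e" "y \<in> G \<mu>' e'" for \<mu> \<mu>' e e' x y n
    using G that by (simp add: weight_degree_grading_def)
  have gb: "gen b \<in> G {#b#} (- of_int (N b b) / 2)" using G k(3) by (simp add: weight_degree_grading_def)
  have hb: "- of_int (N b b) / 2 \<in> half_ints" by (simp add: half_ints_def)
  have NN: "(\<Sum>a\<in>#?\<kappa>. N' b a) = (\<Sum>a\<in>#?\<kappa>. N b a)"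
    using k(2,3) by (intro arg_cong[where f = sum_mset] image_mset_cong) (auto simp: N'_def)
  define l where "l = (\<Sum>a\<in>#?\<kappa>. N b a)"
  define \<delta> where "\<delta> j = of_int (int (energy M') - j - 1 - l) + dmin N ?\<kappa>" for j
  have \<delta>: "\<delta> j \<in> half_ints" for j unfolding \<delta>_def by (intro half_ints_add_int dmin_half)
  have untwist: "g (untwist N' b j (mon M')) \<in> G ?\<kappa> (\<delta> j)" for j
  proof -
    have "untwist N' b j (mon M') \<in> {f. g f \<in> G ?\<kappa> (\<delta> j)}"
    proof (rule supp_in_subset)
      show "untwist N' b j (mon M') \<in> supp_in (\<lambda>M''. colors M'' = ?\<kappa> \<and> int (energy M'') = int (energy M') - j - 1 - (\<Sum>a\<in>#?\<kappa>. N' b a))"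
        unfolding untwist_def by (rule twist_energy)
      show "H.subspace {f. g f \<in> G ?\<kappa> (\<delta> j)}" by (rule supp_in_mon[OF sub[OF k(2) \<delta>]])
      show "mon M'' \<in> {f. g f \<in> G ?\<kappa> (\<delta> j)}"
        if c: "colors M'' = ?\<kappa> \<and> int (energy M'') = int (energy M') - j - 1 - (\<Sum>a\<in>#?\<kappa>. N' b a)" for M''
      proof -
        have "size M'' = k" using c k(1) by (metis size_colors)
        then have "g (mon M'') \<in> G (colors M'') (deg N M'')" using Suc.hyps(1)[of M''] c k(2) by simp
        moreover have "deg N M'' = \<delta> j"
        proof -
          have "int (energy M'') = int (energy M') - j - 1 - l" using c by (simp add: NN l_def)
          then have "(of_nat (energy M'') :: rat) = of_int (int (energy M') - j - 1 - l)" by (metis of_int_of_nat_eq)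
          then show ?thesis using c by (simp add: deg_def \<delta>_def)
        qed
        ultimately show ?thesis using c by simp
      qed
    qed
    then show ?thesis by simp
  qed
  have "g (mon M) = R b (- int n - 1) (mon M')"
    by (simp add: M' y mon_add_mset g_x)
  also have "\<dots> = (\<Sum>j\<in>{j. untwist N' b j (mon M' :: ('b, 'k) jets) \<noteq> 0}. gact b (- int n - 1 - 1 - j) (g (untwist N' b j (mon M'))))"
    by (rule R_eq) (auto simp: untwist_finite)
  also have "\<dots> \<in> G (colors M) (deg N M)"
  proof (rule subspace_sum)
    show "subspace (G (colors M) (deg N M))" using Suc.prems deg_half by (rule sub)
    fix j
    have "nprod V (- int n - 1 - 1 - j) (gen b) (g (untwist N' b j (mon M')))
       \<in> G ({#b#} + ?\<kappa>) (- of_int (N b b) / 2 + \<delta> j - of_int (- int n - 1 - 1 - j) - 1)"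
      by (rule prod[OF _ k(2) hb \<delta> gb untwist]) (simp add: k(3))
    moreover have "- of_int (N b b) / 2 + \<delta> j - of_int (- int n - 1 - 1 - j) - 1 = deg N M"
    proof -
      have "dmin N (add_mset b ?\<kappa>) = dmin N ?\<kappa> - of_int l - of_int (N b b) / 2"
        unfolding l_def by (rule dmin_add) (use k N_sym_B in auto)
      then show ?thesis by (simp add: \<delta>_def deg_def M' y)
    qed
    ultimately show "gact b (- int n - 1 - 1 - j) (g (untwist N' b j (mon M'))) \<in> G (colors M) (deg N M)"
      using k(3) by (simp add: gact_def act_eq g_car M' y)
  qed
  finally show ?case .
qed

end

theorem mainTheorem2:
  fixes B :: "'b::linorder set"
    and N :: "'b \<Rightarrow> 'b \<Rightarrow> int"
    and V :: "('k::field_char_0, 'v::ab_group_add) vertex_alg"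
    and gen :: "'b \<Rightarrow> 'v"
    and G :: "'b multiset \<Rightarrow> rat \<Rightarrow> 'v set"
    and lam :: "'b multiset"
    and d :: rat
  assumes "\<forall>a\<in>B. \<forall>b\<in>B. N a b = N b a"
    and "free_vertex_algebra V B N gen"
    and "weight_degree_grading V B N gen G"
    and "set_mset lam \<subseteq> B"
    and "d \<in> half_ints"
  shows "(\<exists>E. finite E \<and> module.span (smul V) E = G lam d) \<and>
    vector_space.dim (smul V) (G lam d) =
      card (bounded_colored_partitions B lam (d - min_degree G lam))"
proof -
  have free: "vertex_algebra V" "bounded_gens V B N gen" "car V = generated V (gen ` B)"
    using assms(2) by (simp_all add: free_vertex_algebra_def)
  interpret gen_va V B N gen
    using free(1,2) assms(1) by (simp add: gen_va_def gen_va_axioms_def)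
  interpret S: sym_form N' "TYPE('k)"
    by unfold_locales (rule N_sym)
  let ?W = "S.W.state_va"
  have W: "vertex_algebra ?W" by (rule S.W.vertex_algebra_state_va)
  have Wg: "bounded_gens ?W B N (\<lambda>b. jet b (- 1))"
    using S.W_gens[of B] by (auto simp: bounded_gens_def N'_def)
  obtain h where h: "va_hom V ?W h" "\<forall>b\<in>B. h (gen b) = jet b (- 1)"
    using free_vertex_algebra_universal[OF assms(2), where 'w = "('b, 'k) jets"] W Wg
    unfolding va_universal_def by blast
  have h_add: "h (x + y) = h x + h y" and h_nprod: "h (nprod V n x y) = nprod ?W n (h x) (h y)"
    if "x \<in> car V" "y \<in> car V" for x y n
    using h(1) that by (simp_all add: va_hom_def)
  have h_scale: "h (smul V r x) = sc r (h x)" if "x \<in> car V" for x r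
    using h(1) that by (simp add: va_hom_def) (simp add: S.W.state_va_def)
  have h_vac: "h (vac V) = 1"
    using h(1) by (simp add: va_hom_def) (simp add: S.W.state_va_def)
  \<comment> \<open>The map from the free algebra splits \<open>g\<close> on the part of the polynomial ring with colors in \<open>B\<close>.\<close>
  have hg: "H.lin (\<lambda>f. h (g f))"
    by (rule H.linI) (simp_all add: g.add g.scale h_add h_scale g_car)
  interpret hg: module_hom sc sc "\<lambda>f. h (g f)" by (rule hg)
  have h0: "h 0 = 0" using hg.zero by (simp only: g.zero)
  have hg_mon: "h (g (mon M)) = mon M" if "set_mset (colors M) \<subseteq> B" for M
  proof -
    have "mon M \<in> {f. h (g f) = f}"
    proof (rule mon_by_words[where S = "\<lambda>\<mu>. {f. h (g f) = f}" and N = N', OF _ _ _ that])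
      show "H.subspace {f. h (g f) = f}"
        by (rule H.subspaceI) (simp_all add: h0 g.zero hg.add hg.scale)
      show "1 \<in> {f. h (g f) = f}" using h_vac by (simp add: g_1)
      show "vop N' b n f \<in> {f. h (g f) = f}" if "b \<in> B" "f \<in> {f. h (g f) = f}" for b n f
        using that h(2) by (simp add: g_vop gact_def act_eq g_car h_nprod gen_car S.nprod_W)
    qed
    then show ?thesis by simp
  qed
  have mon_nz: "mon M \<noteq> (0 :: ('b, 'k) jets)" for M
    by (metis mon_def keys_single keys_zero insert_not_empty zero_neq_one)
  have mon_inj: "mon M = (mon M' :: ('b, 'k) jets) \<longleftrightarrow> M = M'" for M M'
    by (metis mon_def keys_single singleton_inject zero_neq_one)

  define A where "A e = {M. colors M = lam \<and> deg N M = e}" for e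
  have AB: "set_mset (colors M) \<subseteq> B" if "M \<in> A e" for M e
    using that assms(4) by (auto simp: A_def)
  have A_eq: "A e = {M. colors M = lam \<and> of_nat (energy M) = e - dmin N lam}" for e
    by (auto simp: A_def deg_def)
  have A_bij: "bij_betw (filter_mset (\<lambda>y. 0 < fst y)) (A e) (bounded_colored_partitions B lam (e - dmin N lam))" for e
    unfolding A_eq by (rule partitions_bij[OF assms(4)])
  have A_fin: "finite (A e)" for e
    using bij_betw_finite[OF A_bij] finite_bounded_colored_partitions by blast
  define E where "E e = (\<lambda>M. g (mon M)) ` A e" for e
  have E_fin: "finite (E e)" for e by (simp add: E_def A_fin)
  have inj: "inj_on (\<lambda>M. g (mon M)) (A e)" for e
    by (rule inj_onI) (metis AB hg_mon mon_inj)

  have sub: "subspace (G \<mu> e)" if "set_mset \<mu> \<subseteq> B" "e \<in> half_ints" for \<mu> e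
    using assms(3) that by (simp add: weight_degree_grading_def direct_sum_decomp_def)
  have GV: "G \<mu> e \<subseteq> car V" if "set_mset \<mu> \<subseteq> B" "e \<in> half_ints" for \<mu> e
    using assms(3) that by (simp add: weight_degree_grading_def direct_sum_decomp_def)
  let ?I = "{\<mu>. set_mset \<mu> \<subseteq> B} \<times> half_ints"
  define decomp where "decomp f x \<longleftrightarrow> (\<forall>i\<in>?I. f i \<in> (\<lambda>(\<mu>, e). G \<mu> e) i) \<and> (\<forall>i. i \<notin> ?I \<longrightarrow> f i = 0) \<and>
      finite {i. f i \<noteq> 0} \<and> Sum_any f = x" for f x
  have "\<exists>!f. decomp f x" if "x \<in> car V" for x
    using assms(3) that unfolding weight_degree_grading_def direct_sum_decomp_def decomp_def by blast
  then have uniq: "f = f'" if "x \<in> car V" "decomp f x" "decomp f' x" for f f' x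
    using that by blast

  have G_span: "G lam e = span (E e)" if e: "e \<in> half_ints" for e
  proof
    show "span (E e) \<subseteq> G lam e"
    proof (rule span_minimal[OF _ sub[OF assms(4) e]])
      show "E e \<subseteq> G lam e"
        using g_homogeneous[OF assms(3) AB] by (force simp: E_def A_def)
    qed
    show "G lam e \<subseteq> span (E e)"
    proof
      fix x assume x: "x \<in> G lam e"
      then have xc: "x \<in> car V" using GV[OF assms(4) e] by blast
      then obtain f where f: "x = g f" using g_surj[OF free(3)] by blast
      define K where "K = {M \<in> Poly_Mapping.keys f. set_mset (colors M) \<subseteq> B}"
      have K: "finite K" by (simp add: K_def)
      define t where "t M = smul V (Poly_Mapping.lookup f M) (g (mon M))" for M
      define ix where "ix M = (colors M, deg N M)" for M
      have "g f = (\<Sum>M\<in>Poly_Mapping.keys f. t M)"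
        by (subst jets_expand) (simp add: g.sum g.scale t_def)
      also have "\<dots> = (\<Sum>M\<in>K. t M)"
        by (rule sum.mono_neutral_right) (auto simp: K_def t_def g_outside)
      finally have xt: "x = (\<Sum>M\<in>K. t M)" by (simp add: f)
      define F where "F i = (\<Sum>M\<in>{M \<in> K. ix M = i}. t M)" for i
      have t: "t M \<in> G (colors M) (deg N M)" if "M \<in> K" for M
        using that g_homogeneous[OF assms(3), of M] sub[OF _ deg_half, of "colors M" N M]
        by (auto simp: K_def t_def intro: subspace_scale)
      \<comment> \<open>Grouping the monomials of \<open>f\<close> by weight and degree decomposes \<open>x\<close>, as does \<open>x\<close> itself; so only monomials of weight \<open>lam\<close> and degree \<open>e\<close> survive.\<close>
      have "F i \<in> (\<lambda>(\<mu>, e). G \<mu> e) i" if iI: "i \<in> ?I" for i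
      proof -
        obtain \<mu> e where i: "i = (\<mu>, e)" "set_mset \<mu> \<subseteq> B" "e \<in> half_ints" using iI by auto
        have "F i \<in> G \<mu> e"
          unfolding F_def by (rule subspace_sum[OF sub[OF i(2,3)]]) (use t in \<open>auto simp: ix_def i(1)\<close>)
        then show ?thesis by (simp add: i(1))
      qed
      moreover have "F i = 0" if "i \<notin> ?I" for i
      proof -
        have "{M \<in> K. ix M = i} = {}" using that deg_half by (auto simp: K_def ix_def)
        then show ?thesis by (simp only: F_def sum.empty)
      qed
      moreover have supp: "{i. F i \<noteq> 0} \<subseteq> ix ` K"
      proof
        fix i assume i: "i \<in> {i. F i \<noteq> 0}"
        have "{M \<in> K. ix M = i} \<noteq> {}"
        proof
          assume "{M \<in> K. ix M = i} = {}"
          then have "F i = 0" by (simp only: F_def sum.empty)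
          then show False using i by simp
        qed
        then show "i \<in> ix ` K" by blast
      qed
      moreover have "Sum_any F = x"
      proof -
        have "Sum_any F = sum F (ix ` K)" by (rule Sum_any.expand_superset) (use supp K in auto)
        also have "\<dots> = (\<Sum>M\<in>K. t M)"
          unfolding F_def by (rule sum.image_gen[OF K, symmetric])
        finally show ?thesis by (simp add: xt)
      qed
      ultimately have F: "decomp F x"
        using finite_subset[OF supp] K unfolding decomp_def by blast
      let ?F' = "\<lambda>i. if i = (lam, e) then x else 0"
      have "decomp ?F' x"
        unfolding decomp_def
      proof (intro conjI)
        show "\<forall>i\<in>?I. ?F' i \<in> (\<lambda>(\<mu>, e). G \<mu> e) i" using x subspace_0[OF sub] by auto
        show "\<forall>i. i \<notin> ?I \<longrightarrow> ?F' i = 0" using assms(4) e by auto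
        show "finite {i. ?F' i \<noteq> 0}" by (rule finite_subset[of _ "{(lam, e)}"]) auto
        show "Sum_any ?F' = x"
          by (subst Sum_any.expand_superset[of "{(lam, e)}"]) auto
      qed
      with F have "F = ?F'" by (rule uniq[OF xc])
      then have "x = F (lam, e)" by simp
      also have "\<dots> \<in> span (E e)"
        unfolding F_def t_def
        by (intro span_sum span_scale span_base) (auto simp: E_def A_def ix_def)
      finally show "x \<in> span (E e)" .
    qed
  qed
  have E_indep: "independent (E e)" for e
  proof (rule independent_if_scalars_zero[OF E_fin])
    fix u x assume 0: "(\<Sum>x\<in>E e. smul V (u x) x) = 0" and x: "x \<in> E e"
    obtain M where M: "M \<in> A e" "x = g (mon M)" using x by (auto simp: E_def)
    let ?u = "\<lambda>M. u (g (mon M))"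
    have "g (\<Sum>M\<in>A e. sc (?u M) (mon M)) = 0"
      using 0 by (simp add: E_def sum.reindex[OF inj] g.sum g.scale)
    then have "h (g (\<Sum>M\<in>A e. sc (?u M) (mon M))) = 0"
      using hg.zero by (simp add: g.zero)
    then have "(\<Sum>M\<in>A e. sc (?u M) (mon M)) = (0 :: ('b, 'k) jets)"
      using AB by (simp add: hg.sum hg.scale hg_mon)
    then have "Poly_Mapping.lookup (\<Sum>M\<in>A e. sc (?u M) (mon M) :: ('b, 'k) jets) M = 0"
      by (simp only: lookup_zero)
    then have "(\<Sum>M'\<in>A e. ?u M' * (1 when M' = M)) = 0"
      by (simp add: lookup_sum lookup_sc mon_def lookup_single)
    moreover have "(\<Sum>M'\<in>A e. ?u M' * (1 when M' = M)) = ?u M"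
    proof -
      have "(\<Sum>M'\<in>A e. ?u M' * (1 when M' = M)) = (\<Sum>M'\<in>A e. if M' = M then ?u M else 0)"
        by (intro sum.cong) auto
      then show ?thesis using M(1) A_fin by simp
    qed
    ultimately show "u x = 0" by (simp add: M(2))
  qed
  have min: "min_degree G lam = dmin N lam"
    unfolding min_degree_def
  proof (rule Least_equality)
    \<comment> \<open>The monomial all of whose upper indices are \<open>0\<close> has the least degree.\<close>
    let ?M = "image_mset (Pair 0) lam"
    have M: "colors ?M = lam" "energy ?M = 0" by (auto simp: colors_def multiset.map_comp o_def energy_def)
    then have "?M \<in> A (dmin N lam)" by (simp add: A_def deg_def)
    then have "g (mon ?M) \<in> G lam (dmin N lam)"
      unfolding G_span[OF dmin_half] by (intro span_base) (simp add: E_def)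
    moreover have "g (mon ?M) \<noteq> 0"
      using hg_mon[of ?M] M(1) assms(4) mon_nz[of ?M] hg.zero by (auto simp: g.zero)
    ultimately show "dmin N lam \<in> half_ints \<and> (\<exists>x\<in>G lam (dmin N lam). x \<noteq> 0)"
      using dmin_half by blast
    fix e assume e: "e \<in> half_ints \<and> (\<exists>x\<in>G lam e. x \<noteq> 0)"
    then have "E e \<noteq> {}" using G_span[of e] by auto
    then obtain M where "M \<in> A e" by (auto simp: E_def)
    then show "dmin N lam \<le> e" by (auto simp: A_def deg_def)
  qed
  have "dim (G lam d) = card (E d)"
    unfolding G_span[OF assms(5)] by (rule dim_span_eq_card_independent[OF E_indep])
  also have "\<dots> = card (A d)" unfolding E_def by (rule card_image[OF inj])
  also have "\<dots> = card (bounded_colored_partitions B lam (d - min_degree G lam))"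
    unfolding min by (rule bij_betw_same_card[OF A_bij])
  finally show ?thesis using G_span[OF assms(5)] E_fin by blast
qed

end
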